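(* Let $k$ be a field, $A$ a Hopf algebra over $k$, and $C$ a right $A$-module coalgebra. Let $H(C,A)$ be the Hopf algebra with canonical maps $\imath:H(C)\to H(C,A)$ and $\jmath:A\to H(C,A)$ constructed in the context. Given a Hopf algebra $H$, a coalgebra homomorphism $f:C\to H$, and a Hopf algebra homomorphism $\varphi:A\to H$ satisfying $f(ca)=f(c)\,\varphi(a)$ for all $a\in A$ and $c\in C$, there is a unique Hopf algebra homomorphism $t:H(C,A)\to H$ such that $f=t\circ\imath|_C$ and $\varphi=t\circ\jmath$.
   Context: All algebras are associative unital over $k$. A right $A$-module coalgebra is a coalgebra $C$ with a right $A$-module structure such that $\Delta(ca)=\sum c_{(1)}a_{(1)}\otimes c_{(2)}a_{(2)}$ and $\varepsilon(ca)=\varepsilon(c)\varepsilon(a)$. $H(C)$ denotes Takeuchi's free Hopf algebra on the coalgebra $C$: it comes with a coalgebra map $C\to H(C)$ through which every coalgebra map from $C$ to a Hopf algebra factors via a unique Hopf algebra homomorphism. The map $C\to H(C)$ is injective, and $C$ is identified with a subcoalgebra of $H(C)$. The coproduct $H(C)\coprod A$ of algebras (free product over $k$) has a unique Hopf algebra structure for which the canonical maps $\imath_0:H(C)\to H(C)\coprod A$ and $\jmath_0:A\to H(C)\coprod A$ are Hopf algebra homomorphisms. Put $H(C,A)=(H(C)\coprod A)/I$, where $I$ is the ideal generated by $\{\imath_0(ca)-\imath_0(c)\jmath_0(a)\mid c\in C,\ a\in A\}$; $I$ is a Hopf ideal, so $H(C,A)$ is a Hopf algebra. The maps $\imath:H(C)\to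 H(C,A)$ and $\jmath:A\to H(C,A)$ are the composites of $\imath_0$ and $\jmath_0$ with the canonical map $H(C)\coprod A\to H(C,A)$. *)

theory Defs
  imports "HOL-Algebra.QuotRing" "HOL-Algebra.Module"
begin

section \<open>Linear algebra over a field\<close>

text \<open>
  Throughout, \<open>K\<close> is a field in the sense of \<open>HOL-Algebra\<close> and a vector space over it is a
  \<^locale>\<open>module\<close>.  The record type of modules extends that of rings, so one record type serves
  for vector spaces (whose \<open>mult\<close> and \<open>one\<close> are then irrelevant) and for algebras.
\<close>

definition linear_maps ::
  "('k, 'r) ring_scheme \<Rightarrow> ('k, 'a, 'm) module_scheme \<Rightarrow> ('k, 'b, 'n) module_scheme \<Rightarrow> ('a \<Rightarrow> 'b) set"
where
  "linear_maps K M N =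
    {f \<in> carrier M \<rightarrow> carrier N.
       (\<forall>x \<in> carrier M. \<forall>y \<in> carrier M. f (x \<oplus>\<^bsub>M\<^esub> y) = f x \<oplus>\<^bsub>N\<^esub> f y) \<and>
       (\<forall>a \<in> carrier K. \<forall>x \<in> carrier M. f (a \<odot>\<^bsub>M\<^esub> x) = a \<odot>\<^bsub>N\<^esub> f x)}"

definition self_module :: "('k, 'r) ring_scheme \<Rightarrow> ('k, 'k) module" where
  "self_module K =
    \<lparr>carrier = carrier K, mult = mult K, one = one K, zero = zero K, add = add K,
     smult = mult K\<rparr>"

definition gen_submodule ::
  "('k, 'r) ring_scheme \<Rightarrow> ('k, 'a, 'm) module_scheme \<Rightarrow> 'a set \<Rightarrow> 'a set"
where
  "gen_submodule K M S = \<Inter>{N. submodule N K M \<and> S \<subseteq> N}"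

text \<open>
  The quotient of a module by a submodule, or of an algebra by a two-sided ideal: \<^const>\<open>FactRing\<close>
  together with the induced scalar multiplication.
\<close>

definition quot_module :: "('k, 'a, 'm) module_scheme \<Rightarrow> 'a set \<Rightarrow> ('k, 'a set) module" where
  "quot_module M N =
    \<lparr>carrier = carrier (M Quot N), mult = mult (M Quot N), one = one (M Quot N),
     zero = zero (M Quot N), add = add (M Quot N),
     smult = (\<lambda>a X. \<Union>x\<in>X. N +>\<^bsub>M\<^esub> (a \<odot>\<^bsub>M\<^esub> x))\<rparr>"

text \<open>The map on cosets induced by a map \<open>h\<close> that is constant on cosets.\<close>

definition coset_lift :: "('a \<Rightarrow> 'b) \<Rightarrow> 'a set \<Rightarrow> 'b" where
  "coset_lift h X = the_elem (h ` X)"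

definition single :: "('k, 'r) ring_scheme \<Rightarrow> 'x \<Rightarrow> 'x \<Rightarrow> 'k" where
  "single K x = (\<lambda>y. if y = x then \<one>\<^bsub>K\<^esub> else \<zero>\<^bsub>K\<^esub>)"

definition supp :: "('k, 'r) ring_scheme \<Rightarrow> ('x \<Rightarrow> 'k) \<Rightarrow> 'x set" where
  "supp K f = {x. f x \<noteq> \<zero>\<^bsub>K\<^esub>}"

text \<open>
  The monoid algebra \<open>K[G]\<close>: finitely supported functions on \<open>carrier G\<close> with convolution.
  As a vector space it is the free vector space on \<open>carrier G\<close>, with basis \<open>single K x\<close>.
\<close>

definition monoid_algebra ::
  "('k, 'r) ring_scheme \<Rightarrow> ('x, 'g) monoid_scheme \<Rightarrow> ('k, 'x \<Rightarrow> 'k) module"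
where
  "monoid_algebra K G =
    \<lparr>carrier = {f. range f \<subseteq> carrier K \<and> finite (supp K f) \<and> supp K f \<subseteq> carrier G},
     mult = (\<lambda>f g z. \<Oplus>\<^bsub>K\<^esub>p \<in> {p \<in> supp K f \<times> supp K g. fst p \<otimes>\<^bsub>G\<^esub> snd p = z}.
                        f (fst p) \<otimes>\<^bsub>K\<^esub> g (snd p)),
     one = single K \<one>\<^bsub>G\<^esub>,
     zero = (\<lambda>z. \<zero>\<^bsub>K\<^esub>),
     add = (\<lambda>f g z. f z \<oplus>\<^bsub>K\<^esub> g z),
     smult = (\<lambda>a f z. a \<otimes>\<^bsub>K\<^esub> f z)\<rparr>"

text \<open>The linear extension to the free vector space of a map \<open>g\<close> given on the basis.\<close>

definition lin_ext ::
  "('k, 'r) ring_scheme \<Rightarrow> ('k, 'z, 'm) module_scheme \<Rightarrow> ('x \<Rightarrow> 'z) \<Rightarrow> ('x \<Rightarrow> 'k) \<Rightarrow> 'z"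
where
  "lin_ext K Z g f = (\<Oplus>\<^bsub>Z\<^esub>x \<in> supp K f. f x \<odot>\<^bsub>Z\<^esub> g x)"


section \<open>Tensor products\<close>

text \<open>
  \<open>M \<otimes> N\<close> is the free vector space on \<open>carrier M \<times> carrier N\<close> modulo the bilinearity relations.
  The free vector space is presented as the monoid algebra of \<open>M \<times>\<times> N\<close>, so that when
  \<open>M\<close> and \<open>N\<close> are algebras the product of the quotient is
  \<open>(x \<otimes> y) (x' \<otimes> y') = x x' \<otimes> y y'\<close>.
\<close>

definition tensor_rels ::
  "('k, 'r) ring_scheme \<Rightarrow> ('k, 'a, 'm) module_scheme \<Rightarrow> ('k, 'b, 'n) module_scheme
    \<Rightarrow> ('a \<times> 'b \<Rightarrow> 'k) set"
where
  "tensor_rels K M N = (let F = monoid_algebra K (M \<times>\<times> N); e = (\<lambda>x y. single K (x, y)) in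
     {e (x \<oplus>\<^bsub>M\<^esub> x') y \<ominus>\<^bsub>F\<^esub> (e x y \<oplus>\<^bsub>F\<^esub> e x' y) | x x' y.
        x \<in> carrier M \<and> x' \<in> carrier M \<and> y \<in> carrier N} \<union>
     {e x (y \<oplus>\<^bsub>N\<^esub> y') \<ominus>\<^bsub>F\<^esub> (e x y \<oplus>\<^bsub>F\<^esub> e x y') | x y y'.
        x \<in> carrier M \<and> y \<in> carrier N \<and> y' \<in> carrier N} \<union>
     {e (a \<odot>\<^bsub>M\<^esub> x) y \<ominus>\<^bsub>F\<^esub> a \<odot>\<^bsub>F\<^esub> e x y | a x y.
        a \<in> carrier K \<and> x \<in> carrier M \<and> y \<in> carrier N} \<union>
     {e x (a \<odot>\<^bsub>N\<^esub> y) \<ominus>\<^bsub>F\<^esub> a \<odot>\<^bsub>F\<^esub> e x y | a x y.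
        a \<in> carrier K \<and> x \<in> carrier M \<and> y \<in> carrier N})"

definition tensor_null ::
  "('k, 'r) ring_scheme \<Rightarrow> ('k, 'a, 'm) module_scheme \<Rightarrow> ('k, 'b, 'n) module_scheme
    \<Rightarrow> ('a \<times> 'b \<Rightarrow> 'k) set"
where
  "tensor_null K M N = gen_submodule K (monoid_algebra K (M \<times>\<times> N)) (tensor_rels K M N)"

definition tensor ::
  "('k, 'r) ring_scheme \<Rightarrow> ('k, 'a, 'm) module_scheme \<Rightarrow> ('k, 'b, 'n) module_scheme
    \<Rightarrow> ('k, ('a \<times> 'b \<Rightarrow> 'k) set) module"
where
  "tensor K M N = quot_module (monoid_algebra K (M \<times>\<times> N)) (tensor_null K M N)"

definition pure_tensor ::
  "('k, 'r) ring_scheme \<Rightarrow> ('k, 'a, 'm) module_scheme \<Rightarrow> ('k, 'b, 'n) module_scheme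
    \<Rightarrow> 'a \<Rightarrow> 'b \<Rightarrow> ('a \<times> 'b \<Rightarrow> 'k) set"
where
  "pure_tensor K M N x y = tensor_null K M N +>\<^bsub>monoid_algebra K (M \<times>\<times> N)\<^esub> single K (x, y)"

text \<open>
  The linear map \<open>x \<otimes> y \<mapsto> g x y\<close> into \<open>Z\<close> induced by a bilinear map \<open>g\<close>.  In Sweedler notation,
  \<open>tensor_lift K Z g (comult C c)\<close> is the sum of all \<open>g c\<^sub>(\<^sub>1\<^sub>) c\<^sub>(\<^sub>2\<^sub>)\<close>.
\<close>

definition tensor_lift ::
  "('k, 'r) ring_scheme \<Rightarrow> ('k, 'z, 'm) module_scheme \<Rightarrow> ('a \<Rightarrow> 'b \<Rightarrow> 'z)
    \<Rightarrow> ('a \<times> 'b \<Rightarrow> 'k) set \<Rightarrow> 'z"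
where
  "tensor_lift K Z g = coset_lift (lin_ext K Z (\<lambda>(x, y). g x y))"

text \<open>The map \<open>f \<otimes> g\<close> into \<open>M' \<otimes> N'\<close>.\<close>

definition tensor_map ::
  "('k, 'r) ring_scheme \<Rightarrow> ('k, 'c, 'm) module_scheme \<Rightarrow> ('k, 'd, 'n) module_scheme
    \<Rightarrow> ('a \<Rightarrow> 'c) \<Rightarrow> ('b \<Rightarrow> 'd) \<Rightarrow> ('a \<times> 'b \<Rightarrow> 'k) set \<Rightarrow> ('c \<times> 'd \<Rightarrow> 'k) set"
where
  "tensor_map K M' N' f g =
    tensor_lift K (tensor K M' N') (\<lambda>x y. pure_tensor K M' N' (f x) (g y))"

definition tensor_assoc ::
  "('k, 'r) ring_scheme \<Rightarrow> ('k, 'a, 'm) module_scheme \<Rightarrow> ('k, 'b, 'n) module_scheme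
    \<Rightarrow> ('k, 'c, 'p) module_scheme
    \<Rightarrow> (('a \<times> 'b \<Rightarrow> 'k) set \<times> 'c \<Rightarrow> 'k) set \<Rightarrow> ('a \<times> ('b \<times> 'c \<Rightarrow> 'k) set \<Rightarrow> 'k) set"
where
  "tensor_assoc K L M N =
    (let T = tensor K L (tensor K M N) in
     tensor_lift K T (\<lambda>u z.
       tensor_lift K T (\<lambda>x y. pure_tensor K L (tensor K M N) x (pure_tensor K M N y z)) u))"


section \<open>Coalgebras and Hopf algebras\<close>

record ('k, 'a) coalg = "('k, 'a) module" +
  comult :: "'a \<Rightarrow> ('a \<times> 'a \<Rightarrow> 'k) set"
  counit :: "'a \<Rightarrow> 'k"

record ('k, 'a) hopf = "('k, 'a) coalg" +
  antipode :: "'a \<Rightarrow> 'a"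

locale coalgebra = field K + module K C for K (structure) and C (structure) +
  assumes comult_linear: "comult C \<in> linear_maps K C (tensor K C C)"
    and counit_linear: "counit C \<in> linear_maps K C (self_module K)"
    and coassoc: "c \<in> carrier C \<Longrightarrow>
      tensor_assoc K C C C (tensor_map K (tensor K C C) C (comult C) id (comult C c)) =
      tensor_map K C (tensor K C C) id (comult C) (comult C c)"
    and counit_left: "c \<in> carrier C \<Longrightarrow>
      tensor_lift K C (\<lambda>x y. counit C x \<odot>\<^bsub>C\<^esub> y) (comult C c) = c"
    and counit_right: "c \<in> carrier C \<Longrightarrow>
      tensor_lift K C (\<lambda>x y. counit C y \<odot>\<^bsub>C\<^esub> x) (comult C c) = c"

text \<open>Unlike \<^locale>\<open>algebra\<close>, this does not require commutativity.\<close>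

locale unital_algebra = field K + module K A + ring A for K (structure) and A (structure) +
  assumes smult_mult_left: "\<lbrakk>a \<in> carrier K; x \<in> carrier A; y \<in> carrier A\<rbrakk> \<Longrightarrow>
      (a \<odot>\<^bsub>A\<^esub> x) \<otimes>\<^bsub>A\<^esub> y = a \<odot>\<^bsub>A\<^esub> (x \<otimes>\<^bsub>A\<^esub> y)"
    and smult_mult_right: "\<lbrakk>a \<in> carrier K; x \<in> carrier A; y \<in> carrier A\<rbrakk> \<Longrightarrow>
      x \<otimes>\<^bsub>A\<^esub> (a \<odot>\<^bsub>A\<^esub> y) = a \<odot>\<^bsub>A\<^esub> (x \<otimes>\<^bsub>A\<^esub> y)"

locale bialgebra = unital_algebra K A + coalgebra K A for K (structure) and A (structure) +
  assumes comult_ring_hom: "comult A \<in> ring_hom A (tensor K A A)"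
    and counit_ring_hom: "counit A \<in> ring_hom A K"

locale hopf_algebra = bialgebra K A for K (structure) and A (structure) +
  assumes antipode_linear: "antipode A \<in> linear_maps K A A"
    and antipode_left: "x \<in> carrier A \<Longrightarrow>
      tensor_lift K A (\<lambda>y z. antipode A y \<otimes>\<^bsub>A\<^esub> z) (comult A x) = counit A x \<odot>\<^bsub>A\<^esub> \<one>\<^bsub>A\<^esub>"
    and antipode_right: "x \<in> carrier A \<Longrightarrow>
      tensor_lift K A (\<lambda>y z. y \<otimes>\<^bsub>A\<^esub> antipode A z) (comult A x) = counit A x \<odot>\<^bsub>A\<^esub> \<one>\<^bsub>A\<^esub>"

definition coalgebra_hom ::
  "('k, 'r) ring_scheme \<Rightarrow> ('k, 'a, 'm) coalg_scheme \<Rightarrow> ('k, 'b, 'n) coalg_scheme \<Rightarrow> ('a \<Rightarrow> 'b) set"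
where
  "coalgebra_hom K C D =
    {f \<in> linear_maps K C D. \<forall>c \<in> carrier C.
       comult D (f c) = tensor_map K D D f f (comult C c) \<and> counit D (f c) = counit C c}"

definition hopf_hom ::
  "('k, 'r) ring_scheme \<Rightarrow> ('k, 'a, 'm) hopf_scheme \<Rightarrow> ('k, 'b, 'n) hopf_scheme \<Rightarrow> ('a \<Rightarrow> 'b) set"
where
  "hopf_hom K A B =
    {f \<in> ring_hom A B \<inter> coalgebra_hom K A B. \<forall>x \<in> carrier A. f (antipode A x) = antipode B (f x)}"

text \<open>Right module coalgebras over a Hopf algebra \<open>A\<close>; the action is written \<open>c \<cdot> a\<close>.\<close>

locale module_coalgebra = hopf_algebra K A + C?: coalgebra K C
  for K (structure) and A (structure) and C (structure) +
  fixes act :: "'c \<Rightarrow> 'a \<Rightarrow> 'c"  (infixl \<open>\<cdot>\<close> 70)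
  assumes act_closed: "\<lbrakk>c \<in> carrier C; a \<in> carrier A\<rbrakk> \<Longrightarrow> c \<cdot> a \<in> carrier C"
    and act_add_left: "\<lbrakk>c \<in> carrier C; d \<in> carrier C; a \<in> carrier A\<rbrakk> \<Longrightarrow>
      (c \<oplus>\<^bsub>C\<^esub> d) \<cdot> a = c \<cdot> a \<oplus>\<^bsub>C\<^esub> d \<cdot> a"
    and act_add_right: "\<lbrakk>c \<in> carrier C; a \<in> carrier A; b \<in> carrier A\<rbrakk> \<Longrightarrow>
      c \<cdot> (a \<oplus>\<^bsub>A\<^esub> b) = c \<cdot> a \<oplus>\<^bsub>C\<^esub> c \<cdot> b"
    and act_smult_left: "\<lbrakk>r \<in> carrier K; c \<in> carrier C; a \<in> carrier A\<rbrakk> \<Longrightarrow>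
      (r \<odot>\<^bsub>C\<^esub> c) \<cdot> a = r \<odot>\<^bsub>C\<^esub> (c \<cdot> a)"
    and act_smult_right: "\<lbrakk>r \<in> carrier K; c \<in> carrier C; a \<in> carrier A\<rbrakk> \<Longrightarrow>
      c \<cdot> (r \<odot>\<^bsub>A\<^esub> a) = r \<odot>\<^bsub>C\<^esub> (c \<cdot> a)"
    and act_one: "c \<in> carrier C \<Longrightarrow> c \<cdot> \<one>\<^bsub>A\<^esub> = c"
    and act_mult: "\<lbrakk>c \<in> carrier C; a \<in> carrier A; b \<in> carrier A\<rbrakk> \<Longrightarrow>
      c \<cdot> (a \<otimes>\<^bsub>A\<^esub> b) = (c \<cdot> a) \<cdot> b"
    and act_comult: "\<lbrakk>c \<in> carrier C; a \<in> carrier A\<rbrakk> \<Longrightarrow>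
      comult C (c \<cdot> a) =
      tensor_lift K (tensor K C C)
        (\<lambda>c1 c2. tensor_lift K (tensor K C C)
           (\<lambda>a1 a2. pure_tensor K C C (c1 \<cdot> a1) (c2 \<cdot> a2)) (comult A a)) (comult C c)"
    and act_counit: "\<lbrakk>c \<in> carrier C; a \<in> carrier A\<rbrakk> \<Longrightarrow>
      counit C (c \<cdot> a) = counit C c \<otimes>\<^bsub>K\<^esub> counit A a"


section \<open>Algebras by generators and relations\<close>

definition free_monoid :: "'x set \<Rightarrow> 'x list monoid" where
  "free_monoid X = \<lparr>carrier = lists X, mult = (@), one = []\<rparr>"

definition free_algebra :: "('k, 'r) ring_scheme \<Rightarrow> 'x set \<Rightarrow> ('k, 'x list \<Rightarrow> 'k) module" where
  "free_algebra K X = monoid_algebra K (free_monoid X)"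

text \<open>The algebra map from a free algebra to \<open>B\<close> given on the free generators by \<open>g\<close>.\<close>

definition alg_ext ::
  "('k, 'r) ring_scheme \<Rightarrow> ('k, 'b, 'm) module_scheme \<Rightarrow> ('x \<Rightarrow> 'b) \<Rightarrow> ('x list \<Rightarrow> 'k) \<Rightarrow> 'b"
where
  "alg_ext K B g = lin_ext K B (\<lambda>w. foldr (\<lambda>x b. g x \<otimes>\<^bsub>B\<^esub> b) w \<one>\<^bsub>B\<^esub>)"

definition presented_algebra ::
  "('k, 'r) ring_scheme \<Rightarrow> 'x set \<Rightarrow> ('x list \<Rightarrow> 'k) set \<Rightarrow> ('k, ('x list \<Rightarrow> 'k) set) module"
where
  "presented_algebra K X R = quot_module (free_algebra K X) (Idl\<^bsub>free_algebra K X\<^esub> R)"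

definition generator ::
  "('k, 'r) ring_scheme \<Rightarrow> 'x set \<Rightarrow> ('x list \<Rightarrow> 'k) set \<Rightarrow> 'x \<Rightarrow> ('x list \<Rightarrow> 'k) set"
where
  "generator K X R x = Idl\<^bsub>free_algebra K X\<^esub> R +>\<^bsub>free_algebra K X\<^esub> single K [x]"

definition opposite :: "('k, 'a, 'm) module_scheme \<Rightarrow> ('k, 'a, 'm) module_scheme" where
  "opposite A = A\<lparr>mult := (\<lambda>x y. y \<otimes>\<^bsub>A\<^esub> x)\<rparr>"

definition with_hopf ::
  "('k, 'a, 'm) module_scheme \<Rightarrow> ('a \<Rightarrow> ('a \<times> 'a \<Rightarrow> 'k) set) \<Rightarrow> ('a \<Rightarrow> 'k) \<Rightarrow> ('a \<Rightarrow> 'a) \<Rightarrow> ('k, 'a) hopf"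
where
  "with_hopf A \<Delta> \<epsilon> S =
    \<lparr>carrier = carrier A, mult = mult A, one = one A, zero = zero A, add = add A, smult = smult A,
     comult = \<Delta>, counit = \<epsilon>, antipode = S\<rparr>"

text \<open>
  A presented algebra \<open>P\<close> whose comultiplication \<open>P \<rightarrow> P \<otimes> P\<close> and counit \<open>P \<rightarrow> K\<close> are the algebra maps,
  and whose antipode \<open>P \<rightarrow> P\<^sup>o\<^sup>p\<close> is the algebra map, taking the values \<open>\<delta>\<close>, \<open>e\<close>, \<open>s\<close> on the generators.
\<close>

definition presented_hopf ::
  "('k, 'r) ring_scheme \<Rightarrow> 'x set \<Rightarrow> ('x list \<Rightarrow> 'k) set
    \<Rightarrow> ('x \<Rightarrow> (('x list \<Rightarrow> 'k) set \<times> ('x list \<Rightarrow> 'k) set \<Rightarrow> 'k) set) \<Rightarrow> ('x \<Rightarrow> 'k)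
    \<Rightarrow> ('x \<Rightarrow> ('x list \<Rightarrow> 'k) set) \<Rightarrow> ('k, ('x list \<Rightarrow> 'k) set) hopf"
where
  "presented_hopf K X R \<delta> e s =
    (let P = presented_algebra K X R in
     with_hopf P
       (coset_lift (alg_ext K (tensor K P P) \<delta>))
       (coset_lift (alg_ext K (self_module K) e))
       (coset_lift (alg_ext K (opposite P) s)))"

text \<open>The quotient of a Hopf algebra by a Hopf ideal.\<close>

definition quot_hopf ::
  "('k, 'r) ring_scheme \<Rightarrow> ('k, 'a, 'm) hopf_scheme \<Rightarrow> 'a set \<Rightarrow> ('k, 'a set) hopf"
where
  "quot_hopf K P I =
    (let Q = quot_module P I; \<pi> = (\<lambda>x. I +>\<^bsub>P\<^esub> x) in
     with_hopf Q
       (coset_lift (\<lambda>x. tensor_map K Q Q \<pi> \<pi> (comult P x)))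
       (coset_lift (counit P))
       (coset_lift (\<lambda>x. \<pi> (antipode P x))))"


section \<open>Takeuchi's free Hopf algebra on a coalgebra\<close>

text \<open>
  Let \<open>V\<^sub>i\<close> be \<open>C\<close> for even \<open>i\<close> and the co-opposite coalgebra of \<open>C\<close> for odd \<open>i\<close>, and \<open>V\<close> the
  direct sum of all \<open>V\<^sub>i\<close>.  The tensor algebra \<open>T(V)\<close> is presented by generators \<open>(c, i)\<close>, standing
  for \<open>c \<in> V\<^sub>i\<close>, subject to linearity in \<open>c\<close>.  It is a bialgebra, and it carries the
  algebra map \<open>S\<close> to its opposite that sends \<open>c \<in> V\<^sub>i\<close> to \<open>c \<in> V\<^sub>i\<^sub>+\<^sub>1\<close>.  The free Hopf algebra
  is the quotient of \<open>T(V)\<close> by the ideal that turns \<open>S\<close> into an antipode on all \<open>V\<^sub>i\<close>.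
\<close>

definition takeuchi_gens :: "('k, 'c, 'm) coalg_scheme \<Rightarrow> ('c \<times> nat) set" where
  "takeuchi_gens C = carrier C \<times> UNIV"

definition takeuchi_linear_rels ::
  "('k, 'r) ring_scheme \<Rightarrow> ('k, 'c, 'm) coalg_scheme \<Rightarrow> (('c \<times> nat) list \<Rightarrow> 'k) set"
where
  "takeuchi_linear_rels K C =
    (let F = free_algebra K (takeuchi_gens C); v = (\<lambda>c i. single K [(c, i)]) in
     {v (c \<oplus>\<^bsub>C\<^esub> d) i \<ominus>\<^bsub>F\<^esub> (v c i \<oplus>\<^bsub>F\<^esub> v d i) | c d i. c \<in> carrier C \<and> d \<in> carrier C} \<union>
     {v (a \<odot>\<^bsub>C\<^esub> c) i \<ominus>\<^bsub>F\<^esub> a \<odot>\<^bsub>F\<^esub> v c i | a c i. a \<in> carrier K \<and> c \<in> carrier C})"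

definition takeuchi_var ::
  "('k, 'r) ring_scheme \<Rightarrow> ('k, 'c, 'm) coalg_scheme \<Rightarrow> 'c \<Rightarrow> nat \<Rightarrow> (('c \<times> nat) list \<Rightarrow> 'k) set"
where
  "takeuchi_var K C c i = generator K (takeuchi_gens C) (takeuchi_linear_rels K C) (c, i)"

definition takeuchi_tensor_algebra ::
  "('k, 'r) ring_scheme \<Rightarrow> ('k, 'c, 'm) coalg_scheme \<Rightarrow> ('k, (('c \<times> nat) list \<Rightarrow> 'k) set) hopf"
where
  "takeuchi_tensor_algebra K C =
    (let X = takeuchi_gens C; R = takeuchi_linear_rels K C; v = takeuchi_var K C;
         T = presented_algebra K X R
     in presented_hopf K X R
          (\<lambda>(c, i). tensor_lift K (tensor K T T)
             (\<lambda>x y. if even i then pure_tensor K T T (v x i) (v y i)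
                    else pure_tensor K T T (v y i) (v x i)) (comult C c))
          (\<lambda>(c, i). counit C c)
          (\<lambda>(c, i). v c (Suc i)))"

definition takeuchi_ideal ::
  "('k, 'r) ring_scheme \<Rightarrow> ('k, 'c, 'm) coalg_scheme \<Rightarrow> (('c \<times> nat) list \<Rightarrow> 'k) set set"
where
  "takeuchi_ideal K C =
    (let T = takeuchi_tensor_algebra K C; v = takeuchi_var K C in
     Idl\<^bsub>T\<^esub> (\<Union>c \<in> carrier C. \<Union>i.
       {tensor_lift K T (\<lambda>x y. x \<otimes>\<^bsub>T\<^esub> antipode T y) (comult T (v c i))
          \<ominus>\<^bsub>T\<^esub> counit T (v c i) \<odot>\<^bsub>T\<^esub> \<one>\<^bsub>T\<^esub>,
        tensor_lift K T (\<lambda>x y. antipode T x \<otimes>\<^bsub>T\<^esub> y) (comult T (v c i))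
          \<ominus>\<^bsub>T\<^esub> counit T (v c i) \<odot>\<^bsub>T\<^esub> \<one>\<^bsub>T\<^esub>}))"

definition free_hopf ::
  "('k, 'r) ring_scheme \<Rightarrow> ('k, 'c, 'm) coalg_scheme \<Rightarrow> ('k, (('c \<times> nat) list \<Rightarrow> 'k) set set) hopf"
where
  "free_hopf K C = quot_hopf K (takeuchi_tensor_algebra K C) (takeuchi_ideal K C)"

definition free_hopf_incl ::
  "('k, 'r) ring_scheme \<Rightarrow> ('k, 'c, 'm) coalg_scheme \<Rightarrow> 'c \<Rightarrow> (('c \<times> nat) list \<Rightarrow> 'k) set set"
where
  "free_hopf_incl K C c =
    takeuchi_ideal K C +>\<^bsub>takeuchi_tensor_algebra K C\<^esub> takeuchi_var K C c 0"


section \<open>The coproduct of two Hopf algebras\<close>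

text \<open>
  The free product of algebras \<open>A\<close> and \<open>B\<close>, generated by the elements of both subject to the relations
  making the two canonical maps algebra maps.  The Hopf structure is the one for which the canonical
  maps are Hopf algebra maps.
\<close>

definition free_product_gens ::
  "('k, 'a, 'm) module_scheme \<Rightarrow> ('k, 'b, 'n) module_scheme \<Rightarrow> ('a + 'b) set"
where
  "free_product_gens A B = carrier A <+> carrier B"

definition alg_hom_rels ::
  "('k, 'r) ring_scheme \<Rightarrow> ('k, 'a, 'm) module_scheme \<Rightarrow> ('k, 'f, 'n) module_scheme
    \<Rightarrow> ('a \<Rightarrow> 'f) \<Rightarrow> 'f set"
where
  "alg_hom_rels K A F g =
    {g (x \<oplus>\<^bsub>A\<^esub> y) \<ominus>\<^bsub>F\<^esub> (g x \<oplus>\<^bsub>F\<^esub> g y) | x y. x \<in> carrier A \<and> y \<in> carrier A} \<union>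
    {g (a \<odot>\<^bsub>A\<^esub> x) \<ominus>\<^bsub>F\<^esub> a \<odot>\<^bsub>F\<^esub> g x | a x. a \<in> carrier K \<and> x \<in> carrier A} \<union>
    {g (x \<otimes>\<^bsub>A\<^esub> y) \<ominus>\<^bsub>F\<^esub> g x \<otimes>\<^bsub>F\<^esub> g y | x y. x \<in> carrier A \<and> y \<in> carrier A} \<union>
    {g \<one>\<^bsub>A\<^esub> \<ominus>\<^bsub>F\<^esub> \<one>\<^bsub>F\<^esub>}"

definition free_product_rels ::
  "('k, 'r) ring_scheme \<Rightarrow> ('k, 'a, 'm) module_scheme \<Rightarrow> ('k, 'b, 'n) module_scheme
    \<Rightarrow> (('a + 'b) list \<Rightarrow> 'k) set"
where
  "free_product_rels K A B =
    (let F = free_algebra K (free_product_gens A B) in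
     alg_hom_rels K A F (\<lambda>x. single K [Inl x]) \<union> alg_hom_rels K B F (\<lambda>y. single K [Inr y]))"

definition coprod_inl ::
  "('k, 'r) ring_scheme \<Rightarrow> ('k, 'a, 'm) module_scheme \<Rightarrow> ('k, 'b, 'n) module_scheme
    \<Rightarrow> 'a \<Rightarrow> (('a + 'b) list \<Rightarrow> 'k) set"
where
  "coprod_inl K A B x = generator K (free_product_gens A B) (free_product_rels K A B) (Inl x)"

definition coprod_inr ::
  "('k, 'r) ring_scheme \<Rightarrow> ('k, 'a, 'm) module_scheme \<Rightarrow> ('k, 'b, 'n) module_scheme
    \<Rightarrow> 'b \<Rightarrow> (('a + 'b) list \<Rightarrow> 'k) set"
where
  "coprod_inr K A B y = generator K (free_product_gens A B) (free_product_rels K A B) (Inr y)"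

definition hopf_coprod ::
  "('k, 'r) ring_scheme \<Rightarrow> ('k, 'a, 'm) hopf_scheme \<Rightarrow> ('k, 'b, 'n) hopf_scheme
    \<Rightarrow> ('k, (('a + 'b) list \<Rightarrow> 'k) set) hopf"
where
  "hopf_coprod K A B =
    (let X = free_product_gens A B; R = free_product_rels K A B;
         i = coprod_inl K A B; j = coprod_inr K A B;
         P = presented_algebra K X R
     in presented_hopf K X R
          (case_sum (\<lambda>x. tensor_map K P P i i (comult A x)) (\<lambda>y. tensor_map K P P j j (comult B y)))
          (case_sum (counit A) (counit B))
          (case_sum (\<lambda>x. i (antipode A x)) (\<lambda>y. j (antipode B y))))"


section \<open>The Hopf algebra \<open>H(C, A)\<close>\<close>

type_synonym ('k, 'c, 'a) HCA_pre = "(((('c \<times> nat) list \<Rightarrow> 'k) set set + 'a) list \<Rightarrow> 'k) set"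

definition HCA_ideal ::
  "('k, 'r) ring_scheme \<Rightarrow> ('k, 'c, 'm) coalg_scheme \<Rightarrow> ('k, 'a, 'n) hopf_scheme
    \<Rightarrow> ('c \<Rightarrow> 'a \<Rightarrow> 'c) \<Rightarrow> ('k, 'c, 'a) HCA_pre set"
where
  "HCA_ideal K C A act =
    (let P = hopf_coprod K (free_hopf K C) A;
         i0 = (\<lambda>c. coprod_inl K (free_hopf K C) A (free_hopf_incl K C c));
         j0 = coprod_inr K (free_hopf K C) A
     in Idl\<^bsub>P\<^esub> {i0 (act c a) \<ominus>\<^bsub>P\<^esub> i0 c \<otimes>\<^bsub>P\<^esub> j0 a | c a. c \<in> carrier C \<and> a \<in> carrier A})"

definition HCA ::
  "('k, 'r) ring_scheme \<Rightarrow> ('k, 'c, 'm) coalg_scheme \<Rightarrow> ('k, 'a, 'n) hopf_scheme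
    \<Rightarrow> ('c \<Rightarrow> 'a \<Rightarrow> 'c) \<Rightarrow> ('k, ('k, 'c, 'a) HCA_pre set) hopf"
where
  "HCA K C A act = quot_hopf K (hopf_coprod K (free_hopf K C) A) (HCA_ideal K C A act)"

definition HCA_iota ::
  "('k, 'r) ring_scheme \<Rightarrow> ('k, 'c, 'm) coalg_scheme \<Rightarrow> ('k, 'a, 'n) hopf_scheme
    \<Rightarrow> ('c \<Rightarrow> 'a \<Rightarrow> 'c) \<Rightarrow> (('c \<times> nat) list \<Rightarrow> 'k) set set \<Rightarrow> ('k, 'c, 'a) HCA_pre set"
where
  "HCA_iota K C A act x =
    HCA_ideal K C A act +>\<^bsub>hopf_coprod K (free_hopf K C) A\<^esub> coprod_inl K (free_hopf K C) A x"

definition HCA_jmath ::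
  "('k, 'r) ring_scheme \<Rightarrow> ('k, 'c, 'm) coalg_scheme \<Rightarrow> ('k, 'a, 'n) hopf_scheme
    \<Rightarrow> ('c \<Rightarrow> 'a \<Rightarrow> 'c) \<Rightarrow> 'a \<Rightarrow> ('k, 'c, 'a) HCA_pre set"
where
  "HCA_jmath K C A act y =
    HCA_ideal K C A act +>\<^bsub>hopf_coprod K (free_hopf K C) A\<^esub> coprod_inr K (free_hopf K C) A y"

end

theory Submission
  imports Defs
begin

text \<open>
  Each of the four constructions involved (tensor algebra, free Hopf algebra, coproduct, \<open>H(C, A)\<close>)
  is a quotient on which comultiplication, counit and antipode are algebra maps (the last one into
  the opposite algebra).  Hence everything about it may be checked on generators, both that the
  structure maps pass to the quotient and that an algebra map into \<open>H\<close> is a Hopf algebra map.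
  The map \<open>t\<close> sends the generator \<open>c \<in> V\<^sub>i\<close> of the tensor algebra to \<open>S\<^sup>i (f c)\<close>, where \<open>S\<close> is the
  antipode of \<open>H\<close>, and \<open>a \<in> A\<close> to \<open>\<phi> a\<close>; commuting with antipodes leaves no other choice.

  The checks on generators rest on two convolution arguments.  First,
  \<open>\<Sum> g(c\<^sub>1) g'(c\<^sub>4) \<otimes> g(c\<^sub>2) g'(c\<^sub>3) = \<epsilon>(c) 1 \<otimes> 1\<close> whenever \<open>g'\<close> is a right convolution inverse of \<open>g\<close>;
  this makes antipodes reverse coproducts and makes Takeuchi's ideal a coideal.  Second, a left and a
  right convolution inverse of \<open>c \<otimes> a \<mapsto> i(c) j(a)\<close> coincide; this makes antipodes reverse products
  and shows that the antipode preserves the relations \<open>i(c a) = i(c) j(a)\<close>.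
\<close>

section \<open>Linear and bilinear maps\<close>

text \<open>Algebra maps out of a presented algebra see only its algebra generators, and the algebra
  generated by C inside a Hopf algebra need not be stable under the antipode. Hence one copy of C
  for every power of the antipode: with all of them as generators, the antipode is prescribed by a
  shift of degree. Parity enters because an antipode reverses coproducts, so that its i-th power
  does so exactly for odd i.

  The obstacle is the stability of two ideals under the structure maps. For Takeuchi's ideal the
  antipode is harmless, since it carries relations of degree i to relations of degree i + 1, and the
  work lies in the coproduct. For H(C, A) it is the other way round: the coproduct respects i(c a) =
  i(c) j(a) by the module coalgebra axiom, but the antipode turns this relation into i'(c a) = j'(a)
  i'(c), with i' and j' the composites of i and j with the antipodes. This does not follow from the
  relation by multiplication alone; it is obtained from the uniqueness of convolution inverses over
  C \<otimes> A.\<close>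

locale ground_field = field K for K :: "('k, 'r) ring_scheme" (structure)
begin

lemma linear_mapsI:
  assumes "\<And>x. x \<in> carrier M \<Longrightarrow> f x \<in> carrier N"
    and "\<And>x y. \<lbrakk>x \<in> carrier M; y \<in> carrier M\<rbrakk> \<Longrightarrow> f (x \<oplus>\<^bsub>M\<^esub> y) = f x \<oplus>\<^bsub>N\<^esub> f y"
    and "\<And>a x. \<lbrakk>a \<in> carrier K; x \<in> carrier M\<rbrakk> \<Longrightarrow> f (a \<odot>\<^bsub>M\<^esub> x) = a \<odot>\<^bsub>N\<^esub> f x"
  shows "f \<in> linear_maps K M N"
  using assms by (auto simp: linear_maps_def)

lemma linear_maps_closed: "\<lbrakk>f \<in> linear_maps K M N; x \<in> carrier M\<rbrakk> \<Longrightarrow> f x \<in> carrier N"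
  by (auto simp: linear_maps_def)

lemma linear_maps_add:
  "\<lbrakk>f \<in> linear_maps K M N; x \<in> carrier M; y \<in> carrier M\<rbrakk> \<Longrightarrow> f (x \<oplus>\<^bsub>M\<^esub> y) = f x \<oplus>\<^bsub>N\<^esub> f y"
  by (auto simp: linear_maps_def)

lemma linear_maps_smult:
  "\<lbrakk>f \<in> linear_maps K M N; a \<in> carrier K; x \<in> carrier M\<rbrakk> \<Longrightarrow> f (a \<odot>\<^bsub>M\<^esub> x) = a \<odot>\<^bsub>N\<^esub> f x"
  by (auto simp: linear_maps_def)

lemma linear_maps_zero:
  assumes M: "module K M" and N: "module K N" and f: "f \<in> linear_maps K M N"
  shows "f \<zero>\<^bsub>M\<^esub> = \<zero>\<^bsub>N\<^esub>"
proof -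
  interpret M: module K M by fact
  interpret N: module K N by fact
  have "f (\<zero>\<^bsub>K\<^esub> \<odot>\<^bsub>M\<^esub> \<zero>\<^bsub>M\<^esub>) = \<zero>\<^bsub>K\<^esub> \<odot>\<^bsub>N\<^esub> f \<zero>\<^bsub>M\<^esub>"
    by (rule linear_maps_smult[OF f]) auto
  then show ?thesis
    using linear_maps_closed[OF f M.zero_closed] by simp
qed

lemma linear_maps_a_inv:
  assumes M: "module K M" and N: "module K N" and f: "f \<in> linear_maps K M N" and x: "x \<in> carrier M"
  shows "f (\<ominus>\<^bsub>M\<^esub> x) = \<ominus>\<^bsub>N\<^esub> f x"
proof -
  interpret M: module K M by fact
  interpret N: module K N by fact
  have "f (\<ominus>\<^bsub>M\<^esub> x) \<oplus>\<^bsub>N\<^esub> f x = f (\<ominus>\<^bsub>M\<^esub> x \<oplus>\<^bsub>M\<^esub> x)"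
    using x by (simp add: linear_maps_add[OF f])
  also have "\<dots> = \<zero>\<^bsub>N\<^esub>"
    using x by (simp add: M.l_neg linear_maps_zero[OF M N f])
  finally show ?thesis
    using x by (metis M.a_inv_closed N.minus_equality linear_maps_closed[OF f])
qed

lemma linear_maps_minus:
  assumes M: "module K M" and N: "module K N" and f: "f \<in> linear_maps K M N"
    and x: "x \<in> carrier M" and y: "y \<in> carrier M"
  shows "f (x \<ominus>\<^bsub>M\<^esub> y) = f x \<ominus>\<^bsub>N\<^esub> f y"
proof -
  interpret M: module K M by fact
  show ?thesis
    using x y by (simp add: a_minus_def linear_maps_add[OF f] linear_maps_a_inv[OF M N f])
qed

text \<open>No finiteness is assumed: over an infinite index set \<open>finsum\<close> is zero on
  both sides, and f preserves zero.\<close>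

lemma linear_maps_finsum:
  assumes M: "module K M" and N: "module K N" and f: "f \<in> linear_maps K M N"
    and g: "g \<in> A \<rightarrow> carrier M"
  shows "f (finsum M g A) = finsum N (\<lambda>x. f (g x)) A"
proof -
  interpret M: module K M by fact
  interpret N: module K N by fact
  show ?thesis
    using g
  proof (induction A rule: infinite_finite_induct)
    case (insert x A)
    then have "(\<lambda>x. f (g x)) \<in> A \<rightarrow> carrier N" "f (g x) \<in> carrier N" "g x \<in> carrier M" "g \<in> A \<rightarrow> carrier M"
      by (auto intro: linear_maps_closed[OF f])
    with insert show ?case
      by (simp add: linear_maps_add[OF f])
  qed (simp_all add: linear_maps_zero[OF M N f])
qed

lemma linear_maps_id: "(\<lambda>x. x) \<in> linear_maps K M M"
  by (simp add: linear_maps_def)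

lemma linear_maps_comp:
  assumes "g \<in> linear_maps K N P" "f \<in> linear_maps K M N"
  shows "(\<lambda>x. g (f x)) \<in> linear_maps K M P"
  using assms by (auto simp: linear_maps_def Pi_iff)

text \<open>Membership in \<open>linear_maps\<close> depends only on the values on the carrier,
  which is closed under the module operations.\<close>

lemma linear_maps_cong:
  assumes "module K M" "f \<in> linear_maps K M N" "\<And>x. x \<in> carrier M \<Longrightarrow> g x = f x"
  shows "g \<in> linear_maps K M N"
proof -
  interpret M: module K M by fact
  show ?thesis
    using assms(2,3) by (auto simp: linear_maps_def Pi_iff)
qed

lemma module_self: "module K (self_module K)"
proof (rule moduleI)
  show "abelian_group (self_module K)"
    by (rule abelian_groupI)
      (auto simp: self_module_def a_ac intro!: bexI[of _ "\<ominus> _"] simp: l_neg)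
qed (auto simp: self_module_def is_cring l_distr r_distr m_assoc)

lemma linear_maps_smult_left:
  assumes N: "module K N" and f: "f \<in> linear_maps K M (self_module K)" and z: "z \<in> carrier N"
  shows "(\<lambda>x. f x \<odot>\<^bsub>N\<^esub> z) \<in> linear_maps K M N"
proof -
  interpret N: module K N by fact
  show ?thesis
    using f z by (auto simp: linear_maps_def Pi_iff self_module_def N.smult_l_distr N.smult_assoc1)
qed

lemma linear_maps_smult_right:
  assumes N: "module K N" and f: "f \<in> linear_maps K M N" and a: "a \<in> carrier K"
  shows "(\<lambda>x. a \<odot>\<^bsub>N\<^esub> f x) \<in> linear_maps K M N"
proof -
  interpret N: module K N by fact
  show ?thesis
    using f a by (auto simp: linear_maps_def Pi_iff N.smult_r_distr N.smult_assoc1[symmetric] m_comm)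
qed

lemma module_unital_algebra: "unital_algebra K A \<Longrightarrow> module K A"
  by (simp add: unital_algebra_def)

lemma ring_unital_algebra: "unital_algebra K A \<Longrightarrow> ring A"
  by (simp add: unital_algebra_def)

lemma linear_maps_mult_left:
  assumes A: "unital_algebra K A" and f: "f \<in> linear_maps K M A" and b: "b \<in> carrier A"
  shows "(\<lambda>x. f x \<otimes>\<^bsub>A\<^esub> b) \<in> linear_maps K M A"
proof -
  interpret A: unital_algebra K A by fact
  show ?thesis
    using f b by (auto simp: linear_maps_def Pi_iff A.l_distr A.smult_mult_left)
qed

lemma linear_maps_mult_right:
  assumes A: "unital_algebra K A" and f: "f \<in> linear_maps K M A" and b: "b \<in> carrier A"
  shows "(\<lambda>x. b \<otimes>\<^bsub>A\<^esub> f x) \<in> linear_maps K M A"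
proof -
  interpret A: unital_algebra K A by fact
  show ?thesis
    using f b by (auto simp: linear_maps_def Pi_iff A.r_distr A.smult_mult_right)
qed

text \<open>Given through the partial maps, so that the rules on linear maps apply to one variable
  at a time.\<close>

definition bilinear ::
  "('k, 'x, 'm) module_scheme \<Rightarrow> ('k, 'y, 'n) module_scheme \<Rightarrow> ('k, 'z, 'p) module_scheme
    \<Rightarrow> ('x \<Rightarrow> 'y \<Rightarrow> 'z) \<Rightarrow> bool"
  where "bilinear M N Z g \<longleftrightarrow>
    (\<forall>y \<in> carrier N. (\<lambda>x. g x y) \<in> linear_maps K M Z) \<and>
    (\<forall>x \<in> carrier M. (\<lambda>y. g x y) \<in> linear_maps K N Z)"

lemma bilinearI:
  assumes "\<And>y. y \<in> carrier N \<Longrightarrow> (\<lambda>x. g x y) \<in> linear_maps K M Z"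
    and "\<And>x. x \<in> carrier M \<Longrightarrow> (\<lambda>y. g x y) \<in> linear_maps K N Z"
  shows "bilinear M N Z g"
  using assms by (simp add: bilinear_def)

lemma bilinear_closed:
  "\<lbrakk>bilinear M N Z g; x \<in> carrier M; y \<in> carrier N\<rbrakk> \<Longrightarrow> g x y \<in> carrier Z"
  unfolding bilinear_def by (blast intro: linear_maps_closed)

text \<open>A linear f stands in front of the argument because in applications the argument is a
  compound expression; \<open>linear_maps_id\<close> recovers the plain case.\<close>

lemma bilinear_left:
  "\<lbrakk>bilinear M N Z g; f \<in> linear_maps K P M; y \<in> carrier N\<rbrakk> \<Longrightarrow> (\<lambda>x. g (f x) y) \<in> linear_maps K P Z"
  unfolding bilinear_def by (blast intro: linear_maps_comp[where g = "\<lambda>x. g x y"])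

lemma bilinear_right:
  "\<lbrakk>bilinear M N Z g; f \<in> linear_maps K P N; x \<in> carrier M\<rbrakk> \<Longrightarrow> (\<lambda>y. g x (f y)) \<in> linear_maps K P Z"
  unfolding bilinear_def by (blast intro: linear_maps_comp[where g = "\<lambda>y. g x y"])

section \<open>Free vector spaces and monoid algebras\<close>

lemma single_self [simp]: "single K x x = \<one>"
  and single_other: "y \<noteq> x \<Longrightarrow> single K x y = \<zero>"
  by (simp_all add: single_def)

lemma supp_single: "supp K (single K x) = {x}"
  by (auto simp: supp_def single_def)

text \<open>Any finite set outside which f vanishes serves as witness, so the exact support, which
  may shrink by cancellation, is never computed.\<close>

lemma monoid_algebra_carrierI:
  assumes "\<And>x. f x \<in> carrier K" "finite S" "S \<subseteq> carrier G" "\<And>x. x \<notin> S \<Longrightarrow> f x = \<zero>"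
  shows "f \<in> carrier (monoid_algebra K G)"
proof -
  have "supp K f \<subseteq> S"
    using assms(4) by (auto simp: supp_def)
  then show ?thesis
    using assms(1-3) by (auto simp: monoid_algebra_def finite_subset)
qed

lemma monoid_algebra_carrierD:
  assumes "f \<in> carrier (monoid_algebra K G)"
  shows "f x \<in> carrier K" "finite (supp K f)" "supp K f \<subseteq> carrier G"
  using assms by (auto simp: monoid_algebra_def)

lemma single_closed: "x \<in> carrier G \<Longrightarrow> single K x \<in> carrier (monoid_algebra K G)"
  by (rule monoid_algebra_carrierI[of _ "{x}"]) (auto simp: single_def)

lemma not_in_supp: "x \<notin> supp K f \<Longrightarrow> f x = \<zero>"
  by (simp add: supp_def)

lemma monoid_algebra_add [simp]: "(f \<oplus>\<^bsub>monoid_algebra K G\<^esub> g) = (\<lambda>x. f x \<oplus> g x)"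
  and monoid_algebra_zero [simp]: "\<zero>\<^bsub>monoid_algebra K G\<^esub> = (\<lambda>x. \<zero>)"
  and monoid_algebra_smult [simp]: "(a \<odot>\<^bsub>monoid_algebra K G\<^esub> f) = (\<lambda>x. a \<otimes> f x)"
  and monoid_algebra_one [simp]: "\<one>\<^bsub>monoid_algebra K G\<^esub> = single K \<one>\<^bsub>G\<^esub>"
  by (simp_all add: monoid_algebra_def)

lemma monoid_algebra_add_closed:
  assumes "f \<in> carrier (monoid_algebra K G)" "g \<in> carrier (monoid_algebra K G)"
  shows "(\<lambda>x. f x \<oplus> g x) \<in> carrier (monoid_algebra K G)"
  by (rule monoid_algebra_carrierI[of _ "supp K f \<union> supp K g"])
    (use assms[THEN monoid_algebra_carrierD(1)] assms[THEN monoid_algebra_carrierD(2)]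
      assms[THEN monoid_algebra_carrierD(3)] in \<open>auto simp: not_in_supp\<close>)

lemma monoid_algebra_smult_closed:
  assumes "a \<in> carrier K" "f \<in> carrier (monoid_algebra K G)"
  shows "(\<lambda>x. a \<otimes> f x) \<in> carrier (monoid_algebra K G)"
  by (rule monoid_algebra_carrierI[of _ "supp K f"])
    (use assms(1) monoid_algebra_carrierD[OF assms(2)] in \<open>auto simp: not_in_supp\<close>)

lemma monoid_algebra_zero_closed: "(\<lambda>x. \<zero>) \<in> carrier (monoid_algebra K G)"
  by (rule monoid_algebra_carrierI[of _ "{}"]) auto

lemma module_monoid_algebra: "module K (monoid_algebra K G)"
proof (rule moduleI)
  note D = monoid_algebra_carrierD(1)[where G = G]
  show "abelian_group (monoid_algebra K G)"
  proof (rule abelian_groupI)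
    fix f assume f: "f \<in> carrier (monoid_algebra K G)"
    \<comment> \<open>The negative of f is taken as (-1) f, so that its closure is that of scalar
      multiples.\<close>
    have "(\<lambda>x. (\<ominus> \<one>) \<otimes> f x) \<in> carrier (monoid_algebra K G)"
      by (rule monoid_algebra_smult_closed) (use f in auto)
    moreover have "(\<lambda>x. (\<ominus> \<one>) \<otimes> f x) \<oplus>\<^bsub>monoid_algebra K G\<^esub> f = \<zero>\<^bsub>monoid_algebra K G\<^esub>"
      using D[OF f] by (auto simp: l_minus l_neg)
    ultimately show "\<exists>g\<in>carrier (monoid_algebra K G). g \<oplus>\<^bsub>monoid_algebra K G\<^esub> f = \<zero>\<^bsub>monoid_algebra K G\<^esub>"
      by blast
  qed (auto simp: monoid_algebra_add_closed monoid_algebra_zero_closed D a_ac)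
qed (auto simp: monoid_algebra_smult_closed monoid_algebra_carrierD(1)[where G = G] is_cring l_distr r_distr m_assoc)

text \<open>Sums over different supports can be compared only over a common finite index set; the
  terms added have coefficient zero.\<close>

lemma lin_ext_superset:
  assumes Z: "module K Z" and f: "f \<in> carrier (monoid_algebra K G)"
    and S: "finite S" "supp K f \<subseteq> S" and g: "\<And>x. x \<in> S \<Longrightarrow> g x \<in> carrier Z"
  shows "lin_ext K Z g f = (\<Oplus>\<^bsub>Z\<^esub>x \<in> S. f x \<odot>\<^bsub>Z\<^esub> g x)"
proof -
  interpret Z: module K Z by fact
  show ?thesis
    unfolding lin_ext_def
    by (rule Z.add.finprod_mono_neutral_cong_left)
      (use S g monoid_algebra_carrierD(1)[OF f] in \<open>auto simp: not_in_supp\<close>)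
qed

lemma lin_ext_linear:
  assumes Z: "module K Z" and g: "\<And>x. x \<in> carrier G \<Longrightarrow> g x \<in> carrier Z"
  shows "lin_ext K Z g \<in> linear_maps K (monoid_algebra K G) Z"
proof (rule linear_mapsI)
  interpret Z: module K Z by fact
  let ?F = "monoid_algebra K G"
  interpret F: module K ?F by (rule module_monoid_algebra)
  note D = monoid_algebra_carrierD[where G = G]
  show "lin_ext K Z g f \<in> carrier Z" if "f \<in> carrier ?F" for f
    unfolding lin_ext_def using D[OF that] g by (intro Z.finsum_closed) auto
  show "lin_ext K Z g (f \<oplus>\<^bsub>?F\<^esub> f') = lin_ext K Z g f \<oplus>\<^bsub>Z\<^esub> lin_ext K Z g f'"
    if f: "f \<in> carrier ?F" and f': "f' \<in> carrier ?F" for f f'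
  proof -
    let ?S = "supp K f \<union> supp K f'"
    have S: "finite ?S" "supp K (f \<oplus>\<^bsub>?F\<^esub> f') \<subseteq> ?S" "?S \<subseteq> carrier G"
      using D[OF f] D[OF f'] by (auto simp: supp_def)
    have eq: "lin_ext K Z g h = (\<Oplus>\<^bsub>Z\<^esub>x \<in> ?S. h x \<odot>\<^bsub>Z\<^esub> g x)"
      if "h \<in> {f, f', f \<oplus>\<^bsub>?F\<^esub> f'}" for h
      by (rule lin_ext_superset[OF Z, of _ G]) (use that S g f f' F.a_closed[OF f f'] in auto)
    have "(\<Oplus>\<^bsub>Z\<^esub>x \<in> ?S. (f \<oplus>\<^bsub>?F\<^esub> f') x \<odot>\<^bsub>Z\<^esub> g x)
        = (\<Oplus>\<^bsub>Z\<^esub>x \<in> ?S. f x \<odot>\<^bsub>Z\<^esub> g x \<oplus>\<^bsub>Z\<^esub> f' x \<odot>\<^bsub>Z\<^esub> g x)"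
      using S g D(1)[OF f] D(1)[OF f'] by (intro Z.finsum_cong') (auto simp: Z.smult_l_distr)
    also have "\<dots> = (\<Oplus>\<^bsub>Z\<^esub>x \<in> ?S. f x \<odot>\<^bsub>Z\<^esub> g x) \<oplus>\<^bsub>Z\<^esub> (\<Oplus>\<^bsub>Z\<^esub>x \<in> ?S. f' x \<odot>\<^bsub>Z\<^esub> g x)"
      using S g D(1)[OF f] D(1)[OF f'] by (intro Z.finsum_addf) auto
    finally show ?thesis
      by (simp only: eq insertI1 insertI2)
  qed
  show "lin_ext K Z g (a \<odot>\<^bsub>?F\<^esub> f) = a \<odot>\<^bsub>Z\<^esub> lin_ext K Z g f"
    if a: "a \<in> carrier K" and f: "f \<in> carrier ?F" for a f
  proof -
    have "lin_ext K Z g (a \<odot>\<^bsub>?F\<^esub> f) = (\<Oplus>\<^bsub>Z\<^esub>x \<in> supp K f. (a \<odot>\<^bsub>?F\<^esub> f) x \<odot>\<^bsub>Z\<^esub> g x)"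
      by (rule lin_ext_superset[OF Z F.smult_closed[OF a f]])
        (use D[OF f] a g in \<open>auto simp: supp_def\<close>)
    also have "\<dots> = (\<Oplus>\<^bsub>Z\<^esub>x \<in> supp K f. a \<odot>\<^bsub>Z\<^esub> (f x \<odot>\<^bsub>Z\<^esub> g x))"
      using D[OF f] a g by (intro Z.finsum_cong') (auto simp: Z.smult_assoc1)
    also have "\<dots> = a \<odot>\<^bsub>Z\<^esub> lin_ext K Z g f"
      unfolding lin_ext_def using D[OF f] a g by (subst Z.finsum_smult_ldistr) auto
    finally show ?thesis .
  qed
qed

lemma lin_ext_single:
  assumes Z: "module K Z" and g: "g x \<in> carrier Z"
  shows "lin_ext K Z g (single K x) = g x"
proof -
  interpret Z: module K Z by fact
  show ?thesis
    unfolding lin_ext_def supp_single using g by simp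
qed

text \<open>Expansion in the basis of the vectors \<open>single K x\<close>. Evaluation at z is
  linear, so the claim moves into K, where at most the term x = z survives.\<close>

lemma monoid_algebra_decomp:
  assumes f: "f \<in> carrier (monoid_algebra K G)"
  shows "lin_ext K (monoid_algebra K G) (single K) f = f"
proof
  let ?F = "monoid_algebra K G"
  interpret F: module K ?F by (rule module_monoid_algebra)
  note D = monoid_algebra_carrierD[OF f]
  fix z
  have ev: "(\<lambda>h. h z) \<in> linear_maps K ?F (self_module K)"
    by (rule linear_mapsI) (auto simp: self_module_def monoid_algebra_carrierD)
  have "lin_ext K ?F (single K) f z = (\<Oplus>\<^bsub>self_module K\<^esub>x\<in>supp K f. (f x \<odot>\<^bsub>?F\<^esub> single K x) z)"
    unfolding lin_ext_def
    using D single_closed[of _ G]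
    by (intro linear_maps_finsum[OF F.module_axioms module_self ev]) (auto simp del: monoid_algebra_smult)
  \<comment> \<open>\<open>finsum\<close> reads only carrier, zero and addition, which
    \<open>self_module K\<close> shares with K.\<close>
  also have "\<dots> = (\<Oplus>x\<in>supp K f. f x \<otimes> single K x z)"
    by (simp add: finsum_def finprod_def self_module_def)
  also have "\<dots> = f z"
  proof (cases "z \<in> supp K f")
    case True
    have "(\<Oplus>x\<in>supp K f. f x \<otimes> single K x z) = (\<Oplus>x\<in>supp K f. if z = x then f x else \<zero>)"
      using D by (intro finsum_cong') (auto simp: single_def)
    then show ?thesis
      using True D by (simp add: finsum_singleton)
  next
    case False
    have "(\<Oplus>x\<in>supp K f. f x \<otimes> single K x z) = (\<Oplus>x\<in>supp K f. \<zero>)"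
      using D False by (intro finsum_cong') (auto simp: single_def)
    then show ?thesis
      using False by (simp add: not_in_supp)
  qed
  finally show "lin_ext K ?F (single K) f z = f z" .
qed

lemma linear_eq_lin_ext:
  assumes Z: "module K Z" and h: "h \<in> linear_maps K (monoid_algebra K G) Z"
    and f: "f \<in> carrier (monoid_algebra K G)"
  shows "h f = lin_ext K Z (\<lambda>x. h (single K x)) f"
proof -
  let ?F = "monoid_algebra K G"
  interpret F: module K ?F by (rule module_monoid_algebra)
  interpret Z: module K Z by fact
  note D = monoid_algebra_carrierD[OF f]
  have s: "single K x \<in> carrier ?F" if "x \<in> supp K f" for x
    using that D(3) by (intro single_closed) auto
  have "h f = h (\<Oplus>\<^bsub>?F\<^esub>x \<in> supp K f. f x \<odot>\<^bsub>?F\<^esub> single K x)"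
    using monoid_algebra_decomp[OF f] by (simp add: lin_ext_def)
  also have "\<dots> = (\<Oplus>\<^bsub>Z\<^esub>x \<in> supp K f. h (f x \<odot>\<^bsub>?F\<^esub> single K x))"
    by (rule linear_maps_finsum[OF F.module_axioms Z h]) (use s D in \<open>auto simp del: monoid_algebra_smult\<close>)
  also have "\<dots> = (\<Oplus>\<^bsub>Z\<^esub>x \<in> supp K f. f x \<odot>\<^bsub>Z\<^esub> h (single K x))"
    by (rule Z.finsum_cong') (use s D linear_maps_closed[OF h] linear_maps_smult[OF h] in auto)
  finally show ?thesis
    by (simp add: lin_ext_def)
qed

text \<open>The basis principle; identities in monoid algebras, and through them in tensor products
  and free algebras, are reduced to basis elements by it.\<close>

lemma linear_eq_on_singles:
  assumes Z: "module K Z" and h: "h \<in> linear_maps K (monoid_algebra K G) Z"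
    and h': "h' \<in> linear_maps K (monoid_algebra K G) Z"
    and eq: "\<And>x. x \<in> carrier G \<Longrightarrow> h (single K x) = h' (single K x)"
    and f: "f \<in> carrier (monoid_algebra K G)"
  shows "h f = h' f"
proof -
  interpret Z: module K Z by fact
  have "h' (single K x) \<in> carrier Z" if "x \<in> carrier G" for x
    using that by (intro linear_maps_closed[OF h'] single_closed)
  then have "lin_ext K Z (\<lambda>x. h (single K x)) f = lin_ext K Z (\<lambda>x. h' (single K x)) f"
    unfolding lin_ext_def using monoid_algebra_carrierD[OF f] eq by (intro Z.finsum_cong') auto
  then show ?thesis
    by (simp only: linear_eq_lin_ext[OF Z h f] linear_eq_lin_ext[OF Z h' f])
qed

section \<open>The convolution product of a monoid algebra\<close>

lemma monoid_algebra_mult: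
  "mult (monoid_algebra K G) = (\<lambda>f g z.
    \<Oplus>p \<in> {p \<in> supp K f \<times> supp K g. fst p \<otimes>\<^bsub>G\<^esub> snd p = z}. f (fst p) \<otimes> g (snd p))"
  unfolding monoid_algebra_def by (rule monoid.simps)

text \<open>A sum over a full rectangle, with the condition on the product moved into the summand:
  the index set no longer depends on z and may be chosen alike for several factors. Bilinearity then
  becomes a termwise identity.\<close>

lemma monoid_algebra_mult_superset:
  assumes f: "f \<in> carrier (monoid_algebra K G)" and g: "g \<in> carrier (monoid_algebra K G)"
    and A: "finite A" "supp K f \<subseteq> A" and B: "finite B" "supp K g \<subseteq> B"
  shows "(f \<otimes>\<^bsub>monoid_algebra K G\<^esub> g) z =
    (\<Oplus>p \<in> A \<times> B. if fst p \<otimes>\<^bsub>G\<^esub> snd p = z then f (fst p) \<otimes> g (snd p) else \<zero>)"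
proof -
  have "(f \<otimes>\<^bsub>monoid_algebra K G\<^esub> g) z =
    (\<Oplus>p \<in> {p \<in> supp K f \<times> supp K g. fst p \<otimes>\<^bsub>G\<^esub> snd p = z}. f (fst p) \<otimes> g (snd p))"
    unfolding monoid_algebra_mult by (rule refl)
  also have "\<dots> = (\<Oplus>p \<in> A \<times> B. if fst p \<otimes>\<^bsub>G\<^esub> snd p = z then f (fst p) \<otimes> g (snd p) else \<zero>)"
  proof (rule add.finprod_mono_neutral_cong_left)
    fix p assume p: "p \<in> A \<times> B - {p \<in> supp K f \<times> supp K g. fst p \<otimes>\<^bsub>G\<^esub> snd p = z}"
    have "f (fst p) = \<zero> \<or> g (snd p) = \<zero>" if "fst p \<otimes>\<^bsub>G\<^esub> snd p = z"
      using p that by (simp add: mem_Times_iff supp_def)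
    then show "(if fst p \<otimes>\<^bsub>G\<^esub> snd p = z then f (fst p) \<otimes> g (snd p) else \<zero>) = \<zero>"
      using monoid_algebra_carrierD(1)[OF f, of "fst p"] monoid_algebra_carrierD(1)[OF g, of "snd p"] by auto
  qed (use A B monoid_algebra_carrierD(1)[OF f] monoid_algebra_carrierD(1)[OF g] in auto)
  finally show ?thesis .
qed

lemma monoid_algebra_mult_closed:
  assumes G: "monoid G" and f: "f \<in> carrier (monoid_algebra K G)" and g: "g \<in> carrier (monoid_algebra K G)"
  shows "f \<otimes>\<^bsub>monoid_algebra K G\<^esub> g \<in> carrier (monoid_algebra K G)"
proof (rule monoid_algebra_carrierI)
  interpret G: monoid G by fact
  note D = monoid_algebra_carrierD[OF f] monoid_algebra_carrierD[OF g]
  let ?S = "(\<lambda>p. fst p \<otimes>\<^bsub>G\<^esub> snd p) ` (supp K f \<times> supp K g)"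
  have eq: "(f \<otimes>\<^bsub>monoid_algebra K G\<^esub> g) z =
    (\<Oplus>p \<in> supp K f \<times> supp K g. if fst p \<otimes>\<^bsub>G\<^esub> snd p = z then f (fst p) \<otimes> g (snd p) else \<zero>)" for z
    by (rule monoid_algebra_mult_superset) (use f g D in auto)
  show "(f \<otimes>\<^bsub>monoid_algebra K G\<^esub> g) z \<in> carrier K" for z
    unfolding eq by (rule finsum_closed) (use D in auto)
  show "finite ?S" "?S \<subseteq> carrier G"
    using D by (auto simp: subset_iff)
  show "(f \<otimes>\<^bsub>monoid_algebra K G\<^esub> g) z = \<zero>" if "z \<notin> ?S" for z
  proof -
    have "fst p \<otimes>\<^bsub>G\<^esub> snd p \<noteq> z" if "p \<in> supp K f \<times> supp K g" for p
      using that \<open>z \<notin> ?S\<close> by blast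
    then show ?thesis
      unfolding eq by (intro add.finprod_one_eqI) simp
  qed
qed

lemma monoid_algebra_mult_bilinear:
  assumes G: "monoid G"
  shows "bilinear (monoid_algebra K G) (monoid_algebra K G) (monoid_algebra K G)
    (\<lambda>f g. f \<otimes>\<^bsub>monoid_algebra K G\<^esub> g)"
proof (rule bilinearI; rule linear_mapsI)
  let ?F = "monoid_algebra K G"
  interpret F: module K ?F by (rule module_monoid_algebra)
  note D = monoid_algebra_carrierD[where G = G]
  note eq = monoid_algebra_mult_superset[where G = G]
  fix g assume g: "g \<in> carrier ?F"
  { fix f assume f: "f \<in> carrier ?F"
    show "f \<otimes>\<^bsub>?F\<^esub> g \<in> carrier ?F"
      by (rule monoid_algebra_mult_closed[OF G f g])
    show "g \<otimes>\<^bsub>?F\<^esub> f \<in> carrier ?F"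
      by (rule monoid_algebra_mult_closed[OF G g f])
    { fix f' assume f': "f' \<in> carrier ?F"
      show "(f \<oplus>\<^bsub>?F\<^esub> f') \<otimes>\<^bsub>?F\<^esub> g = f \<otimes>\<^bsub>?F\<^esub> g \<oplus>\<^bsub>?F\<^esub> f' \<otimes>\<^bsub>?F\<^esub> g"
      proof
        fix z
        let ?A = "supp K f \<union> supp K f'" and ?B = "supp K g"
        have A: "finite ?A" "supp K f \<subseteq> ?A" "supp K f' \<subseteq> ?A" "supp K (f \<oplus>\<^bsub>?F\<^esub> f') \<subseteq> ?A"
            "finite ?B" "supp K g \<subseteq> ?B"
          using D[OF f] D[OF f'] D[OF g] by (auto simp: supp_def)
        have "((f \<oplus>\<^bsub>?F\<^esub> f') \<otimes>\<^bsub>?F\<^esub> g) z = (\<Oplus>p \<in> ?A \<times> ?B.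
            (if fst p \<otimes>\<^bsub>G\<^esub> snd p = z then f (fst p) \<otimes> g (snd p) else \<zero>) \<oplus>
            (if fst p \<otimes>\<^bsub>G\<^esub> snd p = z then f' (fst p) \<otimes> g (snd p) else \<zero>))"
          unfolding eq[OF F.a_closed[OF f f'] g A(1) A(4) A(5,6)]
          by (rule finsum_cong') (use D(1)[OF f] D(1)[OF f'] D(1)[OF g] in \<open>auto simp: l_distr\<close>)
        also have "\<dots> = (f \<otimes>\<^bsub>?F\<^esub> g) z \<oplus> (f' \<otimes>\<^bsub>?F\<^esub> g) z"
          unfolding eq[OF f g A(1) A(2) A(5,6)] eq[OF f' g A(1) A(3) A(5,6)]
          by (rule finsum_addf) (use D(1)[OF f] D(1)[OF f'] D(1)[OF g] in auto)
        finally show "((f \<oplus>\<^bsub>?F\<^esub> f') \<otimes>\<^bsub>?F\<^esub> g) z = (f \<otimes>\<^bsub>?F\<^esub> g \<oplus>\<^bsub>?F\<^esub> f' \<otimes>\<^bsub>?F\<^esub> g) z"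
          by simp
      qed
      show "g \<otimes>\<^bsub>?F\<^esub> (f \<oplus>\<^bsub>?F\<^esub> f') = g \<otimes>\<^bsub>?F\<^esub> f \<oplus>\<^bsub>?F\<^esub> g \<otimes>\<^bsub>?F\<^esub> f'"
      proof
        fix z
        let ?A = "supp K f \<union> supp K f'" and ?B = "supp K g"
        have A: "finite ?A" "supp K f \<subseteq> ?A" "supp K f' \<subseteq> ?A" "supp K (f \<oplus>\<^bsub>?F\<^esub> f') \<subseteq> ?A"
            "finite ?B" "supp K g \<subseteq> ?B"
          using D[OF f] D[OF f'] D[OF g] by (auto simp: supp_def)
        have "(g \<otimes>\<^bsub>?F\<^esub> (f \<oplus>\<^bsub>?F\<^esub> f')) z = (\<Oplus>p \<in> ?B \<times> ?A.
            (if fst p \<otimes>\<^bsub>G\<^esub> snd p = z then g (fst p) \<otimes> f (snd p) else \<zero>) \<oplus>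
            (if fst p \<otimes>\<^bsub>G\<^esub> snd p = z then g (fst p) \<otimes> f' (snd p) else \<zero>))"
          unfolding eq[OF g F.a_closed[OF f f'] A(5,6) A(1) A(4)]
          by (rule finsum_cong') (use D(1)[OF f] D(1)[OF f'] D(1)[OF g] in \<open>auto simp: r_distr\<close>)
        also have "\<dots> = (g \<otimes>\<^bsub>?F\<^esub> f) z \<oplus> (g \<otimes>\<^bsub>?F\<^esub> f') z"
          unfolding eq[OF g f A(5,6) A(1) A(2)] eq[OF g f' A(5,6) A(1) A(3)]
          by (rule finsum_addf) (use D(1)[OF f] D(1)[OF f'] D(1)[OF g] in auto)
        finally show "(g \<otimes>\<^bsub>?F\<^esub> (f \<oplus>\<^bsub>?F\<^esub> f')) z = (g \<otimes>\<^bsub>?F\<^esub> f \<oplus>\<^bsub>?F\<^esub> g \<otimes>\<^bsub>?F\<^esub> f') z"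
          by simp
      qed }
    fix a assume a: "a \<in> carrier K"
    have A: "finite (supp K f)" "supp K f \<subseteq> supp K f" "supp K (a \<odot>\<^bsub>?F\<^esub> f) \<subseteq> supp K f"
        "finite (supp K g)" "supp K g \<subseteq> supp K g"
      using D[OF f] D[OF g] a by (auto simp: supp_def)
    show "(a \<odot>\<^bsub>?F\<^esub> f) \<otimes>\<^bsub>?F\<^esub> g = a \<odot>\<^bsub>?F\<^esub> (f \<otimes>\<^bsub>?F\<^esub> g)"
    proof
      fix z
      show "((a \<odot>\<^bsub>?F\<^esub> f) \<otimes>\<^bsub>?F\<^esub> g) z = (a \<odot>\<^bsub>?F\<^esub> (f \<otimes>\<^bsub>?F\<^esub> g)) z"
        unfolding eq[OF F.smult_closed[OF a f] g A(1,3,4,5)] eq[OF f g A(1,2,4,5)]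
        unfolding monoid_algebra_smult
        by (subst finsum_rdistr)
          (use a A D(1)[OF f] D(1)[OF g] in \<open>auto intro!: finsum_cong' simp: m_assoc\<close>)
    qed
    show "g \<otimes>\<^bsub>?F\<^esub> (a \<odot>\<^bsub>?F\<^esub> f) = a \<odot>\<^bsub>?F\<^esub> (g \<otimes>\<^bsub>?F\<^esub> f)"
    proof
      fix z
      show "(g \<otimes>\<^bsub>?F\<^esub> (a \<odot>\<^bsub>?F\<^esub> f)) z = (a \<odot>\<^bsub>?F\<^esub> (g \<otimes>\<^bsub>?F\<^esub> f)) z"
        unfolding eq[OF g F.smult_closed[OF a f] A(4,5,1,3)] eq[OF g f A(4,5,1,2)]
        unfolding monoid_algebra_smult
        by (subst finsum_rdistr)
          (use a A D(1)[OF f] D(1)[OF g] in \<open>auto intro!: finsum_cong' simp: m_lcomm\<close>)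
    qed
    }
qed

lemma single_mult:
  assumes G: "monoid G" and x: "x \<in> carrier G" and y: "y \<in> carrier G"
  shows "single K x \<otimes>\<^bsub>monoid_algebra K G\<^esub> single K y = single K (x \<otimes>\<^bsub>G\<^esub> y)"
proof
  fix z
  show "(single K x \<otimes>\<^bsub>monoid_algebra K G\<^esub> single K y) z = single K (x \<otimes>\<^bsub>G\<^esub> y) z"
    by (subst monoid_algebra_mult_superset[of _ _ _ "{x}" "{y}"])
      (use x y in \<open>auto simp: single_closed supp_single\<close>, auto simp: single_def)
qed

text \<open>Both sides of the associative law are trilinear, so one variable after the other is
  replaced by a basis element, until only the associativity of the monoid remains. The unit laws are
  treated in the same way.\<close>

lemma unital_algebra_monoid_algebra:
  assumes G: "monoid G"
  shows "unital_algebra K (monoid_algebra K G)"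
proof -
  let ?F = "monoid_algebra K G"
  interpret G: monoid G by fact
  interpret F: module K ?F by (rule module_monoid_algebra)
  note bil = monoid_algebra_mult_bilinear[OF G]
  note mod = F.module_axioms
  note left = bilinear_left[OF bil] and right = bilinear_right[OF bil]
  note cl = bilinear_closed[OF bil]
  have assoc: "(f \<otimes>\<^bsub>?F\<^esub> g) \<otimes>\<^bsub>?F\<^esub> h = f \<otimes>\<^bsub>?F\<^esub> (g \<otimes>\<^bsub>?F\<^esub> h)"
    if f: "f \<in> carrier ?F" and g: "g \<in> carrier ?F" and h: "h \<in> carrier ?F" for f g h
  proof (rule linear_eq_on_singles[OF mod _ _ _ f])
    show "(\<lambda>f. (f \<otimes>\<^bsub>?F\<^esub> g) \<otimes>\<^bsub>?F\<^esub> h) \<in> linear_maps K ?F ?F" "(\<lambda>f. f \<otimes>\<^bsub>?F\<^esub> (g \<otimes>\<^bsub>?F\<^esub> h)) \<in> linear_maps K ?F ?F"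
      by (intro left linear_maps_id cl g h)+
    fix x assume x: "x \<in> carrier G"
    note sx = single_closed[OF x]
    show "(single K x \<otimes>\<^bsub>?F\<^esub> g) \<otimes>\<^bsub>?F\<^esub> h = single K x \<otimes>\<^bsub>?F\<^esub> (g \<otimes>\<^bsub>?F\<^esub> h)"
    proof (rule linear_eq_on_singles[OF mod _ _ _ g])
      show "(\<lambda>g. (single K x \<otimes>\<^bsub>?F\<^esub> g) \<otimes>\<^bsub>?F\<^esub> h) \<in> linear_maps K ?F ?F"
        "(\<lambda>g. single K x \<otimes>\<^bsub>?F\<^esub> (g \<otimes>\<^bsub>?F\<^esub> h)) \<in> linear_maps K ?F ?F"
        by (intro left right linear_maps_id h sx)+
      fix y assume y: "y \<in> carrier G"
      note sy = single_closed[OF y]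
      show "(single K x \<otimes>\<^bsub>?F\<^esub> single K y) \<otimes>\<^bsub>?F\<^esub> h = single K x \<otimes>\<^bsub>?F\<^esub> (single K y \<otimes>\<^bsub>?F\<^esub> h)"
      proof (rule linear_eq_on_singles[OF mod _ _ _ h])
        show "(\<lambda>h. (single K x \<otimes>\<^bsub>?F\<^esub> single K y) \<otimes>\<^bsub>?F\<^esub> h) \<in> linear_maps K ?F ?F"
          "(\<lambda>h. single K x \<otimes>\<^bsub>?F\<^esub> (single K y \<otimes>\<^bsub>?F\<^esub> h)) \<in> linear_maps K ?F ?F"
          by (intro right linear_maps_id cl sx sy)+
      qed (use x y in \<open>simp add: single_mult[OF G] G.m_assoc\<close>)
    qed
  qed
  have one: "\<one>\<^bsub>?F\<^esub> \<in> carrier ?F"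
    by (simp add: single_closed)
  have lone: "\<one>\<^bsub>?F\<^esub> \<otimes>\<^bsub>?F\<^esub> f = f" and rone: "f \<otimes>\<^bsub>?F\<^esub> \<one>\<^bsub>?F\<^esub> = f" if f: "f \<in> carrier ?F" for f
    by (rule linear_eq_on_singles[OF mod right[OF linear_maps_id one] linear_maps_id _ f],
        simp add: single_mult[OF G])
      (rule linear_eq_on_singles[OF mod left[OF linear_maps_id one] linear_maps_id _ f],
        simp add: single_mult[OF G])
  have "ring ?F"
    by (rule ringI[OF F.abelian_group_axioms])
      (auto intro!: monoidI cl one assoc lone rone
        simp del: monoid_algebra_add monoid_algebra_one
        simp: linear_maps_add[OF left[OF linear_maps_id]] linear_maps_add[OF right[OF linear_maps_id]])
  then show ?thesis
    using linear_maps_smult[OF left[OF linear_maps_id]] linear_maps_smult[OF right[OF linear_maps_id]]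
    by (auto intro!: unital_algebra.intro unital_algebra_axioms.intro field_axioms mod)
qed

section \<open>Quotients\<close>

lemma submodule_abelian_subgroup:
  assumes M: "module K M" and N: "submodule N K M"
  shows "abelian_subgroup N M"
proof -
  interpret M: module K M by fact
  show ?thesis
    using N by (intro abelian_subgroupI3 additive_subgroupI M.abelian_group_axioms submodule.axioms(1))
qed

lemma coset_eq_iff:
  assumes M: "module K M" and N: "submodule N K M" and x: "x \<in> carrier M" and y: "y \<in> carrier M"
  shows "N +>\<^bsub>M\<^esub> x = N +>\<^bsub>M\<^esub> y \<longleftrightarrow> x \<ominus>\<^bsub>M\<^esub> y \<in> N"
proof -
  interpret abelian_subgroup N M by (rule submodule_abelian_subgroup[OF M N])
  show ?thesis
    using x y a_rcos_module[OF y x] a_repr_independence'[of x y] a_rcos_self[OF x]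
    by (auto simp: a_minus_def)
qed

lemma coset_eq_zero_iff:
  assumes M: "module K M" and N: "submodule N K M" and x: "x \<in> carrier M"
  shows "N +>\<^bsub>M\<^esub> x = \<zero>\<^bsub>quot_module M N\<^esub> \<longleftrightarrow> x \<in> N"
proof -
  interpret abelian_subgroup N M by (rule submodule_abelian_subgroup[OF M N])
  show ?thesis
    using x a_rcos_self[OF x] a_rcos_const[of x] by (auto simp: quot_module_def FactRing_def)
qed

lemma quot_module_carrier: "carrier (quot_module M N) = (\<lambda>x. N +>\<^bsub>M\<^esub> x) ` carrier M"
  by (auto simp: quot_module_def FactRing_def A_RCOSETS_def')

lemma quot_module_add:
  assumes M: "module K M" and N: "submodule N K M" and x: "x \<in> carrier M" and y: "y \<in> carrier M"
  shows "(N +>\<^bsub>M\<^esub> x) \<oplus>\<^bsub>quot_module M N\<^esub> (N +>\<^bsub>M\<^esub> y) = N +>\<^bsub>M\<^esub> (x \<oplus>\<^bsub>M\<^esub> y)"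
proof -
  interpret abelian_subgroup N M by (rule submodule_abelian_subgroup[OF M N])
  show ?thesis
    using a_rcos_sum[OF x y] by (simp add: quot_module_def FactRing_def)
qed

text \<open>The union that defines the scalar multiple runs over a nonempty family of equal
  cosets.\<close>

lemma quot_module_smult:
  assumes M: "module K M" and N: "submodule N K M" and a: "a \<in> carrier K" and x: "x \<in> carrier M"
  shows "a \<odot>\<^bsub>quot_module M N\<^esub> (N +>\<^bsub>M\<^esub> x) = N +>\<^bsub>M\<^esub> (a \<odot>\<^bsub>M\<^esub> x)"
proof -
  interpret M: module K M by fact
  interpret abelian_subgroup N M by (rule submodule_abelian_subgroup[OF M N])
  have "N +>\<^bsub>M\<^esub> (a \<odot>\<^bsub>M\<^esub> y) = N +>\<^bsub>M\<^esub> (a \<odot>\<^bsub>M\<^esub> x)" if y: "y \<in> N +>\<^bsub>M\<^esub> x" for y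
  proof -
    have yc: "y \<in> carrier M"
      using a_elemrcos_carrier[OF x y] .
    have "y \<ominus>\<^bsub>M\<^esub> x \<in> N"
      using a_rcos_module_imp[OF x y] by (simp add: a_minus_def)
    then have "a \<odot>\<^bsub>M\<^esub> (y \<ominus>\<^bsub>M\<^esub> x) \<in> N"
      using submodule.smult_closed[OF N a] by blast
    moreover have "a \<odot>\<^bsub>M\<^esub> (y \<ominus>\<^bsub>M\<^esub> x) = a \<odot>\<^bsub>M\<^esub> y \<ominus>\<^bsub>M\<^esub> a \<odot>\<^bsub>M\<^esub> x"
      using a x yc by (simp add: a_minus_def M.smult_r_distr M.smult_r_minus)
    ultimately show ?thesis
      using a x yc by (simp add: coset_eq_iff[OF M N])
  qed
  then have "(\<Union>y\<in>N +>\<^bsub>M\<^esub> x. N +>\<^bsub>M\<^esub> (a \<odot>\<^bsub>M\<^esub> y)) = N +>\<^bsub>M\<^esub> (a \<odot>\<^bsub>M\<^esub> x)"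
    using a_rcos_self[OF x] by blast
  then show ?thesis
    by (simp add: quot_module_def)
qed

lemma quot_module_proj_linear:
  assumes M: "module K M" and N: "submodule N K M"
  shows "(\<lambda>x. N +>\<^bsub>M\<^esub> x) \<in> linear_maps K M (quot_module M N)"
  by (rule linear_mapsI) (auto simp: quot_module_carrier quot_module_add[OF M N] quot_module_smult[OF M N])

lemma quot_module_zero:
  assumes M: "module K M" and N: "submodule N K M"
  shows "\<zero>\<^bsub>quot_module M N\<^esub> = N +>\<^bsub>M\<^esub> \<zero>\<^bsub>M\<^esub>"
proof -
  interpret M: module K M by fact
  interpret abelian_subgroup N M by (rule submodule_abelian_subgroup[OF M N])
  show ?thesis
    using coset_eq_zero_iff[OF M N M.zero_closed] by simp
qed

lemma module_quot_module:
  assumes M: "module K M" and N: "submodule N K M"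
  shows "module K (quot_module M N)"
proof -
  interpret M: module K M by fact
  let ?Q = "quot_module M N"
  note simps = quot_module_carrier quot_module_add[OF M N] quot_module_smult[OF M N] quot_module_zero[OF M N]
  show ?thesis
  proof (rule moduleI)
    show "abelian_group ?Q"
    proof (rule abelian_groupI)
      fix X assume "X \<in> carrier ?Q"
      then obtain x where x: "x \<in> carrier M" "X = N +>\<^bsub>M\<^esub> x"
        by (auto simp: simps)
      then show "\<exists>Y\<in>carrier ?Q. Y \<oplus>\<^bsub>?Q\<^esub> X = \<zero>\<^bsub>?Q\<^esub>"
        by (intro bexI[of _ "N +>\<^bsub>M\<^esub> (\<ominus>\<^bsub>M\<^esub> x)"]) (auto simp: simps M.l_neg)
    qed (auto simp: simps M.a_assoc, auto simp: M.a_comm)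
  qed (auto simp: simps is_cring M.smult_l_distr M.smult_r_distr M.smult_assoc1)
qed

text \<open>A linear map that kills N is constant on each coset, so the image of a coset is a
  singleton and \<open>the_elem\<close> returns its only element.\<close>

lemma coset_lift_coset:
  assumes M: "module K M" and Z: "module K Z" and N: "submodule N K M"
    and h: "h \<in> linear_maps K M Z" and kill: "\<And>n. n \<in> N \<Longrightarrow> h n = \<zero>\<^bsub>Z\<^esub>" and x: "x \<in> carrier M"
  shows "coset_lift h (N +>\<^bsub>M\<^esub> x) = h x"
proof -
  interpret M: module K M by fact
  interpret Z: module K Z by fact
  interpret abelian_subgroup N M by (rule submodule_abelian_subgroup[OF M N])
  have "h y = h x" if y: "y \<in> N +>\<^bsub>M\<^esub> x" for y
  proof -
    have "y \<in> (\<Union>n\<in>N. {n \<oplus>\<^bsub>M\<^esub> x})"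
      using y by (simp add: a_r_coset_def')
    then obtain n where n: "n \<in> N" "y = n \<oplus>\<^bsub>M\<^esub> x"
      by auto
    then show ?thesis
      using x a_subset linear_maps_closed[OF h x] by (auto simp: linear_maps_add[OF h] kill)
  qed
  then have "h ` (N +>\<^bsub>M\<^esub> x) = {h x}"
    using a_rcos_self[OF x] by blast
  then show ?thesis
    by (simp add: coset_lift_def)
qed

lemma coset_lift_linear:
  assumes M: "module K M" and Z: "module K Z" and N: "submodule N K M"
    and h: "h \<in> linear_maps K M Z" and kill: "\<And>n. n \<in> N \<Longrightarrow> h n = \<zero>\<^bsub>Z\<^esub>"
  shows "coset_lift h \<in> linear_maps K (quot_module M N) Z"
proof -
  interpret M: module K M by fact
  note lift = coset_lift_coset[OF M Z N h kill]
  show ?thesis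
    by (rule linear_mapsI)
      (auto simp: quot_module_carrier quot_module_add[OF M N] quot_module_smult[OF M N] lift
        linear_maps_add[OF h] linear_maps_smult[OF h] linear_maps_closed[OF h])
qed

lemma submodule_kernel:
  assumes M: "module K M" and Z: "module K Z" and h: "h \<in> linear_maps K M Z"
  shows "submodule {x \<in> carrier M. h x = \<zero>\<^bsub>Z\<^esub>} K M"
proof -
  interpret M: module K M by fact
  interpret Z: module K Z by fact
  show ?thesis
    by (rule M.submoduleI)
      (auto simp: linear_maps_zero[OF M Z h] linear_maps_a_inv[OF M Z h] linear_maps_add[OF h]
        linear_maps_smult[OF h])
qed

lemma submodule_gen_submodule:
  assumes M: "module K M" and S: "S \<subseteq> carrier M"
  shows "submodule (gen_submodule K M S) K M"
proof -
  interpret M: module K M by fact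
  \<comment> \<open>The carrier contains S, so the intersection is taken over a nonempty family; an
    empty one would yield the whole type.\<close>
  have c: "submodule (carrier M) K M"
    by (rule M.carrier_is_submodule)
  have sub: "\<zero>\<^bsub>M\<^esub> \<in> N \<and> N \<subseteq> carrier M" if "submodule N K M" for N
  proof -
    interpret abelian_subgroup N M by (rule submodule_abelian_subgroup[OF M that])
    show ?thesis using a_subset by simp
  qed
  show ?thesis
    unfolding gen_submodule_def
    using c S by (intro M.submoduleI) (auto simp: sub M.submoduleE)
qed

lemma gen_submodule_incl: "S \<subseteq> gen_submodule K M S"
  by (auto simp: gen_submodule_def)

text \<open>The kernel is itself one of the submodules that are intersected.\<close>

lemma linear_kills_gen_submodule:
  assumes M: "module K M" and Z: "module K Z" and h: "h \<in> linear_maps K M Z"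
    and S: "S \<subseteq> carrier M" and kill: "\<And>s. s \<in> S \<Longrightarrow> h s = \<zero>\<^bsub>Z\<^esub>" and x: "x \<in> gen_submodule K M S"
  shows "h x = \<zero>\<^bsub>Z\<^esub>"
proof -
  have "gen_submodule K M S \<subseteq> {x \<in> carrier M. h x = \<zero>\<^bsub>Z\<^esub>}"
    unfolding gen_submodule_def using submodule_kernel[OF M Z h] S kill by (intro Inter_lower) blast
  then show ?thesis
    using x by blast
qed

section \<open>Algebra homomorphisms and quotients by ideals\<close>

definition alg_homs ::
  "('k, 'x, 'm) module_scheme \<Rightarrow> ('k, 'y, 'n) module_scheme \<Rightarrow> ('x \<Rightarrow> 'y) set"
  where "alg_homs A B = ring_hom A B \<inter> linear_maps K A B"

lemma alg_homsI:
  assumes "f \<in> linear_maps K A B"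
    and "\<And>x y. \<lbrakk>x \<in> carrier A; y \<in> carrier A\<rbrakk> \<Longrightarrow> f (x \<otimes>\<^bsub>A\<^esub> y) = f x \<otimes>\<^bsub>B\<^esub> f y"
    and "f \<one>\<^bsub>A\<^esub> = \<one>\<^bsub>B\<^esub>"
  shows "f \<in> alg_homs A B"
  unfolding alg_homs_def
  by (intro IntI ring_hom_memI assms linear_maps_closed[OF assms(1)] linear_maps_add[OF assms(1)])

lemma alg_homs_linear: "f \<in> alg_homs A B \<Longrightarrow> f \<in> linear_maps K A B"
  and alg_homs_ring_hom: "f \<in> alg_homs A B \<Longrightarrow> f \<in> ring_hom A B"
  by (auto simp: alg_homs_def)

lemmas alg_homs_closed = linear_maps_closed[OF alg_homs_linear]
  and alg_homs_add = linear_maps_add[OF alg_homs_linear]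
  and alg_homs_smult = linear_maps_smult[OF alg_homs_linear]
  and alg_homs_mult = ring_hom_mult[OF alg_homs_ring_hom]
  and alg_homs_one = ring_hom_one[OF alg_homs_ring_hom]

lemma alg_homs_minus:
  assumes "unital_algebra K A" "unital_algebra K B" "f \<in> alg_homs A B"
    "x \<in> carrier A" "y \<in> carrier A"
  shows "f (x \<ominus>\<^bsub>A\<^esub> y) = f x \<ominus>\<^bsub>B\<^esub> f y"
  using assms by (intro linear_maps_minus module_unital_algebra alg_homs_linear)

lemma alg_homs_comp:
  assumes "g \<in> alg_homs B D" "f \<in> alg_homs A B"
  shows "(\<lambda>x. g (f x)) \<in> alg_homs A D"
proof (rule alg_homsI)
  show "(\<lambda>x. g (f x)) \<in> linear_maps K A D"
    by (rule linear_maps_comp[OF alg_homs_linear alg_homs_linear, OF assms])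
qed (simp_all add: alg_homs_mult[OF assms(1)] alg_homs_mult[OF assms(2)] alg_homs_one[OF assms(1)]
      alg_homs_one[OF assms(2)] alg_homs_closed[OF assms(2)])

text \<open>A scalar a acts as multiplication by the element a 1, which an ideal absorbs.\<close>

lemma ideal_submodule:
  assumes A: "unital_algebra K A" and I: "ideal I A"
  shows "submodule I K A"
proof -
  interpret A: unital_algebra K A by fact
  interpret I: ideal I A by fact
  have "a \<odot>\<^bsub>A\<^esub> x \<in> I" if "a \<in> carrier K" "x \<in> I" for a x
  proof -
    have "(a \<odot>\<^bsub>A\<^esub> \<one>\<^bsub>A\<^esub>) \<otimes>\<^bsub>A\<^esub> x \<in> I"
      using that by (intro I.I_l_closed) auto
    then show ?thesis
      using that I.a_subset by (simp add: A.smult_mult_left subset_iff)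
  qed
  then show ?thesis
    using I.a_subset by (intro A.submoduleI) auto
qed

lemma quot_module_mult:
  assumes A: "unital_algebra K A" and I: "ideal I A" and x: "x \<in> carrier A" and y: "y \<in> carrier A"
  shows "(I +>\<^bsub>A\<^esub> x) \<otimes>\<^bsub>quot_module A I\<^esub> (I +>\<^bsub>A\<^esub> y) = I +>\<^bsub>A\<^esub> (x \<otimes>\<^bsub>A\<^esub> y)"
  using ideal.rcoset_mult_add[OF I x y] by (simp add: quot_module_def FactRing_def)

lemma quot_module_one: "\<one>\<^bsub>quot_module A I\<^esub> = I +>\<^bsub>A\<^esub> \<one>\<^bsub>A\<^esub>"
  by (simp add: quot_module_def FactRing_def)

lemma quot_module_proj_alg_hom:
  assumes A: "unital_algebra K A" and I: "ideal I A"
  shows "(\<lambda>x. I +>\<^bsub>A\<^esub> x) \<in> alg_homs A (quot_module A I)"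
  by (intro alg_homsI quot_module_proj_linear[OF module_unital_algebra[OF A] ideal_submodule[OF A I]])
    (simp_all add: quot_module_mult[OF A I] quot_module_one)

lemma unital_algebra_quot_module:
  assumes A: "unital_algebra K A" and I: "ideal I A"
  shows "unital_algebra K (quot_module A I)"
proof -
  interpret A: unital_algebra K A by fact
  let ?Q = "quot_module A I"
  note M = A.module_axioms and N = ideal_submodule[OF A I]
  interpret Q: module K ?Q by (rule module_quot_module[OF M N])
  note simps = quot_module_carrier quot_module_add[OF M N] quot_module_smult[OF M N] quot_module_zero[OF M N]
    quot_module_mult[OF A I] quot_module_one
  have "ring ?Q"
    by (rule ringI[OF Q.abelian_group_axioms])
      (auto intro!: monoidI simp: simps A.m_assoc A.l_distr A.r_distr)
  then show ?thesis
    by (intro unital_algebra.intro unital_algebra_axioms.intro field_axioms Q.module_axioms)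
      (auto simp: simps A.smult_mult_left A.smult_mult_right)
qed

lemma ideal_kernel:
  assumes A: "unital_algebra K A" and B: "unital_algebra K B" and h: "h \<in> alg_homs A B"
  shows "ideal {x \<in> carrier A. h x = \<zero>\<^bsub>B\<^esub>} A"
proof -
  interpret A: unital_algebra K A by fact
  interpret B: unital_algebra K B by fact
  have "subgroup {x \<in> carrier A. h x = \<zero>\<^bsub>B\<^esub>} (add_monoid A)"
    by (rule submodule.axioms(1)[OF submodule_kernel[OF A.module_axioms B.module_axioms alg_homs_linear[OF h]]])
  then show ?thesis
    by (intro idealI A.ring_axioms) (auto simp: alg_homs_mult[OF h] alg_homs_closed[OF h])
qed

text \<open>The kernel is an ideal that contains S, hence one of those intersected in
  \<open>genideal\<close>. This is what allows an ideal to be tested on its generators.\<close>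

lemma alg_hom_kills_Idl:
  assumes A: "unital_algebra K A" and B: "unital_algebra K B" and h: "h \<in> alg_homs A B"
    and S: "S \<subseteq> carrier A" and kill: "\<And>s. s \<in> S \<Longrightarrow> h s = \<zero>\<^bsub>B\<^esub>" and x: "x \<in> Idl\<^bsub>A\<^esub> S"
  shows "h x = \<zero>\<^bsub>B\<^esub>"
proof -
  have "Idl\<^bsub>A\<^esub> S \<subseteq> {x \<in> carrier A. h x = \<zero>\<^bsub>B\<^esub>}"
    unfolding genideal_def using ideal_kernel[OF A B h] S kill by (intro Inter_lower) blast
  then show ?thesis
    using x by blast
qed

lemma coset_lift_alg_hom:
  assumes A: "unital_algebra K A" and B: "unital_algebra K B" and I: "ideal I A"
    and h: "h \<in> alg_homs A B" and kill: "\<And>n. n \<in> I \<Longrightarrow> h n = \<zero>\<^bsub>B\<^esub>"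
  shows "coset_lift h \<in> alg_homs (quot_module A I) B"
    and "x \<in> carrier A \<Longrightarrow> coset_lift h (I +>\<^bsub>A\<^esub> x) = h x"
proof -
  interpret A: unital_algebra K A by fact
  note lift = coset_lift_coset[OF A.module_axioms module_unital_algebra[OF B] ideal_submodule[OF A I] alg_homs_linear[OF h] kill]
  show "coset_lift h (I +>\<^bsub>A\<^esub> x) = h x" if "x \<in> carrier A"
    using that by (simp add: lift)
  show "coset_lift h \<in> alg_homs (quot_module A I) B"
    by (rule alg_homsI[OF coset_lift_linear[OF A.module_axioms module_unital_algebra[OF B] ideal_submodule[OF A I] alg_homs_linear[OF h] kill]])
      (auto simp: quot_module_carrier quot_module_mult[OF A I] quot_module_one lift alg_homs_mult[OF h] alg_homs_one[OF h])
qed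

section \<open>Tensor products\<close>

lemma tensor_rels_subset: 
  assumes M: "module K M" and N: "module K N"
  shows "tensor_rels K M N \<subseteq> carrier (monoid_algebra K (M \<times>\<times> N))"
proof -
  interpret M: module K M by fact
  interpret N: module K N by fact
  interpret F: module K "monoid_algebra K (M \<times>\<times> N)" by (rule module_monoid_algebra)
  have s: "single K (x, y) \<in> carrier (monoid_algebra K (M \<times>\<times> N))" if "x \<in> carrier M" "y \<in> carrier N" for x y
    using that by (intro single_closed) simp
  show ?thesis
    unfolding tensor_rels_def Let_def
    by (auto simp del: monoid_algebra_add monoid_algebra_smult intro!: F.minus_closed F.a_closed F.smult_closed s)
qed

lemma submodule_tensor_null:
  assumes M: "module K M" and N: "module K N"
  shows "submodule (tensor_null K M N) K (monoid_algebra K (M \<times>\<times> N))"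
  unfolding tensor_null_def
  by (rule submodule_gen_submodule[OF module_monoid_algebra tensor_rels_subset[OF M N]])

lemma module_tensor:
  assumes M: "module K M" and N: "module K N"
  shows "module K (tensor K M N)"
  unfolding tensor_def by (rule module_quot_module[OF module_monoid_algebra submodule_tensor_null[OF M N]])

text \<open>Stated for every linear map that is bilinear on the basis, not just for
  \<open>lin_ext\<close>: in \<open>tensor_null_ideal\<close> it is applied to multiplications
  followed by the projection.\<close>

lemma linear_kills_tensor_null:
  assumes M: "module K M" and N: "module K N" and Z: "module K Z" and g: "bilinear M N Z g"
    and h: "h \<in> linear_maps K (monoid_algebra K (M \<times>\<times> N)) Z"
    and hg: "\<And>x y. \<lbrakk>x \<in> carrier M; y \<in> carrier N\<rbrakk> \<Longrightarrow> h (single K (x, y)) = g x y"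
    and u: "u \<in> tensor_null K M N"
  shows "h u = \<zero>\<^bsub>Z\<^esub>"
proof (rule linear_kills_gen_submodule[OF module_monoid_algebra Z h tensor_rels_subset[OF M N] _ u[unfolded tensor_null_def]])
  interpret M: module K M by fact
  interpret N: module K N by fact
  interpret Z: module K Z by fact
  let ?F = "monoid_algebra K (M \<times>\<times> N)"
  interpret F: module K ?F by (rule module_monoid_algebra)
  have s: "single K (x, y) \<in> carrier ?F" if "x \<in> carrier M" "y \<in> carrier N" for x y
    using that by (intro single_closed) simp
  have gl: "(\<lambda>x. g x y) \<in> linear_maps K M Z" if "y \<in> carrier N" for y
    using g that by (simp add: bilinear_def)
  have gr: "(\<lambda>y. g x y) \<in> linear_maps K N Z" if "x \<in> carrier M" for x
    using g that by (simp add: bilinear_def)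
  note gc = bilinear_closed[OF g]
  have zz: "z \<ominus>\<^bsub>Z\<^esub> z = \<zero>\<^bsub>Z\<^esub>" if "z \<in> carrier Z" for z
    using that by (simp add: a_minus_def Z.r_neg)
  note hs = linear_maps_minus[OF F.module_axioms Z h] linear_maps_add[OF h] linear_maps_smult[OF h]
  fix r assume "r \<in> tensor_rels K M N"
  then show "h r = \<zero>\<^bsub>Z\<^esub>"
    unfolding tensor_rels_def Let_def
    by (auto simp del: monoid_algebra_add monoid_algebra_smult
      simp: hs s hg gc linear_maps_add[OF gl] linear_maps_add[OF gr] linear_maps_smult[OF gl] linear_maps_smult[OF gr]
        zz)
qed

lemma pure_tensor_closed:
  "\<lbrakk>x \<in> carrier M; y \<in> carrier N\<rbrakk> \<Longrightarrow> pure_tensor K M N x y \<in> carrier (tensor K M N)"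
  unfolding pure_tensor_def tensor_def quot_module_carrier by (intro imageI single_closed) simp

text \<open>For each of the four identities, the difference of the two sides before projection is
  one of the generating relations.\<close>

lemma pure_tensor_bilinear:
  assumes M: "module K M" and N: "module K N"
  shows "bilinear M N (tensor K M N) (pure_tensor K M N)"
proof -
  interpret M: module K M by fact
  interpret N: module K N by fact
  let ?F = "monoid_algebra K (M \<times>\<times> N)" and ?T = "tensor K M N" and ?I = "tensor_null K M N"
  interpret F: module K ?F by (rule module_monoid_algebra)
  interpret T: module K ?T by (rule module_tensor[OF M N])
  have s: "single K (x, y) \<in> carrier ?F" if "x \<in> carrier M" "y \<in> carrier N" for x y
    using that by (intro single_closed) simp
  note sub = submodule_tensor_null[OF M N]
  have proj: "(\<lambda>u. ?I +>\<^bsub>?F\<^esub> u) \<in> linear_maps K ?F ?T"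
    unfolding tensor_def by (rule quot_module_proj_linear[OF F.module_axioms sub])
  have rel: "?I +>\<^bsub>?F\<^esub> u = ?I +>\<^bsub>?F\<^esub> v"
    if "u \<ominus>\<^bsub>?F\<^esub> v \<in> tensor_rels K M N" "u \<in> carrier ?F" "v \<in> carrier ?F" for u v
  proof -
    have "u \<ominus>\<^bsub>?F\<^esub> v \<in> ?I"
      unfolding tensor_null_def by (rule subsetD[OF gen_submodule_incl that(1)])
    then show ?thesis
      by (simp only: coset_eq_iff[OF F.module_axioms sub that(2,3)])
  qed
  have add_l: "pure_tensor K M N (x \<oplus>\<^bsub>M\<^esub> x') y = pure_tensor K M N x y \<oplus>\<^bsub>?T\<^esub> pure_tensor K M N x' y"
    if "x \<in> carrier M" "x' \<in> carrier M" "y \<in> carrier N" for x x' y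
  proof -
    have "single K (x \<oplus>\<^bsub>M\<^esub> x', y) \<ominus>\<^bsub>?F\<^esub> (single K (x, y) \<oplus>\<^bsub>?F\<^esub> single K (x', y)) \<in> tensor_rels K M N"
      using that unfolding tensor_rels_def Let_def by blast
    then have "?I +>\<^bsub>?F\<^esub> single K (x \<oplus>\<^bsub>M\<^esub> x', y) = ?I +>\<^bsub>?F\<^esub> (single K (x, y) \<oplus>\<^bsub>?F\<^esub> single K (x', y))"
      by (rule rel) (use that in \<open>auto simp del: monoid_algebra_add intro!: F.a_closed s\<close>)
    then show ?thesis
      unfolding pure_tensor_def using that by (simp del: monoid_algebra_add add: linear_maps_add[OF proj] s)
  qed
  have add_r: "pure_tensor K M N x (y \<oplus>\<^bsub>N\<^esub> y') = pure_tensor K M N x y \<oplus>\<^bsub>?T\<^esub> pure_tensor K M N x y'"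
    if "x \<in> carrier M" "y \<in> carrier N" "y' \<in> carrier N" for x y y'
  proof -
    have "single K (x, y \<oplus>\<^bsub>N\<^esub> y') \<ominus>\<^bsub>?F\<^esub> (single K (x, y) \<oplus>\<^bsub>?F\<^esub> single K (x, y')) \<in> tensor_rels K M N"
      using that unfolding tensor_rels_def Let_def by blast
    then have "?I +>\<^bsub>?F\<^esub> single K (x, y \<oplus>\<^bsub>N\<^esub> y') = ?I +>\<^bsub>?F\<^esub> (single K (x, y) \<oplus>\<^bsub>?F\<^esub> single K (x, y'))"
      by (rule rel) (use that in \<open>auto simp del: monoid_algebra_add intro!: F.a_closed s\<close>)
    then show ?thesis
      unfolding pure_tensor_def using that by (simp del: monoid_algebra_add add: linear_maps_add[OF proj] s)
  qed
  have smult_l: "pure_tensor K M N (a \<odot>\<^bsub>M\<^esub> x) y = a \<odot>\<^bsub>?T\<^esub> pure_tensor K M N x y"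
    if "a \<in> carrier K" "x \<in> carrier M" "y \<in> carrier N" for a x y
  proof -
    have "single K (a \<odot>\<^bsub>M\<^esub> x, y) \<ominus>\<^bsub>?F\<^esub> (a \<odot>\<^bsub>?F\<^esub> single K (x, y)) \<in> tensor_rels K M N"
      using that unfolding tensor_rels_def Let_def by blast
    then have "?I +>\<^bsub>?F\<^esub> single K (a \<odot>\<^bsub>M\<^esub> x, y) = ?I +>\<^bsub>?F\<^esub> (a \<odot>\<^bsub>?F\<^esub> single K (x, y))"
      by (rule rel) (use that in \<open>auto simp del: monoid_algebra_smult intro!: F.smult_closed s\<close>)
    then show ?thesis
      unfolding pure_tensor_def using that by (simp del: monoid_algebra_smult add: linear_maps_smult[OF proj] s)
  qed
  have smult_r: "pure_tensor K M N x (a \<odot>\<^bsub>N\<^esub> y) = a \<odot>\<^bsub>?T\<^esub> pure_tensor K M N x y"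
    if "a \<in> carrier K" "x \<in> carrier M" "y \<in> carrier N" for a x y
  proof -
    have "single K (x, a \<odot>\<^bsub>N\<^esub> y) \<ominus>\<^bsub>?F\<^esub> (a \<odot>\<^bsub>?F\<^esub> single K (x, y)) \<in> tensor_rels K M N"
      using that unfolding tensor_rels_def Let_def by blast
    then have "?I +>\<^bsub>?F\<^esub> single K (x, a \<odot>\<^bsub>N\<^esub> y) = ?I +>\<^bsub>?F\<^esub> (a \<odot>\<^bsub>?F\<^esub> single K (x, y))"
      by (rule rel) (use that in \<open>auto simp del: monoid_algebra_smult intro!: F.smult_closed s\<close>)
    then show ?thesis
      unfolding pure_tensor_def using that by (simp del: monoid_algebra_smult add: linear_maps_smult[OF proj] s)
  qed
  show ?thesis
    by (rule bilinearI; rule linear_mapsI) (simp_all add: add_l add_r smult_l smult_r pure_tensor_closed)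
qed

lemma lin_ext_bilinear:
  assumes "bilinear M N Z g" "module K Z"
  shows "lin_ext K Z (\<lambda>(x, y). g x y) \<in> linear_maps K (monoid_algebra K (M \<times>\<times> N)) Z"
    and "\<lbrakk>x \<in> carrier M; y \<in> carrier N\<rbrakk> \<Longrightarrow> lin_ext K Z (\<lambda>(x, y). g x y) (single K (x, y)) = g x y"
  using assms by (auto intro!: lin_ext_linear simp: lin_ext_single bilinear_closed)

lemma tensor_lift_linear:
  assumes M: "module K M" and N: "module K N" and Z: "module K Z" and g: "bilinear M N Z g"
  shows "tensor_lift K Z g \<in> linear_maps K (tensor K M N) Z"
  unfolding tensor_lift_def tensor_def
  by (rule coset_lift_linear[OF module_monoid_algebra Z submodule_tensor_null[OF M N] lin_ext_bilinear(1)[OF g Z]])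
    (rule linear_kills_tensor_null[OF M N Z g lin_ext_bilinear(1)[OF g Z] lin_ext_bilinear(2)[OF g Z]])

lemma tensor_lift_pure:
  assumes M: "module K M" and N: "module K N" and Z: "module K Z" and g: "bilinear M N Z g"
    and x: "x \<in> carrier M" and y: "y \<in> carrier N"
  shows "tensor_lift K Z g (pure_tensor K M N x y) = g x y"
proof -
  have "tensor_lift K Z g (pure_tensor K M N x y) = lin_ext K Z (\<lambda>(x, y). g x y) (single K (x, y))"
    unfolding tensor_lift_def pure_tensor_def
    by (rule coset_lift_coset[OF module_monoid_algebra Z submodule_tensor_null[OF M N] lin_ext_bilinear(1)[OF g Z]])
      (use x y in \<open>auto intro!: single_closed
        linear_kills_tensor_null[OF M N Z g lin_ext_bilinear(1)[OF g Z] lin_ext_bilinear(2)[OF g Z]]\<close>)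
  then show ?thesis
    by (simp add: lin_ext_bilinear(2)[OF g Z] x y)
qed

text \<open>Pure tensors are the cosets of the basis vectors, so they span the tensor
  product.\<close>

lemma linear_eq_on_pure:
  assumes M: "module K M" and N: "module K N" and Z: "module K Z"
    and h: "h \<in> linear_maps K (tensor K M N) Z" and h': "h' \<in> linear_maps K (tensor K M N) Z"
    and eq: "\<And>x y. \<lbrakk>x \<in> carrier M; y \<in> carrier N\<rbrakk> \<Longrightarrow> h (pure_tensor K M N x y) = h' (pure_tensor K M N x y)"
    and u: "u \<in> carrier (tensor K M N)"
  shows "h u = h' u"
proof -
  let ?F = "monoid_algebra K (M \<times>\<times> N)" and ?I = "tensor_null K M N"
  have proj: "(\<lambda>u. ?I +>\<^bsub>?F\<^esub> u) \<in> linear_maps K ?F (tensor K M N)"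
    unfolding tensor_def by (rule quot_module_proj_linear[OF module_monoid_algebra submodule_tensor_null[OF M N]])
  obtain f where f: "f \<in> carrier ?F" "u = ?I +>\<^bsub>?F\<^esub> f"
    using u by (auto simp: tensor_def quot_module_carrier)
  have "h (?I +>\<^bsub>?F\<^esub> f) = h' (?I +>\<^bsub>?F\<^esub> f)"
    by (rule linear_eq_on_singles[OF Z linear_maps_comp[OF h proj] linear_maps_comp[OF h' proj] _ f(1)])
      (use eq in \<open>auto simp: pure_tensor_def\<close>)
  then show ?thesis
    by (simp add: f)
qed

text \<open>Agreement on the carriers makes g' bilinear as well, so both lifts are linear and need
  to be compared on pure tensors only.\<close>

lemma tensor_lift_cong:
  assumes M: "module K M" and N: "module K N" and Z: "module K Z" and g: "bilinear M N Z g"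
    and eq: "\<And>x y. \<lbrakk>x \<in> carrier M; y \<in> carrier N\<rbrakk> \<Longrightarrow> g' x y = g x y"
    and u: "u \<in> carrier (tensor K M N)"
  shows "tensor_lift K Z g' u = tensor_lift K Z g u"
proof -
  have "bilinear M N Z g'"
    using g unfolding bilinear_def
    by (blast intro: linear_maps_cong[OF M, where g = "\<lambda>x. g' x _"] linear_maps_cong[OF N, where g = "g' _"] eq)
  then show ?thesis
    using tensor_lift_linear[OF M N Z, of g] tensor_lift_linear[OF M N Z, of g'] g
    by (intro linear_eq_on_pure[OF M N Z, where h = "tensor_lift K Z g'", OF _ _ _ u])
      (simp_all add: tensor_lift_pure M N Z eq)
qed

text \<open>Later moves linear maps in and out of Sweedler sums.\<close>

lemma linear_tensor_lift:
  assumes M: "module K M" and N: "module K N" and Z: "module K Z" and Z': "module K Z'"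
    and g: "bilinear M N Z g" and h: "h \<in> linear_maps K Z Z'" and u: "u \<in> carrier (tensor K M N)"
  shows "h (tensor_lift K Z g u) = tensor_lift K Z' (\<lambda>x y. h (g x y)) u"
proof -
  have b: "bilinear M N Z' (\<lambda>x y. h (g x y))"
    using g h unfolding bilinear_def by (auto intro: linear_maps_comp[OF h])
  show ?thesis
    by (rule linear_eq_on_pure[OF M N Z' linear_maps_comp[OF h tensor_lift_linear[OF M N Z g]] tensor_lift_linear[OF M N Z' b] _ u])
      (simp add: tensor_lift_pure M N Z Z' g b)
qed

lemma pure_tensor_maps_bilinear:
  assumes "module K M'" "module K N'" "f \<in> linear_maps K M M'" "g \<in> linear_maps K N N'"
  shows "bilinear M N (tensor K M' N') (\<lambda>x y. pure_tensor K M' N' (f x) (g y))"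
  using assms by (intro bilinearI bilinear_left[OF pure_tensor_bilinear] bilinear_right[OF pure_tensor_bilinear])
    (auto simp: linear_maps_closed)

lemma tensor_map_linear:
  assumes "module K M" "module K N" "module K M'" "module K N'"
    "f \<in> linear_maps K M M'" "g \<in> linear_maps K N N'"
  shows "tensor_map K M' N' f g \<in> linear_maps K (tensor K M N) (tensor K M' N')"
  unfolding tensor_map_def using assms
  by (intro tensor_lift_linear pure_tensor_maps_bilinear module_tensor)

lemma tensor_map_pure:
  assumes "module K M" "module K N" "module K M'" "module K N'"
    "f \<in> linear_maps K M M'" "g \<in> linear_maps K N N'" "x \<in> carrier M" "y \<in> carrier N"
  shows "tensor_map K M' N' f g (pure_tensor K M N x y) = pure_tensor K M' N' (f x) (g y)"
  unfolding tensor_map_def using assms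
  by (simp add: tensor_lift_pure pure_tensor_maps_bilinear module_tensor)

lemma tensor_lift_tensor_map:
  assumes M: "module K M" "module K N" "module K M'" "module K N'" "module K Z"
    and f: "f \<in> linear_maps K M M'" "f' \<in> linear_maps K N N'"
    and g: "bilinear M' N' Z g" and u: "u \<in> carrier (tensor K M N)"
  shows "tensor_lift K Z g (tensor_map K M' N' f f' u) = tensor_lift K Z (\<lambda>x y. g (f x) (f' y)) u"
  unfolding tensor_map_def
  by (subst linear_tensor_lift[OF M(1,2) _ M(5) pure_tensor_maps_bilinear[OF M(3,4) f] _ u])
    (use M f g u in \<open>auto intro!: module_tensor tensor_lift_linear tensor_lift_cong[OF M(1,2,5)] bilinearI
      bilinear_left[OF g] bilinear_right[OF g]
      simp: linear_maps_closed tensor_lift_pure\<close>)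

lemma tensor_map_cong:
  assumes M: "module K M" "module K N" "module K M'" "module K N'"
    and f: "f \<in> linear_maps K M M'" "f' \<in> linear_maps K N N'"
    and eq: "\<And>x. x \<in> carrier M \<Longrightarrow> g x = f x" "\<And>x. x \<in> carrier N \<Longrightarrow> g' x = f' x"
    and u: "u \<in> carrier (tensor K M N)"
  shows "tensor_map K M' N' g g' u = tensor_map K M' N' f f' u"
  unfolding tensor_map_def
  by (rule tensor_lift_cong[OF M(1,2) module_tensor[OF M(3,4)] pure_tensor_maps_bilinear[OF M(3,4) f] _ u])
    (simp add: eq)

section \<open>The algebra structure of a tensor product\<close>

lemma bilinear_mult:
  assumes A: "unital_algebra K A"
  shows "bilinear A A A (\<lambda>x y. x \<otimes>\<^bsub>A\<^esub> y)"
  by (intro bilinearI linear_maps_mult_left[OF A linear_maps_id] linear_maps_mult_right[OF A linear_maps_id])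

text \<open>This makes the product of A \<otimes> B well defined. Multiplication by a basis element
  (a, b), followed by the projection, sends (x, y) to a x \<otimes> b y or x a \<otimes> y b; this
  is bilinear in x and y, so the bilinearity relations are killed. Linearity in the multiplier then
  passes from basis elements to all of them.\<close>

lemma tensor_null_ideal:
  assumes A: "unital_algebra K A" and B: "unital_algebra K B"
  shows "ideal (tensor_null K A B) (monoid_algebra K (A \<times>\<times> B))"
proof -
  interpret A: unital_algebra K A by fact
  interpret B: unital_algebra K B by fact
  note MA = A.module_axioms and MB = B.module_axioms
  let ?F = "monoid_algebra K (A \<times>\<times> B)" and ?T = "tensor K A B" and ?I = "tensor_null K A B"
  have mon: "monoid (A \<times>\<times> B)"
    by (intro DirProd_monoid A.monoid_axioms B.monoid_axioms)
  interpret F: unital_algebra K ?F by (rule unital_algebra_monoid_algebra[OF mon])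
  note sub = submodule_tensor_null[OF MA MB]
  note T = module_tensor[OF MA MB]
  have proj: "(\<lambda>u. ?I +>\<^bsub>?F\<^esub> u) \<in> linear_maps K ?F ?T"
    unfolding tensor_def by (rule quot_module_proj_linear[OF F.module_axioms sub])
  have zero: "?I +>\<^bsub>?F\<^esub> u = \<zero>\<^bsub>?T\<^esub> \<longleftrightarrow> u \<in> ?I" if "u \<in> carrier ?F" for u
    unfolding tensor_def by (rule coset_eq_zero_iff[OF F.module_axioms sub that])
  have subI: "?I \<subseteq> carrier ?F"
    by (rule F.submoduleE(1)[OF sub])
  note l = linear_maps_comp[OF proj linear_maps_mult_left[OF F.unital_algebra_axioms linear_maps_id]]
    and r = linear_maps_comp[OF proj linear_maps_mult_right[OF F.unital_algebra_axioms linear_maps_id]]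
  note pb = pure_tensor_bilinear[OF MA MB]
  have sl: "?I +>\<^bsub>?F\<^esub> (single K (a, b) \<otimes>\<^bsub>?F\<^esub> u) = \<zero>\<^bsub>?T\<^esub>" if "a \<in> carrier A" "b \<in> carrier B" "u \<in> ?I" for a b u
  proof (rule linear_kills_tensor_null[OF MA MB T _ r _ \<open>u \<in> ?I\<close>])
    show "bilinear A B ?T (\<lambda>x y. pure_tensor K A B (a \<otimes>\<^bsub>A\<^esub> x) (b \<otimes>\<^bsub>B\<^esub> y))"
      by (intro pure_tensor_maps_bilinear MA MB linear_maps_mult_right[OF A linear_maps_id]
        linear_maps_mult_right[OF B linear_maps_id] that)
    show "single K (a, b) \<in> carrier ?F"
      using that by (intro single_closed) simp
    show "?I +>\<^bsub>?F\<^esub> (single K (a, b) \<otimes>\<^bsub>?F\<^esub> single K (x, y)) = pure_tensor K A B (a \<otimes>\<^bsub>A\<^esub> x) (b \<otimes>\<^bsub>B\<^esub> y)"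
      if "x \<in> carrier A" "y \<in> carrier B" for x y
      using that \<open>a \<in> carrier A\<close> \<open>b \<in> carrier B\<close> by (subst single_mult[OF mon]) (auto simp: pure_tensor_def)
  qed
  have sr: "?I +>\<^bsub>?F\<^esub> (u \<otimes>\<^bsub>?F\<^esub> single K (a, b)) = \<zero>\<^bsub>?T\<^esub>" if "a \<in> carrier A" "b \<in> carrier B" "u \<in> ?I" for a b u
  proof (rule linear_kills_tensor_null[OF MA MB T _ l _ \<open>u \<in> ?I\<close>])
    show "bilinear A B ?T (\<lambda>x y. pure_tensor K A B (x \<otimes>\<^bsub>A\<^esub> a) (y \<otimes>\<^bsub>B\<^esub> b))"
      by (intro pure_tensor_maps_bilinear MA MB linear_maps_mult_left[OF A linear_maps_id]
        linear_maps_mult_left[OF B linear_maps_id] that)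
    show "single K (a, b) \<in> carrier ?F"
      using that by (intro single_closed) simp
    show "?I +>\<^bsub>?F\<^esub> (single K (x, y) \<otimes>\<^bsub>?F\<^esub> single K (a, b)) = pure_tensor K A B (x \<otimes>\<^bsub>A\<^esub> a) (y \<otimes>\<^bsub>B\<^esub> b)"
      if "x \<in> carrier A" "y \<in> carrier B" for x y
      using that \<open>a \<in> carrier A\<close> \<open>b \<in> carrier B\<close> by (subst single_mult[OF mon]) (auto simp: pure_tensor_def)
  qed
  have z: "(\<lambda>x. \<zero>\<^bsub>?T\<^esub>) \<in> linear_maps K ?F ?T"
  proof -
    interpret T: module K ?T by (rule T)
    show ?thesis by (rule linear_mapsI) auto
  qed
  have fl: "?I +>\<^bsub>?F\<^esub> (f \<otimes>\<^bsub>?F\<^esub> u) = \<zero>\<^bsub>?T\<^esub>" and fr: "?I +>\<^bsub>?F\<^esub> (u \<otimes>\<^bsub>?F\<^esub> f) = \<zero>\<^bsub>?T\<^esub>"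
    if f: "f \<in> carrier ?F" and u: "u \<in> ?I" for f u
  proof -
    have uc: "u \<in> carrier ?F"
      using subI u by (rule subsetD)
    show "?I +>\<^bsub>?F\<^esub> (f \<otimes>\<^bsub>?F\<^esub> u) = \<zero>\<^bsub>?T\<^esub>"
      by (rule linear_eq_on_singles[OF T l[OF uc] z _ f]) (use sl u in auto)
    show "?I +>\<^bsub>?F\<^esub> (u \<otimes>\<^bsub>?F\<^esub> f) = \<zero>\<^bsub>?T\<^esub>"
      by (rule linear_eq_on_singles[OF T r[OF uc] z _ f]) (use sr u in auto)
  qed
  have uc: "u \<in> carrier ?F" if "u \<in> ?I" for u
    using subI that by (rule subsetD)
  show ?thesis
    by (rule idealI[OF F.ring_axioms submodule.axioms(1)[OF sub]])
      (simp_all only: zero[symmetric] F.m_closed uc fl fr)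
qed

lemma unital_algebra_tensor:
  assumes A: "unital_algebra K A" and B: "unital_algebra K B"
  shows "unital_algebra K (tensor K A B)"
proof -
  interpret A: unital_algebra K A by fact
  interpret B: unital_algebra K B by fact
  show ?thesis
    unfolding tensor_def
    by (intro unital_algebra_quot_module unital_algebra_monoid_algebra tensor_null_ideal A B
      DirProd_monoid A.monoid_axioms B.monoid_axioms)
qed

lemma pure_tensor_mult:
  assumes A: "unital_algebra K A" and B: "unital_algebra K B"
    and "x \<in> carrier A" "x' \<in> carrier A" "y \<in> carrier B" "y' \<in> carrier B"
  shows "pure_tensor K A B x y \<otimes>\<^bsub>tensor K A B\<^esub> pure_tensor K A B x' y' =
    pure_tensor K A B (x \<otimes>\<^bsub>A\<^esub> x') (y \<otimes>\<^bsub>B\<^esub> y')"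
proof -
  interpret A: unital_algebra K A by fact
  interpret B: unital_algebra K B by fact
  have mon: "monoid (A \<times>\<times> B)"
    by (intro DirProd_monoid A.monoid_axioms B.monoid_axioms)
  have "single K (x, y) \<in> carrier (monoid_algebra K (A \<times>\<times> B))"
    "single K (x', y') \<in> carrier (monoid_algebra K (A \<times>\<times> B))"
    using assms by (auto intro!: single_closed)
  then show ?thesis
    unfolding pure_tensor_def tensor_def
    using assms by (simp add: quot_module_mult[OF unital_algebra_monoid_algebra[OF mon] tensor_null_ideal[OF A B]]
      single_mult[OF mon])
qed

lemma tensor_one: "\<one>\<^bsub>tensor K A B\<^esub> = pure_tensor K A B \<one>\<^bsub>A\<^esub> \<one>\<^bsub>B\<^esub>"
  by (simp add: tensor_def quot_module_one pure_tensor_def DirProd_def)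

text \<open>Both sides of h(u v) = h(u) h(v) are linear in u and in v, so pure tensors
  suffice.\<close>

lemma tensor_alg_homI:
  assumes A: "unital_algebra K A" and B: "unital_algebra K B" and D: "unital_algebra K D"
    and h: "h \<in> linear_maps K (tensor K A B) D"
    and mult: "\<And>x y x' y'. \<lbrakk>x \<in> carrier A; y \<in> carrier B; x' \<in> carrier A; y' \<in> carrier B\<rbrakk> \<Longrightarrow>
      h (pure_tensor K A B (x \<otimes>\<^bsub>A\<^esub> x') (y \<otimes>\<^bsub>B\<^esub> y')) = h (pure_tensor K A B x y) \<otimes>\<^bsub>D\<^esub> h (pure_tensor K A B x' y')"
    and one: "h (pure_tensor K A B \<one>\<^bsub>A\<^esub> \<one>\<^bsub>B\<^esub>) = \<one>\<^bsub>D\<^esub>"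
  shows "h \<in> alg_homs (tensor K A B) D"
proof (rule alg_homsI[OF h])
  let ?T = "tensor K A B"
  note MA = module_unital_algebra[OF A] and MB = module_unital_algebra[OF B] and MD = module_unital_algebra[OF D]
  note T = unital_algebra_tensor[OF A B]
  show "h \<one>\<^bsub>?T\<^esub> = \<one>\<^bsub>D\<^esub>"
    by (simp add: tensor_one one)
  fix u v assume u: "u \<in> carrier ?T" and v: "v \<in> carrier ?T"
  have hv: "h v \<in> carrier D"
    by (rule linear_maps_closed[OF h v])
  show "h (u \<otimes>\<^bsub>?T\<^esub> v) = h u \<otimes>\<^bsub>D\<^esub> h v"
  proof (rule linear_eq_on_pure[OF MA MB MD _ _ _ u])
    show "(\<lambda>u. h (u \<otimes>\<^bsub>?T\<^esub> v)) \<in> linear_maps K ?T D" "(\<lambda>u. h u \<otimes>\<^bsub>D\<^esub> h v) \<in> linear_maps K ?T D"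
      by (rule linear_maps_comp[OF h linear_maps_mult_left[OF T linear_maps_id v]],
          rule linear_maps_mult_left[OF D h hv])
    fix x y assume xy: "x \<in> carrier A" "y \<in> carrier B"
    note p = pure_tensor_closed[OF xy]
    show "h (pure_tensor K A B x y \<otimes>\<^bsub>?T\<^esub> v) = h (pure_tensor K A B x y) \<otimes>\<^bsub>D\<^esub> h v"
    proof (rule linear_eq_on_pure[OF MA MB MD _ _ _ v])
      show "(\<lambda>v. h (pure_tensor K A B x y \<otimes>\<^bsub>?T\<^esub> v)) \<in> linear_maps K ?T D"
        "(\<lambda>v. h (pure_tensor K A B x y) \<otimes>\<^bsub>D\<^esub> h v) \<in> linear_maps K ?T D"
        by (rule linear_maps_comp[OF h linear_maps_mult_right[OF T linear_maps_id p]],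
            rule linear_maps_mult_right[OF D h linear_maps_closed[OF h p]])
    qed (simp add: pure_tensor_mult[OF A B] xy mult)
  qed
qed

lemma tensor_map_alg_hom:
  assumes A: "unital_algebra K A" and B: "unital_algebra K B" and A': "unital_algebra K A'" and B': "unital_algebra K B'"
    and f: "f \<in> alg_homs A A'" and g: "g \<in> alg_homs B B'"
  shows "tensor_map K A' B' f g \<in> alg_homs (tensor K A B) (tensor K A' B')"
proof -
  interpret A: unital_algebra K A by fact
  interpret B: unital_algebra K B by fact
  note M = module_unital_algebra[OF A] module_unital_algebra[OF B] module_unital_algebra[OF A'] module_unital_algebra[OF B']
  note lin = alg_homs_linear[OF f] alg_homs_linear[OF g]
  show ?thesis
    by (rule tensor_alg_homI[OF A B unital_algebra_tensor[OF A' B'] tensor_map_linear[OF M lin]])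
      (simp_all add: tensor_map_pure[OF M lin] pure_tensor_mult[OF A' B'] alg_homs_mult[OF f] alg_homs_mult[OF g]
        alg_homs_one[OF f] alg_homs_one[OF g] alg_homs_closed[OF f] alg_homs_closed[OF g] tensor_one)
qed

section \<open>The ground field as an algebra; opposite algebras\<close>

lemma unital_algebra_self_module: "unital_algebra K (self_module K)"
proof -
  interpret S: module K "self_module K" by (rule module_self)
  have "ring (self_module K)"
    by (rule ringI[OF S.abelian_group_axioms])
      (auto intro!: monoidI simp: self_module_def m_assoc l_distr r_distr)
  then show ?thesis
    by (intro unital_algebra.intro unital_algebra_axioms.intro field_axioms S.module_axioms)
      (auto simp: self_module_def m_assoc m_lcomm)
qed

lemma opposite_simps [simp]:
  "carrier (opposite A) = carrier A" "\<one>\<^bsub>opposite A\<^esub> = \<one>\<^bsub>A\<^esub>" "\<zero>\<^bsub>opposite A\<^esub> = \<zero>\<^bsub>A\<^esub>"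
  "x \<oplus>\<^bsub>opposite A\<^esub> y = x \<oplus>\<^bsub>A\<^esub> y" "a \<odot>\<^bsub>opposite A\<^esub> x = a \<odot>\<^bsub>A\<^esub> x" "x \<otimes>\<^bsub>opposite A\<^esub> y = y \<otimes>\<^bsub>A\<^esub> x"
  by (simp_all add: opposite_def)

text \<open>An algebra and its opposite have the same underlying vector space; only algebra maps
  tell them apart.\<close>

lemma linear_maps_opposite [simp]:
  "linear_maps K M (opposite A) = linear_maps K M A" "linear_maps K (opposite A) M = linear_maps K A M"
  by (simp_all add: linear_maps_def)

lemma bilinear_opposite [simp]: "bilinear (opposite A) (opposite B) Z g = bilinear A B Z g"
  by (simp add: bilinear_def)

lemma unital_algebra_opposite:
  assumes A: "unital_algebra K A"
  shows "unital_algebra K (opposite A)"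
proof -
  interpret A: unital_algebra K A by fact
  have ab: "abelian_group (opposite A)"
  proof (rule abelian_groupI)
    fix x assume "x \<in> carrier (opposite A)"
    then show "\<exists>y\<in>carrier (opposite A). y \<oplus>\<^bsub>opposite A\<^esub> x = \<zero>\<^bsub>opposite A\<^esub>"
      by (intro bexI[of _ "\<ominus>\<^bsub>A\<^esub> x"]) (auto simp: A.l_neg)
  qed (auto simp: A.a_ac)
  have "module K (opposite A)"
    by (rule moduleI[OF is_cring ab]) (auto simp: A.smult_l_distr A.smult_r_distr A.smult_assoc1)
  moreover have "ring (opposite A)"
    by (rule ringI[OF ab]) (auto intro!: monoidI simp: A.m_assoc A.l_distr A.r_distr)
  ultimately show ?thesis
    by (intro unital_algebra.intro unital_algebra_axioms.intro field_axioms)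
      (auto simp: A.smult_mult_left A.smult_mult_right)
qed

section \<open>Free and presented algebras\<close>

lemma monoid_free_monoid: "monoid (free_monoid X)"
  by (rule monoidI) (auto simp: free_monoid_def)

lemma unital_algebra_free_algebra: "unital_algebra K (free_algebra K X)"
  unfolding free_algebra_def by (rule unital_algebra_monoid_algebra[OF monoid_free_monoid])

lemma free_gen_closed: "x \<in> X \<Longrightarrow> single K [x] \<in> carrier (free_algebra K X)"
  unfolding free_algebra_def by (rule single_closed) (simp add: free_monoid_def)

text \<open>On words the extension is the product of the values of the letters, which turns
  concatenation into multiplication. Both sides of multiplicativity are bilinear, so words are
  enough.\<close>

lemma alg_ext_alg_hom:
  assumes B: "unital_algebra K B" and g: "\<And>x. x \<in> X \<Longrightarrow> g x \<in> carrier B"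
  shows "alg_ext K B g \<in> alg_homs (free_algebra K X) B"
    and "x \<in> X \<Longrightarrow> alg_ext K B g (single K [x]) = g x"
proof -
  interpret B: unital_algebra K B by fact
  let ?p = "\<lambda>w. foldr (\<lambda>x b. g x \<otimes>\<^bsub>B\<^esub> b) w \<one>\<^bsub>B\<^esub>"
  let ?F = "free_algebra K X"
  have F: "unital_algebra K ?F" by (rule unital_algebra_free_algebra)
  have p: "?p w \<in> carrier B" if "w \<in> lists X" for w
    using that by (induction w) (auto simp: g)
  have pa: "?p (v @ w) = ?p v \<otimes>\<^bsub>B\<^esub> ?p w" if "v \<in> lists X" "w \<in> lists X" for v w
    using that(1)
  proof (induction v)
    case (Cons x v)
    then show ?case
      using that(2) p[of v] p[of w] by (simp add: g B.m_assoc)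
  qed (use p[OF that(2)] in simp)
  have lin: "alg_ext K B g \<in> linear_maps K ?F B"
    unfolding alg_ext_def free_algebra_def
    by (rule lin_ext_linear[OF B.module_axioms]) (simp add: p free_monoid_def)
  have s: "alg_ext K B g (single K w) = ?p w" if "w \<in> lists X" for w
    unfolding alg_ext_def by (rule lin_ext_single[where g = ?p, OF B.module_axioms p[OF that]])
  show "alg_ext K B g (single K [x]) = g x" if "x \<in> X"
    using that by (simp add: s g)
  show "alg_ext K B g \<in> alg_homs ?F B"
  proof (rule alg_homsI[OF lin])
    show "alg_ext K B g \<one>\<^bsub>?F\<^esub> = \<one>\<^bsub>B\<^esub>"
      using s[of "[]"] by (simp add: free_algebra_def free_monoid_def)
    fix u v assume u: "u \<in> carrier ?F" and v: "v \<in> carrier ?F"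
    note cl = linear_maps_closed[OF lin]
    have s': "single K w \<in> carrier ?F" if "w \<in> lists X" for w
      unfolding free_algebra_def using that by (intro single_closed) (simp add: free_monoid_def)
    show "alg_ext K B g (u \<otimes>\<^bsub>?F\<^esub> v) = alg_ext K B g u \<otimes>\<^bsub>B\<^esub> alg_ext K B g v"
    proof (rule linear_eq_on_singles[OF B.module_axioms _ _ _ u[unfolded free_algebra_def], folded free_algebra_def])
      show "(\<lambda>u. alg_ext K B g (u \<otimes>\<^bsub>?F\<^esub> v)) \<in> linear_maps K ?F B"
        "(\<lambda>u. alg_ext K B g u \<otimes>\<^bsub>B\<^esub> alg_ext K B g v) \<in> linear_maps K ?F B"
        by (rule linear_maps_comp[OF lin linear_maps_mult_left[OF F linear_maps_id v]],
            rule linear_maps_mult_left[OF B lin cl[OF v]])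
      fix w assume "w \<in> carrier (free_monoid X)"
      then have w: "w \<in> lists X"
        by (simp add: free_monoid_def)
      show "alg_ext K B g (single K w \<otimes>\<^bsub>?F\<^esub> v) = alg_ext K B g (single K w) \<otimes>\<^bsub>B\<^esub> alg_ext K B g v"
      proof (rule linear_eq_on_singles[OF B.module_axioms _ _ _ v[unfolded free_algebra_def], folded free_algebra_def])
        show "(\<lambda>v. alg_ext K B g (single K w \<otimes>\<^bsub>?F\<^esub> v)) \<in> linear_maps K ?F B"
          "(\<lambda>v. alg_ext K B g (single K w) \<otimes>\<^bsub>B\<^esub> alg_ext K B g v) \<in> linear_maps K ?F B"
          by (rule linear_maps_comp[OF lin linear_maps_mult_right[OF F linear_maps_id s'[OF w]]],
              rule linear_maps_mult_right[OF B lin cl[OF s'[OF w]]])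
        fix w' assume "w' \<in> carrier (free_monoid X)"
        then have w': "w' \<in> lists X"
          by (simp add: free_monoid_def)
        have "single K w \<otimes>\<^bsub>?F\<^esub> single K w' = single K (w @ w')"
          unfolding free_algebra_def using w w'
          by (subst single_mult[OF monoid_free_monoid]) (auto simp: free_monoid_def)
        then show "alg_ext K B g (single K w \<otimes>\<^bsub>?F\<^esub> single K w') =
            alg_ext K B g (single K w) \<otimes>\<^bsub>B\<^esub> alg_ext K B g (single K w')"
          using w w' by (simp add: s pa del: foldr_append)
      qed
    qed
  qed
qed

text \<open>A word is the product of its letters and words form a basis, so induction over words
  followed by linearity gives the claim.\<close>

lemma free_algebra_hom_eq:
  assumes B: "unital_algebra K B" and h: "h \<in> alg_homs (free_algebra K X) B" and h': "h' \<in> alg_homs (free_algebra K X) B"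
    and eq: "\<And>x. x \<in> X \<Longrightarrow> h (single K [x]) = h' (single K [x])" and u: "u \<in> carrier (free_algebra K X)"
  shows "h u = h' u"
proof (rule linear_eq_on_singles[OF module_unital_algebra[OF B] alg_homs_linear[OF h, unfolded free_algebra_def]
    alg_homs_linear[OF h', unfolded free_algebra_def] _ u[unfolded free_algebra_def]])
  let ?F = "free_algebra K X"
  fix w assume "w \<in> carrier (free_monoid X)"
  then have "w \<in> lists X"
    by (simp add: free_monoid_def)
  then show "h (single K w) = h' (single K w)"
  proof (induction w)
    case Nil
    have "single K [] = \<one>\<^bsub>?F\<^esub>"
      by (simp add: free_algebra_def free_monoid_def)
    then show ?case
      by (simp only: alg_homs_one[OF h] alg_homs_one[OF h'])
  next
    case (Cons x w)
    have c: "single K [x] \<in> carrier ?F" "single K w \<in> carrier ?F"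
      unfolding free_algebra_def using Cons by (auto intro!: single_closed simp: free_monoid_def)
    have "single K (x # w) = single K [x] \<otimes>\<^bsub>?F\<^esub> single K w"
      unfolding free_algebra_def using Cons
      by (subst single_mult[OF monoid_free_monoid]) (auto simp: free_monoid_def)
    then show ?case
      using Cons by (simp add: alg_homs_mult[OF h c] alg_homs_mult[OF h' c] eq)
  qed
qed

lemma Idl_free_algebra:
  assumes "R \<subseteq> carrier (free_algebra K X)"
  shows "ideal (Idl\<^bsub>free_algebra K X\<^esub> R) (free_algebra K X)"
  using ring.genideal_ideal[OF ring_unital_algebra[OF unital_algebra_free_algebra] assms] .

lemma unital_algebra_presented_algebra:
  assumes "R \<subseteq> carrier (free_algebra K X)"
  shows "unital_algebra K (presented_algebra K X R)"
  unfolding presented_algebra_def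
  by (rule unital_algebra_quot_module[OF unital_algebra_free_algebra Idl_free_algebra[OF assms]])

lemma presented_algebra_proj:
  assumes "R \<subseteq> carrier (free_algebra K X)"
  shows "(\<lambda>x. Idl\<^bsub>free_algebra K X\<^esub> R +>\<^bsub>free_algebra K X\<^esub> x)
    \<in> alg_homs (free_algebra K X) (presented_algebra K X R)"
  unfolding presented_algebra_def
  by (rule quot_module_proj_alg_hom[OF unital_algebra_free_algebra Idl_free_algebra[OF assms]])

lemma presented_algebra_rel:
  assumes R: "R \<subseteq> carrier (free_algebra K X)" and r: "r \<in> R"
  shows "Idl\<^bsub>free_algebra K X\<^esub> R +>\<^bsub>free_algebra K X\<^esub> r = \<zero>\<^bsub>presented_algebra K X R\<^esub>"
proof -
  note F = unital_algebra_free_algebra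
  have "r \<in> Idl\<^bsub>free_algebra K X\<^esub> R"
    using ring.genideal_self[OF ring_unital_algebra[OF F] R] r by (rule subsetD)
  then show ?thesis
    unfolding presented_algebra_def
    using coset_eq_zero_iff[OF module_unital_algebra[OF F] ideal_submodule[OF F Idl_free_algebra[OF R]]] R r
    by (simp add: subset_iff)
qed

lemma generator_closed:
  assumes "R \<subseteq> carrier (free_algebra K X)" "x \<in> X"
  shows "generator K X R x \<in> carrier (presented_algebra K X R)"
  unfolding generator_def by (rule alg_homs_closed[OF presented_algebra_proj[OF assms(1)] free_gen_closed[OF assms(2)]])

text \<open>Existence half of the universal property. All structure maps and all maps into H on
  presented algebras are obtained from it.\<close>

lemma presented_algebra_lift:
  assumes R: "R \<subseteq> carrier (free_algebra K X)" and B: "unital_algebra K B"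
    and g: "\<And>x. x \<in> X \<Longrightarrow> g x \<in> carrier B" and kill: "\<And>r. r \<in> R \<Longrightarrow> alg_ext K B g r = \<zero>\<^bsub>B\<^esub>"
  shows "coset_lift (alg_ext K B g) \<in> alg_homs (presented_algebra K X R) B"
    and "x \<in> X \<Longrightarrow> coset_lift (alg_ext K B g) (generator K X R x) = g x"
proof -
  note F = unital_algebra_free_algebra
  note e = alg_ext_alg_hom(1)[where g = g and X = X, OF B g]
  note lift = coset_lift_alg_hom[OF F B Idl_free_algebra[OF R] e alg_hom_kills_Idl[OF F B e R kill]]
  show "coset_lift (alg_ext K B g) \<in> alg_homs (presented_algebra K X R) B"
    unfolding presented_algebra_def by (rule lift(1))
  show "coset_lift (alg_ext K B g) (generator K X R x) = g x" if "x \<in> X"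
    unfolding generator_def using alg_ext_alg_hom(2)[where g = g and X = X, OF B g that]
    by (simp add: lift(2) free_gen_closed[OF that])
qed

text \<open>Uniqueness half: the projection from the free algebra is onto, so two maps agree as soon
  as their composites with it agree on the free generators.\<close>

lemma presented_algebra_hom_eq:
  assumes R: "R \<subseteq> carrier (free_algebra K X)" and B: "unital_algebra K B"
    and h: "h \<in> alg_homs (presented_algebra K X R) B" and h': "h' \<in> alg_homs (presented_algebra K X R) B"
    and eq: "\<And>x. x \<in> X \<Longrightarrow> h (generator K X R x) = h' (generator K X R x)"
    and u: "u \<in> carrier (presented_algebra K X R)"
  shows "h u = h' u"
proof -
  let ?F = "free_algebra K X"
  obtain v where v: "v \<in> carrier ?F" "u = Idl\<^bsub>?F\<^esub> R +>\<^bsub>?F\<^esub> v"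
    using u unfolding presented_algebra_def quot_module_carrier by blast
  show ?thesis
    unfolding v(2)
    by (rule free_algebra_hom_eq[OF B alg_homs_comp[OF h presented_algebra_proj[OF R]]
        alg_homs_comp[OF h' presented_algebra_proj[OF R]] _ v(1)])
      (use eq in \<open>simp add: generator_def\<close>)
qed

section \<open>Sweedler calculus\<close>

lemma coalgebra_module: "coalgebra K C \<Longrightarrow> module K C"
  by (simp add: coalgebra_def)

lemma coalgebra_comult_linear: "coalgebra K C \<Longrightarrow> comult C \<in> linear_maps K C (tensor K C C)"
  by (rule coalgebra.comult_linear)

lemma coalgebra_counit_linear: "coalgebra K C \<Longrightarrow> counit C \<in> linear_maps K C (self_module K)"
  by (rule coalgebra.counit_linear)

lemma self_module_carrier [simp]: "carrier (self_module K) = carrier K"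
  by (simp add: self_module_def)

lemma coalgebra_counit_closed: "\<lbrakk>coalgebra K C; c \<in> carrier C\<rbrakk> \<Longrightarrow> counit C c \<in> carrier K"
  using linear_maps_closed[OF coalgebra_counit_linear] by fastforce

lemma coalgebra_comult_closed: "\<lbrakk>coalgebra K C; c \<in> carrier C\<rbrakk> \<Longrightarrow> comult C c \<in> carrier (tensor K C C)"
  by (rule linear_maps_closed[OF coalgebra_comult_linear])

text \<open>Here the tensor is fixed and the bilinear map varies, so linearity is not that of a
  composite with the lift. For given parameters both sides of the claim are linear in t, hence it
  may be checked on pure tensors.\<close>

lemma tensor_lift_param_linear:
  assumes M: "module K M" and N: "module K N" and Z: "module K Z" and P: "module K P"
    and lin: "\<And>u v. \<lbrakk>u \<in> carrier M; v \<in> carrier N\<rbrakk> \<Longrightarrow> (\<lambda>x. g x u v) \<in> linear_maps K P Z"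
    and bil: "\<And>x. x \<in> carrier P \<Longrightarrow> bilinear M N Z (\<lambda>u v. g x u v)"
    and t: "t \<in> carrier (tensor K M N)"
  shows "(\<lambda>x. tensor_lift K Z (\<lambda>u v. g x u v) t) \<in> linear_maps K P Z"
proof (rule linear_mapsI)
  interpret Z: module K Z by fact
  interpret P: module K P by fact
  note l = tensor_lift_linear[OF M N Z bil]
  show "tensor_lift K Z (\<lambda>u v. g x u v) t \<in> carrier Z" if "x \<in> carrier P" for x
    by (rule linear_maps_closed[OF l[OF that] t])
  show "tensor_lift K Z (\<lambda>u v. g (x \<oplus>\<^bsub>P\<^esub> y) u v) t =
      tensor_lift K Z (\<lambda>u v. g x u v) t \<oplus>\<^bsub>Z\<^esub> tensor_lift K Z (\<lambda>u v. g y u v) t"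
    if x: "x \<in> carrier P" and y: "y \<in> carrier P" for x y
  proof (rule linear_eq_on_pure[OF M N Z l[OF P.a_closed[OF x y]] _ _ t])
    show "(\<lambda>t. tensor_lift K Z (\<lambda>u v. g x u v) t \<oplus>\<^bsub>Z\<^esub> tensor_lift K Z (\<lambda>u v. g y u v) t)
        \<in> linear_maps K (tensor K M N) Z"
      by (rule linear_mapsI)
        (simp_all add: linear_maps_closed[OF l[OF x]] linear_maps_closed[OF l[OF y]] linear_maps_add[OF l[OF x]]
          linear_maps_add[OF l[OF y]] linear_maps_smult[OF l[OF x]] linear_maps_smult[OF l[OF y]] Z.smult_r_distr Z.a_ac)
  qed (simp add: tensor_lift_pure M N Z bil x y linear_maps_add[OF lin])
  show "tensor_lift K Z (\<lambda>u v. g (a \<odot>\<^bsub>P\<^esub> x) u v) t = a \<odot>\<^bsub>Z\<^esub> tensor_lift K Z (\<lambda>u v. g x u v) t"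
    if a: "a \<in> carrier K" and x: "x \<in> carrier P" for a x
    by (rule linear_eq_on_pure[OF M N Z l[OF P.smult_closed[OF a x]] linear_maps_smult_right[OF Z l[OF x] a] _ t])
      (simp add: tensor_lift_pure M N Z bil x a linear_maps_smult[OF lin])
qed

section \<open>Sums over the coproduct of an element\<close>

lemma sweedler_closed:
  assumes "coalgebra K C" "module K Z" "bilinear C C Z g" "c \<in> carrier C"
  shows "tensor_lift K Z g (comult C c) \<in> carrier Z"
  using assms by (intro linear_maps_closed[OF tensor_lift_linear[where M = C and N = C]] coalgebra_comult_closed coalgebra_module)

text \<open>A variable can enter a Sweedler sum in two ways: under the coproduct, as here, or in the
  summand, as in \<open>sweedler_param_linear\<close>.\<close>

lemma sweedler_linear:
  assumes "coalgebra K C" "module K Z" "f \<in> linear_maps K P C" "bilinear C C Z g"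
  shows "(\<lambda>x. tensor_lift K Z g (comult C (f x))) \<in> linear_maps K P Z"
proof -
  have "(\<lambda>x. comult C (f x)) \<in> linear_maps K P (tensor K C C)"
    by (rule linear_maps_comp[OF coalgebra_comult_linear]) (fact assms)+
  then show ?thesis
    using assms coalgebra_module[OF assms(1)]
    by (intro linear_maps_comp[where g = "tensor_lift K Z g", OF tensor_lift_linear])
qed

lemma sweedler_param_linear:
  assumes "coalgebra K C" "module K Z" "module K P" "c \<in> carrier C"
    "\<And>u v. \<lbrakk>u \<in> carrier C; v \<in> carrier C\<rbrakk> \<Longrightarrow> (\<lambda>x. g x u v) \<in> linear_maps K P Z"
    "\<And>x. x \<in> carrier P \<Longrightarrow> bilinear C C Z (\<lambda>u v. g x u v)"
  shows "(\<lambda>x. tensor_lift K Z (\<lambda>u v. g x u v) (comult C c)) \<in> linear_maps K P Z"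
  using assms by (intro tensor_lift_param_linear[where M = C and N = C] coalgebra_module coalgebra_comult_closed)

lemma sweedler_cong:
  assumes "coalgebra K C" "module K Z" "c \<in> carrier C" "bilinear C C Z g"
    "\<And>x y. \<lbrakk>x \<in> carrier C; y \<in> carrier C\<rbrakk> \<Longrightarrow> g' x y = g x y"
  shows "tensor_lift K Z g' (comult C c) = tensor_lift K Z g (comult C c)"
  using assms by (intro tensor_lift_cong[where M = C and N = C] coalgebra_module coalgebra_comult_closed)

lemma linear_sweedler:
  assumes "coalgebra K C" "module K Z" "module K Z'" "c \<in> carrier C" "bilinear C C Z g" "h \<in> linear_maps K Z Z'"
  shows "h (tensor_lift K Z g (comult C c)) = tensor_lift K Z' (\<lambda>x y. h (g x y)) (comult C c)"
  using assms coalgebra_module[OF assms(1)]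
  by (intro linear_tensor_lift[where M = C and N = C] coalgebra_comult_closed)

lemma algebra_mult_closed:
  "\<lbrakk>unital_algebra K A; x \<in> carrier A; y \<in> carrier A\<rbrakk> \<Longrightarrow> x \<otimes>\<^bsub>A\<^esub> y \<in> carrier A"
  using monoid.m_closed ring.is_monoid ring_unital_algebra by metis

lemma algebra_one_closed: "unital_algebra K A \<Longrightarrow> \<one>\<^bsub>A\<^esub> \<in> carrier A"
  using monoid.one_closed ring.is_monoid ring_unital_algebra by metis

lemma smult_closed: "\<lbrakk>module K M; a \<in> carrier K; x \<in> carrier M\<rbrakk> \<Longrightarrow> a \<odot>\<^bsub>M\<^esub> x \<in> carrier M"
  by (rule module.smult_closed)

text \<open>
  These rules decompose any expression that is multilinear in its variables: as each variable
  occurs exactly once, at most one rule applies to a given subgoal.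
\<close>

lemmas multilinear = bilinearI linear_maps_id linear_maps_mult_left linear_maps_mult_right
  linear_maps_smult_left linear_maps_smult_right sweedler_linear sweedler_param_linear
  module_unital_algebra coalgebra_module sweedler_closed algebra_mult_closed algebra_one_closed
  coalgebra_counit_linear coalgebra_counit_closed linear_maps_comp[OF coalgebra_counit_linear] smult_closed

text \<open>The trilinear g induces a linear map on C \<otimes> (C \<otimes> C). Applied to the
  right side of the coassociativity axiom it gives the right-nested sum; composed with the
  associator it becomes the lift of g on (C \<otimes> C) \<otimes> C, and so gives the left-nested
  one.\<close>

lemma sweedler_coassoc:
  assumes C: "coalgebra K C" and Z: "module K Z" and c: "c \<in> carrier C"
    and g1: "\<And>y z. \<lbrakk>y \<in> carrier C; z \<in> carrier C\<rbrakk> \<Longrightarrow> (\<lambda>x. g x y z) \<in> linear_maps K C Z"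
    and g2: "\<And>x z. \<lbrakk>x \<in> carrier C; z \<in> carrier C\<rbrakk> \<Longrightarrow> (\<lambda>y. g x y z) \<in> linear_maps K C Z"
    and g3: "\<And>x y. \<lbrakk>x \<in> carrier C; y \<in> carrier C\<rbrakk> \<Longrightarrow> (\<lambda>z. g x y z) \<in> linear_maps K C Z"
  shows "tensor_lift K Z (\<lambda>u z. tensor_lift K Z (\<lambda>x y. g x y z) (comult C u)) (comult C c) =
    tensor_lift K Z (\<lambda>x u. tensor_lift K Z (\<lambda>y z. g x y z) (comult C u)) (comult C c)"
proof -
  note M = coalgebra_module[OF C] and cm = coalgebra_comult_linear[OF C]
  let ?T2 = "tensor K C C"
  let ?T = "tensor K C ?T2"
  have T2: "module K ?T2" by (rule module_tensor[OF M M])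
  have T: "module K ?T" by (rule module_tensor[OF M T2])
  \<comment> \<open>\<Phi> is the map with x \<otimes> (y \<otimes> z) going to g x y z; \<alpha>
    below is the bilinear map behind \<open>tensor_assoc\<close>.\<close>
  let ?\<Phi> = "tensor_lift K Z (\<lambda>x w. tensor_lift K Z (\<lambda>y z. g x y z) w)"
  let ?\<alpha> = "\<lambda>u z. tensor_lift K ?T (\<lambda>x y. pure_tensor K C ?T2 x (pure_tensor K C C y z)) u"
  note p1 = pure_tensor_bilinear[OF M M] and p2 = pure_tensor_bilinear[OF M T2]
  have b23: "bilinear C C Z (\<lambda>y z. g x y z)" if "x \<in> carrier C" for x
    using that by (intro bilinearI g2 g3)
  have b: "bilinear C ?T2 Z (\<lambda>x w. tensor_lift K Z (\<lambda>y z. g x y z) w)"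
    by (intro bilinearI tensor_lift_param_linear[OF M M Z M] tensor_lift_linear[OF M M Z] b23 g1)
  note \<Phi> = tensor_lift_linear[OF M T2 Z b]
  have bp: "bilinear C C ?T (\<lambda>x y. pure_tensor K C ?T2 x (pure_tensor K C C y z))" if "z \<in> carrier C" for z
    using that
    by (intro bilinearI bilinear_left[OF p2 linear_maps_id] bilinear_right[OF p2] bilinear_left[OF p1 linear_maps_id]
      pure_tensor_closed)
  have b\<alpha>: "bilinear ?T2 C ?T ?\<alpha>"
    by (intro bilinearI tensor_lift_param_linear[OF M M T M] tensor_lift_linear[OF M M T] bp
      bilinear_right[OF p2] bilinear_right[OF p1 linear_maps_id])
  have id: "id \<in> linear_maps K C C"
    by (simp add: linear_maps_def)
  note \<Delta> = coalgebra_comult_closed[OF C]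
  have \<Phi>p: "?\<Phi> (pure_tensor K C ?T2 x (pure_tensor K C C y z)) = g x y z"
    if "x \<in> carrier C" "y \<in> carrier C" "z \<in> carrier C" for x y z
    using that by (simp add: tensor_lift_pure[OF M T2 Z b] tensor_lift_pure[OF M M Z b23] pure_tensor_closed)
  have \<Phi>\<alpha>: "?\<Phi> (?\<alpha> u z) = tensor_lift K Z (\<lambda>x y. g x y z) u" if "u \<in> carrier ?T2" "z \<in> carrier C" for u z
  proof -
    have "?\<Phi> (?\<alpha> u z) = tensor_lift K Z (\<lambda>x y. ?\<Phi> (pure_tensor K C ?T2 x (pure_tensor K C C y z))) u"
      by (rule linear_tensor_lift[OF M M T Z bp[OF that(2)] \<Phi> that(1)])
    also have "\<dots> = tensor_lift K Z (\<lambda>x y. g x y z) u"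
      by (rule tensor_lift_cong[OF M M Z _ _ that(1)]) (use that in \<open>auto intro!: bilinearI g1 g2 simp: \<Phi>p\<close>)
    finally show ?thesis .
  qed
  have bl: "bilinear ?T2 C Z (\<lambda>u z. tensor_lift K Z (\<lambda>x y. g x y z) u)"
    by (intro bilinearI tensor_lift_param_linear[OF M M Z M] tensor_lift_linear[OF M M Z] g1 g2 g3)
  let ?d = "tensor_map K ?T2 C (comult C) id (comult C c)"
  have d: "?d \<in> carrier (tensor K ?T2 C)"
    by (rule linear_maps_closed[OF tensor_map_linear[OF M M T2 M cm id] \<Delta>[OF c]])
  have "?\<Phi> (tensor_assoc K C C C ?d) = ?\<Phi> (tensor_map K C ?T2 id (comult C) (comult C c))"
    by (simp only: coalgebra.coassoc[OF C c])
  also have "\<dots> = tensor_lift K Z (\<lambda>x u. tensor_lift K Z (\<lambda>y z. g x y z) (comult C u)) (comult C c)"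
    by (subst tensor_lift_tensor_map[OF M M M T2 Z id cm b \<Delta>[OF c]]) simp
  finally have "\<dots> = ?\<Phi> (tensor_assoc K C C C ?d)" ..
  also have "\<dots> = tensor_lift K Z (\<lambda>u z. ?\<Phi> (?\<alpha> u z)) ?d"
    unfolding tensor_assoc_def Let_def by (rule linear_tensor_lift[OF T2 M T Z b\<alpha> \<Phi> d])
  also have "\<dots> = tensor_lift K Z (\<lambda>u z. tensor_lift K Z (\<lambda>x y. g x y z) u) ?d"
    by (rule tensor_lift_cong[OF T2 M Z bl \<Phi>\<alpha> d])
  also have "\<dots> = tensor_lift K Z (\<lambda>u z. tensor_lift K Z (\<lambda>x y. g x y z) (comult C u)) (comult C c)"
    by (subst tensor_lift_tensor_map[OF M M T2 M Z cm id bl \<Delta>[OF c]]) simp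
  finally show ?thesis ..
qed

lemma sweedler_counit_left:
  assumes C: "coalgebra K C" and Z: "module K Z" and h: "h \<in> linear_maps K C Z" and c: "c \<in> carrier C"
  shows "tensor_lift K Z (\<lambda>x y. counit C x \<odot>\<^bsub>Z\<^esub> h y) (comult C c) = h c"
proof -
  note M = coalgebra_module[OF C]
  have "tensor_lift K Z (\<lambda>x y. counit C x \<odot>\<^bsub>Z\<^esub> h y) (comult C c) =
      tensor_lift K Z (\<lambda>x y. h (counit C x \<odot>\<^bsub>C\<^esub> y)) (comult C c)"
    by (rule sweedler_cong[OF C Z c, symmetric])
      ((assumption | rule multilinear C Z h linear_maps_comp[OF h] linear_maps_closed[OF h])+,
        simp add: linear_maps_smult[OF h] coalgebra_counit_closed[OF C])
  also have "\<dots> = h (tensor_lift K C (\<lambda>x y. counit C x \<odot>\<^bsub>C\<^esub> y) (comult C c))"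
    by (rule linear_sweedler[OF C M Z c _ h, symmetric]) (assumption | rule multilinear C M)+
  finally show ?thesis
    by (simp add: coalgebra.counit_left[OF C c])
qed

lemma sweedler_counit_right:
  assumes C: "coalgebra K C" and Z: "module K Z" and h: "h \<in> linear_maps K C Z" and c: "c \<in> carrier C"
  shows "tensor_lift K Z (\<lambda>x y. counit C y \<odot>\<^bsub>Z\<^esub> h x) (comult C c) = h c"
proof -
  note M = coalgebra_module[OF C]
  have "tensor_lift K Z (\<lambda>x y. counit C y \<odot>\<^bsub>Z\<^esub> h x) (comult C c) =
      tensor_lift K Z (\<lambda>x y. h (counit C y \<odot>\<^bsub>C\<^esub> x)) (comult C c)"
    by (rule sweedler_cong[OF C Z c, symmetric])
      ((assumption | rule multilinear C Z h linear_maps_comp[OF h] linear_maps_closed[OF h])+,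
        simp add: linear_maps_smult[OF h] coalgebra_counit_closed[OF C])
  also have "\<dots> = h (tensor_lift K C (\<lambda>x y. counit C y \<odot>\<^bsub>C\<^esub> x) (comult C c))"
    by (rule linear_sweedler[OF C M Z c _ h, symmetric]) (assumption | rule multilinear C M)+
  finally show ?thesis
    by (simp add: coalgebra.counit_right[OF C c])
qed

text \<open>Interchange of two independent sums. With the coproduct of c replaced by an arbitrary
  tensor t, both sides are linear in t; on a pure tensor each side reduces to a single sum over
  d.\<close>

lemma sweedler_swap:
  assumes C: "coalgebra K C" and D: "coalgebra K D" and Z: "module K Z" and c: "c \<in> carrier C" and d: "d \<in> carrier D"
    and g1: "\<And>y u v. \<lbrakk>y \<in> carrier C; u \<in> carrier D; v \<in> carrier D\<rbrakk> \<Longrightarrow> (\<lambda>x. g x y u v) \<in> linear_maps K C Z"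
    and g2: "\<And>x u v. \<lbrakk>x \<in> carrier C; u \<in> carrier D; v \<in> carrier D\<rbrakk> \<Longrightarrow> (\<lambda>y. g x y u v) \<in> linear_maps K C Z"
    and g3: "\<And>x y v. \<lbrakk>x \<in> carrier C; y \<in> carrier C; v \<in> carrier D\<rbrakk> \<Longrightarrow> (\<lambda>u. g x y u v) \<in> linear_maps K D Z"
    and g4: "\<And>x y u. \<lbrakk>x \<in> carrier C; y \<in> carrier C; u \<in> carrier D\<rbrakk> \<Longrightarrow> (\<lambda>v. g x y u v) \<in> linear_maps K D Z"
  shows "tensor_lift K Z (\<lambda>x y. tensor_lift K Z (\<lambda>u v. g x y u v) (comult D d)) (comult C c) =
    tensor_lift K Z (\<lambda>u v. tensor_lift K Z (\<lambda>x y. g x y u v) (comult C c)) (comult D d)"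
proof -
  note MC = coalgebra_module[OF C] and MD = coalgebra_module[OF D]
  have TC: "module K (tensor K C C)" by (rule module_tensor[OF MC MC])
  note cc = coalgebra_comult_closed[OF C c] and dc = coalgebra_comult_closed[OF D d]
  have bC: "bilinear C C Z (\<lambda>x y. g x y u v)" if "u \<in> carrier D" "v \<in> carrier D" for u v
    using that by (intro bilinearI g1 g2)
  have bD: "bilinear D D Z (\<lambda>u v. g x y u v)" if "x \<in> carrier C" "y \<in> carrier C" for x y
    using that by (intro bilinearI g3 g4)
  have b1: "bilinear C C Z (\<lambda>x y. tensor_lift K Z (\<lambda>u v. g x y u v) (comult D d))"
    by (intro bilinearI tensor_lift_param_linear[OF MD MD Z MC] bD g1 g2 dc)
  have b2: "bilinear D D Z (\<lambda>u v. tensor_lift K Z (\<lambda>x y. g x y u v) t)" if "t \<in> carrier (tensor K C C)" for t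
    using that by (intro bilinearI tensor_lift_param_linear[OF MC MC Z MD] bC g3 g4)
  show ?thesis
  proof (rule linear_eq_on_pure[OF MC MC Z tensor_lift_linear[OF MC MC Z b1] _ _ cc])
    show "(\<lambda>t. tensor_lift K Z (\<lambda>u v. tensor_lift K Z (\<lambda>x y. g x y u v) t) (comult D d))
        \<in> linear_maps K (tensor K C C) Z"
      by (intro tensor_lift_param_linear[OF MD MD Z TC] tensor_lift_linear[OF MC MC Z] bC b2 dc)
    fix x y assume xy: "x \<in> carrier C" "y \<in> carrier C"
    show "tensor_lift K Z (\<lambda>x y. tensor_lift K Z (\<lambda>u v. g x y u v) (comult D d)) (pure_tensor K C C x y) =
      tensor_lift K Z (\<lambda>u v. tensor_lift K Z (\<lambda>x y. g x y u v) (pure_tensor K C C x y)) (comult D d)"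
      using tensor_lift_cong[OF MD MD Z bD[OF xy] _ dc,
          of "\<lambda>u v. tensor_lift K Z (\<lambda>x y. g x y u v) (pure_tensor K C C x y)"] xy
      by (simp add: tensor_lift_pure[OF MC MC Z b1] tensor_lift_pure[OF MC MC Z bC])
  qed
qed

text \<open>The chain spells out l = l \<star> (m \<star> r) = (l \<star> m) \<star> r = r for the
  convolution product \<star> on linear maps from C to Q, whose unit is c \<mapsto> \<epsilon>(c)
  1.\<close>

lemma convolution_inverse_unique:
  assumes C: "coalgebra K C" and Q: "unital_algebra K Q"
    and l: "l \<in> linear_maps K C Q" and m: "m \<in> linear_maps K C Q" and r: "r \<in> linear_maps K C Q"
    and lm: "\<And>c. c \<in> carrier C \<Longrightarrow> tensor_lift K Q (\<lambda>x y. l x \<otimes>\<^bsub>Q\<^esub> m y) (comult C c) = counit C c \<odot>\<^bsub>Q\<^esub> \<one>\<^bsub>Q\<^esub>"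
    and mr: "\<And>c. c \<in> carrier C \<Longrightarrow> tensor_lift K Q (\<lambda>x y. m x \<otimes>\<^bsub>Q\<^esub> r y) (comult C c) = counit C c \<odot>\<^bsub>Q\<^esub> \<one>\<^bsub>Q\<^esub>"
    and c: "c \<in> carrier C"
  shows "l c = r c"
proof -
  interpret Q: unital_algebra K Q by fact
  note MC = coalgebra_module[OF C] and MQ = module_unital_algebra[OF Q]
  note lin = l m r linear_maps_comp[OF l] linear_maps_comp[OF m] linear_maps_comp[OF r]
    linear_maps_closed[OF l] linear_maps_closed[OF m] linear_maps_closed[OF r]
  note cl = linear_maps_closed[OF l] linear_maps_closed[OF m] linear_maps_closed[OF r] coalgebra_counit_closed[OF C]
  have "l c = tensor_lift K Q (\<lambda>x y. counit C y \<odot>\<^bsub>Q\<^esub> l x) (comult C c)"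
    by (rule sweedler_counit_right[OF C MQ l c, symmetric])
  also have "\<dots> = tensor_lift K Q (\<lambda>x u. l x \<otimes>\<^bsub>Q\<^esub> tensor_lift K Q (\<lambda>y z. m y \<otimes>\<^bsub>Q\<^esub> r z) (comult C u)) (comult C c)"
    by (rule sweedler_cong[OF C MQ c])
      ((assumption | rule multilinear C Q MC MQ lin)+, simp add: mr cl Q.smult_mult_right)
  also have "\<dots> = tensor_lift K Q (\<lambda>x u. tensor_lift K Q (\<lambda>y z. l x \<otimes>\<^bsub>Q\<^esub> (m y \<otimes>\<^bsub>Q\<^esub> r z)) (comult C u)) (comult C c)"
    by (rule sweedler_cong[OF C MQ c], (assumption | rule multilinear C Q MC MQ lin)+,
      rule linear_sweedler[OF C MQ MQ], (assumption | rule multilinear C Q MC MQ lin)+)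
  also have "\<dots> = tensor_lift K Q (\<lambda>u z. tensor_lift K Q (\<lambda>x y. l x \<otimes>\<^bsub>Q\<^esub> (m y \<otimes>\<^bsub>Q\<^esub> r z)) (comult C u)) (comult C c)"
    by (rule sweedler_coassoc[OF C MQ c, symmetric]; (assumption | rule multilinear C Q MC MQ lin)+)
  also have "\<dots> = tensor_lift K Q (\<lambda>u z. tensor_lift K Q (\<lambda>x y. (l x \<otimes>\<^bsub>Q\<^esub> m y) \<otimes>\<^bsub>Q\<^esub> r z) (comult C u)) (comult C c)"
    by (rule sweedler_cong[OF C MQ c], (assumption | rule multilinear C Q MC MQ lin)+,
      rule sweedler_cong[OF C MQ], assumption, (assumption | rule multilinear C Q MC MQ lin)+, simp add: cl Q.m_assoc)
  also have "\<dots> = tensor_lift K Q (\<lambda>u z. tensor_lift K Q (\<lambda>x y. l x \<otimes>\<^bsub>Q\<^esub> m y) (comult C u) \<otimes>\<^bsub>Q\<^esub> r z) (comult C c)"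
    by (rule sweedler_cong[OF C MQ c], (assumption | rule multilinear C Q MC MQ lin)+,
      rule linear_sweedler[OF C MQ MQ, symmetric], (assumption | rule multilinear C Q MC MQ lin)+)
  also have "\<dots> = tensor_lift K Q (\<lambda>u z. counit C u \<odot>\<^bsub>Q\<^esub> r z) (comult C c)"
    by (rule sweedler_cong[OF C MQ c])
      ((assumption | rule multilinear C Q MC MQ lin)+, simp add: lm cl Q.smult_mult_left)
  also have "\<dots> = r c"
    by (rule sweedler_counit_left[OF C MQ r c])
  finally show ?thesis .
qed

text \<open>Distributivity for Sweedler sums over possibly different coalgebras, as it follows from
  linearity in each factor.\<close>

lemma sweedler_mult:
  assumes C: "coalgebra K C" and D: "coalgebra K D" and Q: "unital_algebra K Q"
    and g: "bilinear C C Q g" and g': "bilinear D D Q g'" and c: "c \<in> carrier C" and d: "d \<in> carrier D"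
  shows "tensor_lift K Q g (comult C c) \<otimes>\<^bsub>Q\<^esub> tensor_lift K Q g' (comult D d) =
    tensor_lift K Q (\<lambda>x y. tensor_lift K Q (\<lambda>u v. g x y \<otimes>\<^bsub>Q\<^esub> g' u v) (comult D d)) (comult C c)"
proof -
  note MC = coalgebra_module[OF C] and MD = coalgebra_module[OF D] and MQ = module_unital_algebra[OF Q]
  note lin = g g' bilinear_left[OF g] bilinear_right[OF g] bilinear_left[OF g'] bilinear_right[OF g']
    bilinear_closed[OF g] bilinear_closed[OF g']
  have "tensor_lift K Q g (comult C c) \<otimes>\<^bsub>Q\<^esub> tensor_lift K Q g' (comult D d) =
    tensor_lift K Q (\<lambda>x y. g x y \<otimes>\<^bsub>Q\<^esub> tensor_lift K Q g' (comult D d)) (comult C c)"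
    by (rule linear_sweedler[OF C MQ MQ c g]) (assumption | rule multilinear C D Q MC MD MQ c d lin)+
  also have "\<dots> = tensor_lift K Q (\<lambda>x y. tensor_lift K Q (\<lambda>u v. g x y \<otimes>\<^bsub>Q\<^esub> g' u v) (comult D d)) (comult C c)"
    by (rule sweedler_cong[OF C MQ c], (assumption | rule multilinear C D Q MC MD MQ c d lin)+,
      rule linear_sweedler[OF D MQ MQ d g'], (assumption | rule multilinear C D Q MC MD MQ c d lin)+)
  finally show ?thesis .
qed

text \<open>The counit law of the coalgebra C \<otimes> D, written with iterated sums over C and D.
  Summing over D first leaves the counit law of C.\<close>

lemma sweedler_counit_left2:
  assumes C: "coalgebra K C" and D: "coalgebra K D" and Z: "module K Z"
    and h: "bilinear C D Z h" and c: "c \<in> carrier C" and d: "d \<in> carrier D"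
  shows "tensor_lift K Z (\<lambda>x x'. tensor_lift K Z (\<lambda>y y'. counit D y \<odot>\<^bsub>Z\<^esub> (counit C x \<odot>\<^bsub>Z\<^esub> h x' y'))
    (comult D d)) (comult C c) = h c d"
proof -
  note MC = coalgebra_module[OF C] and MD = coalgebra_module[OF D]
  note lin = h bilinear_left[OF h] bilinear_right[OF h] bilinear_closed[OF h]
    bilinear_left[OF h linear_maps_id] bilinear_right[OF h linear_maps_id]
  have "tensor_lift K Z (\<lambda>x x'. tensor_lift K Z (\<lambda>y y'. counit D y \<odot>\<^bsub>Z\<^esub> (counit C x \<odot>\<^bsub>Z\<^esub> h x' y'))
    (comult D d)) (comult C c) = tensor_lift K Z (\<lambda>x x'. counit C x \<odot>\<^bsub>Z\<^esub> h x' d) (comult C c)"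
    by (rule sweedler_cong[OF C Z c], (assumption | rule multilinear C D Z MC MD c d lin)+,
      rule sweedler_counit_left[OF D Z _ d], (assumption | rule multilinear C D Z MC MD c d lin)+)
  also have "\<dots> = h c d"
    by (rule sweedler_counit_left[OF C Z bilinear_left[OF h linear_maps_id d] c])
  finally show ?thesis .
qed

lemma sweedler_counit_right2:
  assumes C: "coalgebra K C" and D: "coalgebra K D" and Z: "module K Z"
    and h: "bilinear C D Z h" and c: "c \<in> carrier C" and d: "d \<in> carrier D"
  shows "tensor_lift K Z (\<lambda>x x'. tensor_lift K Z (\<lambda>y y'. counit D y' \<odot>\<^bsub>Z\<^esub> (counit C x' \<odot>\<^bsub>Z\<^esub> h x y))
    (comult D d)) (comult C c) = h c d"
proof -
  note MC = coalgebra_module[OF C] and MD = coalgebra_module[OF D]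
  note lin = h bilinear_left[OF h] bilinear_right[OF h] bilinear_closed[OF h]
    bilinear_left[OF h linear_maps_id] bilinear_right[OF h linear_maps_id]
  have "tensor_lift K Z (\<lambda>x x'. tensor_lift K Z (\<lambda>y y'. counit D y' \<odot>\<^bsub>Z\<^esub> (counit C x' \<odot>\<^bsub>Z\<^esub> h x y))
    (comult D d)) (comult C c) = tensor_lift K Z (\<lambda>x x'. counit C x' \<odot>\<^bsub>Z\<^esub> h x d) (comult C c)"
    by (rule sweedler_cong[OF C Z c], (assumption | rule multilinear C D Z MC MD c d lin)+,
      rule sweedler_counit_right[OF D Z _ d], (assumption | rule multilinear C D Z MC MD c d lin)+)
  also have "\<dots> = h c d"
    by (rule sweedler_counit_right[OF C Z bilinear_left[OF h linear_maps_id d] c])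
  finally show ?thesis .
qed

text \<open>The argument of \<open>convolution_inverse_unique\<close> for the coalgebra C \<otimes>
  D, whose coproduct is represented by a sum over C with a sum over D inside.\<close>

lemma convolution_inverse_unique2:
  assumes C: "coalgebra K C" and D: "coalgebra K D" and Q: "unital_algebra K Q"
    and l: "bilinear C D Q l" and m: "bilinear C D Q m" and r: "bilinear C D Q r"
    and lm: "\<And>c d. \<lbrakk>c \<in> carrier C; d \<in> carrier D\<rbrakk> \<Longrightarrow>
      tensor_lift K Q (\<lambda>x u. tensor_lift K Q (\<lambda>y v. l x y \<otimes>\<^bsub>Q\<^esub> m u v) (comult D d)) (comult C c) =
      counit D d \<odot>\<^bsub>Q\<^esub> (counit C c \<odot>\<^bsub>Q\<^esub> \<one>\<^bsub>Q\<^esub>)"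
    and mr: "\<And>c d. \<lbrakk>c \<in> carrier C; d \<in> carrier D\<rbrakk> \<Longrightarrow>
      tensor_lift K Q (\<lambda>u w. tensor_lift K Q (\<lambda>v z. m u v \<otimes>\<^bsub>Q\<^esub> r w z) (comult D d)) (comult C c) =
      counit D d \<odot>\<^bsub>Q\<^esub> (counit C c \<odot>\<^bsub>Q\<^esub> \<one>\<^bsub>Q\<^esub>)"
    and c: "c \<in> carrier C" and d: "d \<in> carrier D"
  shows "l c d = r c d"
proof -
  interpret Q: unital_algebra K Q by fact
  note MC = coalgebra_module[OF C] and MD = coalgebra_module[OF D] and MQ = module_unital_algebra[OF Q]
  note lin = C D Q MC MD MQ c d bilinear_left[OF l] bilinear_right[OF l] bilinear_closed[OF l]
    bilinear_left[OF l linear_maps_id] bilinear_right[OF l linear_maps_id]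
    bilinear_left[OF m] bilinear_right[OF m] bilinear_closed[OF m]
    bilinear_left[OF m linear_maps_id] bilinear_right[OF m linear_maps_id]
    bilinear_left[OF r] bilinear_right[OF r] bilinear_closed[OF r]
    bilinear_left[OF r linear_maps_id] bilinear_right[OF r linear_maps_id]
  note cl = bilinear_closed[OF l] bilinear_closed[OF m] bilinear_closed[OF r]
    coalgebra_counit_closed[OF C] coalgebra_counit_closed[OF D]
  have "l c d = tensor_lift K Q (\<lambda>x x'. tensor_lift K Q (\<lambda>y y'. counit D y' \<odot>\<^bsub>Q\<^esub> (counit C x' \<odot>\<^bsub>Q\<^esub> l x y))
    (comult D d)) (comult C c)"
    by (rule sweedler_counit_right2[OF C D MQ l c d, symmetric])
  also have "\<dots> = tensor_lift K Q (\<lambda>x x'. tensor_lift K Q (\<lambda>y y'.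
      tensor_lift K Q (\<lambda>u w. tensor_lift K Q (\<lambda>v z. l x y \<otimes>\<^bsub>Q\<^esub> (m u v \<otimes>\<^bsub>Q\<^esub> r w z)) (comult D y')) (comult C x'))
      (comult D d)) (comult C c)"
  proof (rule sweedler_cong[OF C MQ c], (assumption | rule lin multilinear)+,
      rule sweedler_cong[OF D MQ d], (assumption | rule lin multilinear)+)
    fix x x' y y' assume xy: "x \<in> carrier C" "x' \<in> carrier C" "y \<in> carrier D" "y' \<in> carrier D"
    \<comment> \<open>The counit of C \<otimes> D at (x', y') is replaced by the convolution of m
      and r there.\<close>
    have "counit D y' \<odot>\<^bsub>Q\<^esub> (counit C x' \<odot>\<^bsub>Q\<^esub> l x y) = l x y \<otimes>\<^bsub>Q\<^esub> (counit D y' \<odot>\<^bsub>Q\<^esub> (counit C x' \<odot>\<^bsub>Q\<^esub> \<one>\<^bsub>Q\<^esub>))"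
      using xy by (simp add: cl Q.smult_mult_right)
    also have "\<dots> = l x y \<otimes>\<^bsub>Q\<^esub> tensor_lift K Q (\<lambda>u w. tensor_lift K Q (\<lambda>v z. m u v \<otimes>\<^bsub>Q\<^esub> r w z) (comult D y')) (comult C x')"
      using xy by (simp only: mr)
    also have "\<dots> = tensor_lift K Q (\<lambda>u w. l x y \<otimes>\<^bsub>Q\<^esub> tensor_lift K Q (\<lambda>v z. m u v \<otimes>\<^bsub>Q\<^esub> r w z) (comult D y')) (comult C x')"
      by (rule linear_sweedler[OF C MQ MQ]) (assumption | rule xy lin multilinear)+
    also have "\<dots> = tensor_lift K Q (\<lambda>u w. tensor_lift K Q (\<lambda>v z. l x y \<otimes>\<^bsub>Q\<^esub> (m u v \<otimes>\<^bsub>Q\<^esub> r w z)) (comult D y')) (comult C x')"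
      by (rule sweedler_cong[OF C MQ xy(2)], (assumption | rule xy lin multilinear)+,
        rule linear_sweedler[OF D MQ MQ], (assumption | rule xy lin multilinear)+)
    finally show "counit D y' \<odot>\<^bsub>Q\<^esub> (counit C x' \<odot>\<^bsub>Q\<^esub> l x y) =
      tensor_lift K Q (\<lambda>u w. tensor_lift K Q (\<lambda>v z. l x y \<otimes>\<^bsub>Q\<^esub> (m u v \<otimes>\<^bsub>Q\<^esub> r w z)) (comult D y')) (comult C x')" .
  qed
  \<comment> \<open>This and the next three equalities are coassociativity of C \<otimes> D. The
    sums are interchanged so that the two coproducts of C are adjacent, C is reassociated, then D,
    and the sums are interchanged back.\<close>
  also have "\<dots> = tensor_lift K Q (\<lambda>x x'. tensor_lift K Q (\<lambda>u w.
      tensor_lift K Q (\<lambda>y y'. tensor_lift K Q (\<lambda>v z. l x y \<otimes>\<^bsub>Q\<^esub> (m u v \<otimes>\<^bsub>Q\<^esub> r w z)) (comult D y')) (comult D d))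
      (comult C x')) (comult C c)"
    by (rule sweedler_cong[OF C MQ c], (assumption | rule lin multilinear)+,
      rule sweedler_swap[OF D C MQ d], assumption; (assumption | rule lin multilinear)+)
  also have "\<dots> = tensor_lift K Q (\<lambda>x' w. tensor_lift K Q (\<lambda>x u.
      tensor_lift K Q (\<lambda>y y'. tensor_lift K Q (\<lambda>v z. l x y \<otimes>\<^bsub>Q\<^esub> (m u v \<otimes>\<^bsub>Q\<^esub> r w z)) (comult D y')) (comult D d))
      (comult C x')) (comult C c)"
    by (rule sweedler_coassoc[OF C MQ c, symmetric]; (assumption | rule lin multilinear)+)
  also have "\<dots> = tensor_lift K Q (\<lambda>x' w. tensor_lift K Q (\<lambda>x u.
      tensor_lift K Q (\<lambda>y' z. tensor_lift K Q (\<lambda>y v. l x y \<otimes>\<^bsub>Q\<^esub> (m u v \<otimes>\<^bsub>Q\<^esub> r w z)) (comult D y')) (comult D d))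
      (comult C x')) (comult C c)"
    by (rule sweedler_cong[OF C MQ c], (assumption | rule lin multilinear)+,
      rule sweedler_cong[OF C MQ], assumption, (assumption | rule lin multilinear)+,
      rule sweedler_coassoc[OF D MQ d, symmetric]; (assumption | rule lin multilinear)+)
  also have "\<dots> = tensor_lift K Q (\<lambda>x' w. tensor_lift K Q (\<lambda>y' z.
      tensor_lift K Q (\<lambda>x u. tensor_lift K Q (\<lambda>y v. l x y \<otimes>\<^bsub>Q\<^esub> (m u v \<otimes>\<^bsub>Q\<^esub> r w z)) (comult D y')) (comult C x'))
      (comult D d)) (comult C c)"
    by (rule sweedler_cong[OF C MQ c], (assumption | rule lin multilinear)+,
      rule sweedler_swap[OF C D MQ _ d], assumption; (assumption | rule lin multilinear)+)
  also have "\<dots> = tensor_lift K Q (\<lambda>x' w. tensor_lift K Q (\<lambda>y' z. counit D y' \<odot>\<^bsub>Q\<^esub> (counit C x' \<odot>\<^bsub>Q\<^esub> r w z))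
      (comult D d)) (comult C c)"
  proof (rule sweedler_cong[OF C MQ c], (assumption | rule lin multilinear)+,
      rule sweedler_cong[OF D MQ d], (assumption | rule lin multilinear)+)
    fix x' w y' z assume xy: "x' \<in> carrier C" "w \<in> carrier C" "y' \<in> carrier D" "z \<in> carrier D"
    have "tensor_lift K Q (\<lambda>x u. tensor_lift K Q (\<lambda>y v. l x y \<otimes>\<^bsub>Q\<^esub> (m u v \<otimes>\<^bsub>Q\<^esub> r w z)) (comult D y')) (comult C x') =
      tensor_lift K Q (\<lambda>x u. tensor_lift K Q (\<lambda>y v. (l x y \<otimes>\<^bsub>Q\<^esub> m u v) \<otimes>\<^bsub>Q\<^esub> r w z) (comult D y')) (comult C x')"
      by (rule sweedler_cong[OF C MQ xy(1)], (assumption | rule xy lin multilinear)+,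
        rule sweedler_cong[OF D MQ xy(3)], (assumption | rule xy lin multilinear)+, simp add: cl xy Q.m_assoc)
    also have "\<dots> = tensor_lift K Q (\<lambda>x u. tensor_lift K Q (\<lambda>y v. l x y \<otimes>\<^bsub>Q\<^esub> m u v) (comult D y') \<otimes>\<^bsub>Q\<^esub> r w z) (comult C x')"
      by (rule sweedler_cong[OF C MQ xy(1)], (assumption | rule xy lin multilinear)+,
        rule linear_sweedler[OF D MQ MQ, symmetric], (assumption | rule xy lin multilinear)+)
    also have "\<dots> = tensor_lift K Q (\<lambda>x u. tensor_lift K Q (\<lambda>y v. l x y \<otimes>\<^bsub>Q\<^esub> m u v) (comult D y')) (comult C x') \<otimes>\<^bsub>Q\<^esub> r w z"
      by (rule linear_sweedler[OF C MQ MQ, symmetric]) (assumption | rule xy lin multilinear)+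
    also have "\<dots> = counit D y' \<odot>\<^bsub>Q\<^esub> (counit C x' \<odot>\<^bsub>Q\<^esub> r w z)"
      using xy by (simp add: lm cl Q.smult_mult_left)
    finally show "tensor_lift K Q (\<lambda>x u. tensor_lift K Q (\<lambda>y v. l x y \<otimes>\<^bsub>Q\<^esub> (m u v \<otimes>\<^bsub>Q\<^esub> r w z)) (comult D y')) (comult C x') =
      counit D y' \<odot>\<^bsub>Q\<^esub> (counit C x' \<odot>\<^bsub>Q\<^esub> r w z)" .
  qed
  also have "\<dots> = r c d"
    by (rule sweedler_counit_left2[OF C D MQ r c d])
  finally show ?thesis .
qed

text \<open>Convolution cancels only neighbours, and c2, c3 are the only neighbours paired here.
  Cancelling them leaves a counit that is absorbed into c4, after which the outer pair has become
  adjacent and cancels in turn. A general \<beta> covers both the tensor product itself and its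
  version with exchanged factors.\<close>

lemma sweedler_four_cancel:
  assumes C: "coalgebra K C" and Q: "unital_algebra K Q" and Z: "module K Z"
    and g: "g \<in> linear_maps K C Q" and g': "g' \<in> linear_maps K C Q" and \<beta>: "bilinear Q Q Z \<beta>"
    and conv: "\<And>c. c \<in> carrier C \<Longrightarrow> tensor_lift K Q (\<lambda>x y. g x \<otimes>\<^bsub>Q\<^esub> g' y) (comult C c) = counit C c \<odot>\<^bsub>Q\<^esub> \<one>\<^bsub>Q\<^esub>"
    and c: "c \<in> carrier C"
  shows "tensor_lift K Z (\<lambda>u v. tensor_lift K Z (\<lambda>x y. tensor_lift K Z (\<lambda>z w.
      \<beta> (g x \<otimes>\<^bsub>Q\<^esub> g' w) (g y \<otimes>\<^bsub>Q\<^esub> g' z)) (comult C v)) (comult C u)) (comult C c) =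
    counit C c \<odot>\<^bsub>Z\<^esub> \<beta> \<one>\<^bsub>Q\<^esub> \<one>\<^bsub>Q\<^esub>"
proof -
  interpret Q: unital_algebra K Q by fact
  note MC = coalgebra_module[OF C] and MQ = module_unital_algebra[OF Q]
  note lin = C Q Z MC MQ c g g' linear_maps_comp[OF g] linear_maps_comp[OF g'] linear_maps_closed[OF g]
    linear_maps_closed[OF g'] bilinear_left[OF \<beta>] bilinear_right[OF \<beta>] bilinear_closed[OF \<beta>]
  note cl = linear_maps_closed[OF g] linear_maps_closed[OF g'] coalgebra_counit_closed[OF C]
  have "tensor_lift K Z (\<lambda>u v. tensor_lift K Z (\<lambda>x y. tensor_lift K Z (\<lambda>z w.
      \<beta> (g x \<otimes>\<^bsub>Q\<^esub> g' w) (g y \<otimes>\<^bsub>Q\<^esub> g' z)) (comult C v)) (comult C u)) (comult C c) =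
    tensor_lift K Z (\<lambda>x u. tensor_lift K Z (\<lambda>y v. tensor_lift K Z (\<lambda>z w.
      \<beta> (g x \<otimes>\<^bsub>Q\<^esub> g' w) (g y \<otimes>\<^bsub>Q\<^esub> g' z)) (comult C v)) (comult C u)) (comult C c)"
    by (rule sweedler_coassoc[OF C Z c]; (assumption | rule lin multilinear)+)
  also have "\<dots> = tensor_lift K Z (\<lambda>x u. \<beta> (g x \<otimes>\<^bsub>Q\<^esub> g' u) \<one>\<^bsub>Q\<^esub>) (comult C c)"
  proof (rule sweedler_cong[OF C Z c], (assumption | rule lin multilinear)+)
    fix x u assume xu: "x \<in> carrier C" "u \<in> carrier C"
    \<comment> \<open>Reassociation puts the middle pair y, z under one coproduct.\<close>
    have "tensor_lift K Z (\<lambda>y v. tensor_lift K Z (\<lambda>z w. \<beta> (g x \<otimes>\<^bsub>Q\<^esub> g' w) (g y \<otimes>\<^bsub>Q\<^esub> g' z)) (comult C v)) (comult C u) =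
      tensor_lift K Z (\<lambda>v w. tensor_lift K Z (\<lambda>y z. \<beta> (g x \<otimes>\<^bsub>Q\<^esub> g' w) (g y \<otimes>\<^bsub>Q\<^esub> g' z)) (comult C v)) (comult C u)"
      by (rule sweedler_coassoc[OF C Z xu(2), symmetric]; (assumption | rule xu lin multilinear)+)
    also have "\<dots> = tensor_lift K Z (\<lambda>v w. counit C v \<odot>\<^bsub>Z\<^esub> \<beta> (g x \<otimes>\<^bsub>Q\<^esub> g' w) \<one>\<^bsub>Q\<^esub>) (comult C u)"
    proof (rule sweedler_cong[OF C Z xu(2)], (assumption | rule xu lin multilinear)+)
      fix v w assume vw: "v \<in> carrier C" "w \<in> carrier C"
      have \<beta>l: "(\<lambda>q. \<beta> (g x \<otimes>\<^bsub>Q\<^esub> g' w) q) \<in> linear_maps K Q Z"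
        by (rule bilinear_right[OF \<beta> linear_maps_id]) (simp add: cl xu vw)
      have "tensor_lift K Z (\<lambda>y z. \<beta> (g x \<otimes>\<^bsub>Q\<^esub> g' w) (g y \<otimes>\<^bsub>Q\<^esub> g' z)) (comult C v) =
        \<beta> (g x \<otimes>\<^bsub>Q\<^esub> g' w) (tensor_lift K Q (\<lambda>y z. g y \<otimes>\<^bsub>Q\<^esub> g' z) (comult C v))"
        by (rule linear_sweedler[OF C MQ Z _ _ \<beta>l, symmetric]) (assumption | rule vw lin multilinear)+
      also have "\<dots> = counit C v \<odot>\<^bsub>Z\<^esub> \<beta> (g x \<otimes>\<^bsub>Q\<^esub> g' w) \<one>\<^bsub>Q\<^esub>"
        by (simp add: conv vw linear_maps_smult[OF \<beta>l] cl)
      finally show "tensor_lift K Z (\<lambda>y z. \<beta> (g x \<otimes>\<^bsub>Q\<^esub> g' w) (g y \<otimes>\<^bsub>Q\<^esub> g' z)) (comult C v) =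
        counit C v \<odot>\<^bsub>Z\<^esub> \<beta> (g x \<otimes>\<^bsub>Q\<^esub> g' w) \<one>\<^bsub>Q\<^esub>" .
    qed
    also have "\<dots> = \<beta> (g x \<otimes>\<^bsub>Q\<^esub> g' u) \<one>\<^bsub>Q\<^esub>"
      by (rule sweedler_counit_left[OF C Z _ xu(2)]) (assumption | rule xu lin multilinear)+
    finally show "tensor_lift K Z (\<lambda>y v. tensor_lift K Z (\<lambda>z w. \<beta> (g x \<otimes>\<^bsub>Q\<^esub> g' w) (g y \<otimes>\<^bsub>Q\<^esub> g' z)) (comult C v)) (comult C u) =
      \<beta> (g x \<otimes>\<^bsub>Q\<^esub> g' u) \<one>\<^bsub>Q\<^esub>" .
  qed
  also have "\<dots> = \<beta> (tensor_lift K Q (\<lambda>x u. g x \<otimes>\<^bsub>Q\<^esub> g' u) (comult C c)) \<one>\<^bsub>Q\<^esub>"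
    by (rule linear_sweedler[OF C MQ Z c _ bilinear_left[OF \<beta> linear_maps_id Q.one_closed], symmetric])
      (assumption | rule lin multilinear)+
  also have "\<dots> = counit C c \<odot>\<^bsub>Z\<^esub> \<beta> \<one>\<^bsub>Q\<^esub> \<one>\<^bsub>Q\<^esub>"
    using linear_maps_smult[OF bilinear_left[OF \<beta> linear_maps_id Q.one_closed]]
    by (simp add: conv c cl)
  finally show ?thesis .
qed

text \<open>The module coalgebra axiom is an equation between tensors; pushed through the lift of an
  arbitrary g it can be used inside Sweedler sums.\<close>

lemma sweedler_act:
  assumes C: "coalgebra K C" and A: "coalgebra K A" and Z: "module K Z" and act: "bilinear C A C act"
    and act_comult: "comult C (act c a) = tensor_lift K (tensor K C C) (\<lambda>c1 c2. tensor_lift K (tensor K C C)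
           (\<lambda>a1 a2. pure_tensor K C C (act c1 a1) (act c2 a2)) (comult A a)) (comult C c)"
    and g: "bilinear C C Z g" and c: "c \<in> carrier C" and a: "a \<in> carrier A"
  shows "tensor_lift K Z g (comult C (act c a)) =
    tensor_lift K Z (\<lambda>c1 c2. tensor_lift K Z (\<lambda>a1 a2. g (act c1 a1) (act c2 a2)) (comult A a)) (comult C c)"
proof -
  let ?T = "tensor K C C"
  note MC = coalgebra_module[OF C] and MA = coalgebra_module[OF A]
  have MT: "module K ?T" by (rule module_tensor[OF MC MC])
  note p = pure_tensor_bilinear[OF MC MC]
  note lg = tensor_lift_linear[OF MC MC Z g]
  note lin = C A Z MC MA MT c a bilinear_left[OF act] bilinear_right[OF act] bilinear_closed[OF act]
    bilinear_left[OF p] bilinear_right[OF p] bilinear_closed[OF p]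
    bilinear_left[OF act linear_maps_id] bilinear_right[OF act linear_maps_id]
    bilinear_left[OF g] bilinear_right[OF g] bilinear_closed[OF g]
    linear_maps_closed[OF lg] linear_maps_comp[OF lg]
  have "tensor_lift K Z g (comult C (act c a)) = tensor_lift K Z (\<lambda>c1 c2. tensor_lift K Z g (tensor_lift K ?T
           (\<lambda>a1 a2. pure_tensor K C C (act c1 a1) (act c2 a2)) (comult A a))) (comult C c)"
    unfolding act_comult by (rule linear_sweedler[OF C MT Z c _ lg]) (assumption | rule lin multilinear)+
  also have "\<dots> = tensor_lift K Z (\<lambda>c1 c2. tensor_lift K Z (\<lambda>a1 a2. g (act c1 a1) (act c2 a2)) (comult A a)) (comult C c)"
  proof (rule sweedler_cong[OF C Z c], (assumption | rule lin multilinear)+)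
    fix x y assume xy: "x \<in> carrier C" "y \<in> carrier C"
    have "tensor_lift K Z g (tensor_lift K ?T (\<lambda>a1 a2. pure_tensor K C C (act x a1) (act y a2)) (comult A a)) =
      tensor_lift K Z (\<lambda>a1 a2. tensor_lift K Z g (pure_tensor K C C (act x a1) (act y a2))) (comult A a)"
      by (rule linear_sweedler[OF A MT Z a _ lg]) (assumption | rule xy lin multilinear)+
    also have "\<dots> = tensor_lift K Z (\<lambda>a1 a2. g (act x a1) (act y a2)) (comult A a)"
      by (rule sweedler_cong[OF A Z a], (assumption | rule xy lin multilinear)+)
        (simp add: tensor_lift_pure[OF MC MC Z g] bilinear_closed[OF act] xy)
    finally show "tensor_lift K Z g (tensor_lift K ?T (\<lambda>a1 a2. pure_tensor K C C (act x a1) (act y a2)) (comult A a)) =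
      tensor_lift K Z (\<lambda>a1 a2. g (act x a1) (act y a2)) (comult A a)" .
  qed
  finally show ?thesis .
qed

text \<open>
  Both \<open>i'(c a)\<close> and \<open>j'(a) i'(c)\<close> are convolution inverses of \<open>i(c a) = i(c) j(a)\<close> on \<open>C \<otimes> A\<close>.
\<close>

lemma convolution_inverse_act:
  assumes C: "coalgebra K C" and A: "coalgebra K A" and Q: "unital_algebra K Q" and act: "bilinear C A C act"
    and act_comult: "\<And>c a. \<lbrakk>c \<in> carrier C; a \<in> carrier A\<rbrakk> \<Longrightarrow>
      comult C (act c a) = tensor_lift K (tensor K C C) (\<lambda>c1 c2. tensor_lift K (tensor K C C)
           (\<lambda>a1 a2. pure_tensor K C C (act c1 a1) (act c2 a2)) (comult A a)) (comult C c)"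
    and act_counit: "\<And>c a. \<lbrakk>c \<in> carrier C; a \<in> carrier A\<rbrakk> \<Longrightarrow> counit C (act c a) = counit C c \<otimes> counit A a"
    and i: "i \<in> linear_maps K C Q" and i': "i' \<in> linear_maps K C Q"
    and j: "j \<in> linear_maps K A Q" and j': "j' \<in> linear_maps K A Q"
    and mult: "\<And>c a. \<lbrakk>c \<in> carrier C; a \<in> carrier A\<rbrakk> \<Longrightarrow> i (act c a) = i c \<otimes>\<^bsub>Q\<^esub> j a"
    and ii: "\<And>c. c \<in> carrier C \<Longrightarrow> tensor_lift K Q (\<lambda>x y. i' x \<otimes>\<^bsub>Q\<^esub> i y) (comult C c) = counit C c \<odot>\<^bsub>Q\<^esub> \<one>\<^bsub>Q\<^esub>"
    and ii': "\<And>c. c \<in> carrier C \<Longrightarrow> tensor_lift K Q (\<lambda>x y. i x \<otimes>\<^bsub>Q\<^esub> i' y) (comult C c) = counit C c \<odot>\<^bsub>Q\<^esub> \<one>\<^bsub>Q\<^esub>"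
    and jj': "\<And>a. a \<in> carrier A \<Longrightarrow> tensor_lift K Q (\<lambda>x y. j x \<otimes>\<^bsub>Q\<^esub> j' y) (comult A a) = counit A a \<odot>\<^bsub>Q\<^esub> \<one>\<^bsub>Q\<^esub>"
    and c: "c \<in> carrier C" and a: "a \<in> carrier A"
  shows "i' (act c a) = j' a \<otimes>\<^bsub>Q\<^esub> i' c"
proof -
  interpret Q: unital_algebra K Q by fact
  note MC = coalgebra_module[OF C] and MA = coalgebra_module[OF A] and MQ = module_unital_algebra[OF Q]
  note lin = C A Q MC MA MQ bilinear_left[OF act] bilinear_right[OF act] bilinear_closed[OF act]
    bilinear_left[OF act linear_maps_id] bilinear_right[OF act linear_maps_id]
    i i' j j' linear_maps_comp[OF i] linear_maps_comp[OF j] linear_maps_comp[OF i'] linear_maps_comp[OF j']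
    linear_maps_closed[OF i] linear_maps_closed[OF i'] linear_maps_closed[OF j] linear_maps_closed[OF j']
  note cl = linear_maps_closed[OF i] linear_maps_closed[OF i'] linear_maps_closed[OF j] linear_maps_closed[OF j']
    bilinear_closed[OF act] coalgebra_counit_closed[OF C] coalgebra_counit_closed[OF A]
  show ?thesis
  proof (rule convolution_inverse_unique2[OF C A Q _ _ _ _ _ c a])
    show "bilinear C A Q (\<lambda>c a. i' (act c a))" "bilinear C A Q (\<lambda>c a. i c \<otimes>\<^bsub>Q\<^esub> j a)" "bilinear C A Q (\<lambda>c a. j' a \<otimes>\<^bsub>Q\<^esub> i' c)"
      by (assumption | rule lin multilinear)+
  next
    fix c a assume c: "c \<in> carrier C" and a: "a \<in> carrier A"
    \<comment> \<open>Left inverse: by \<open>mult\<close> the second factor is i at an acted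
      element, so the double sum is the convolution of i' and i at c a, and the counit of C is
      multiplicative for the action.\<close>
    have "tensor_lift K Q (\<lambda>x u. tensor_lift K Q (\<lambda>y v. i' (act x y) \<otimes>\<^bsub>Q\<^esub> (i u \<otimes>\<^bsub>Q\<^esub> j v)) (comult A a)) (comult C c) =
      tensor_lift K Q (\<lambda>x u. tensor_lift K Q (\<lambda>y v. i' (act x y) \<otimes>\<^bsub>Q\<^esub> i (act u v)) (comult A a)) (comult C c)"
      by (rule sweedler_cong[OF C MQ c], (assumption | rule a lin multilinear)+,
        rule sweedler_cong[OF A MQ a], (assumption | rule a lin multilinear)+, simp add: mult)
    also have "\<dots> = tensor_lift K Q (\<lambda>x y. i' x \<otimes>\<^bsub>Q\<^esub> i y) (comult C (act c a))"
      by (rule sweedler_act[OF C A MQ act act_comult[OF c a] _ c a, symmetric]) (assumption | rule lin multilinear)+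
    also have "\<dots> = counit A a \<odot>\<^bsub>Q\<^esub> (counit C c \<odot>\<^bsub>Q\<^esub> \<one>\<^bsub>Q\<^esub>)"
      using c a by (simp add: ii cl act_counit Q.smult_assoc1[symmetric] m_comm)
    finally show "tensor_lift K Q (\<lambda>x u. tensor_lift K Q (\<lambda>y v. i' (act x y) \<otimes>\<^bsub>Q\<^esub> (i u \<otimes>\<^bsub>Q\<^esub> j v)) (comult A a)) (comult C c) =
      counit A a \<odot>\<^bsub>Q\<^esub> (counit C c \<odot>\<^bsub>Q\<^esub> \<one>\<^bsub>Q\<^esub>)" .
  next
    fix c a assume c: "c \<in> carrier C" and a: "a \<in> carrier A"
    \<comment> \<open>Right inverse: in i(u) j(v) j'(z) i'(w) the inner pair cancels first, then the
      outer one.\<close>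
    have "tensor_lift K Q (\<lambda>u w. tensor_lift K Q (\<lambda>v z. (i u \<otimes>\<^bsub>Q\<^esub> j v) \<otimes>\<^bsub>Q\<^esub> (j' z \<otimes>\<^bsub>Q\<^esub> i' w)) (comult A a)) (comult C c) =
      tensor_lift K Q (\<lambda>u w. counit A a \<odot>\<^bsub>Q\<^esub> (i u \<otimes>\<^bsub>Q\<^esub> i' w)) (comult C c)"
    proof (rule sweedler_cong[OF C MQ c], (assumption | rule a lin multilinear)+)
      fix u w assume uw: "u \<in> carrier C" "w \<in> carrier C"
      have h: "(\<lambda>q. i u \<otimes>\<^bsub>Q\<^esub> (q \<otimes>\<^bsub>Q\<^esub> i' w)) \<in> linear_maps K Q Q"
        by (assumption | rule uw lin multilinear)+
      have "tensor_lift K Q (\<lambda>v z. (i u \<otimes>\<^bsub>Q\<^esub> j v) \<otimes>\<^bsub>Q\<^esub> (j' z \<otimes>\<^bsub>Q\<^esub> i' w)) (comult A a) =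
        tensor_lift K Q (\<lambda>v z. i u \<otimes>\<^bsub>Q\<^esub> ((j v \<otimes>\<^bsub>Q\<^esub> j' z) \<otimes>\<^bsub>Q\<^esub> i' w)) (comult A a)"
        by (rule sweedler_cong[OF A MQ a], (assumption | rule uw lin multilinear)+, simp add: cl uw Q.m_assoc)
      also have "\<dots> = i u \<otimes>\<^bsub>Q\<^esub> (tensor_lift K Q (\<lambda>v z. j v \<otimes>\<^bsub>Q\<^esub> j' z) (comult A a) \<otimes>\<^bsub>Q\<^esub> i' w)"
        by (rule linear_sweedler[OF A MQ MQ a _ h, symmetric]) (assumption | rule lin multilinear)+
      also have "\<dots> = counit A a \<odot>\<^bsub>Q\<^esub> (i u \<otimes>\<^bsub>Q\<^esub> i' w)"
        using a uw by (simp add: jj' cl Q.smult_mult_left Q.smult_mult_right)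
      finally show "tensor_lift K Q (\<lambda>v z. (i u \<otimes>\<^bsub>Q\<^esub> j v) \<otimes>\<^bsub>Q\<^esub> (j' z \<otimes>\<^bsub>Q\<^esub> i' w)) (comult A a) =
        counit A a \<odot>\<^bsub>Q\<^esub> (i u \<otimes>\<^bsub>Q\<^esub> i' w)" .
    qed
    also have "\<dots> = counit A a \<odot>\<^bsub>Q\<^esub> tensor_lift K Q (\<lambda>u w. i u \<otimes>\<^bsub>Q\<^esub> i' w) (comult C c)"
      by (rule linear_sweedler[OF C MQ MQ c, symmetric]) (assumption | rule a lin multilinear)+
    also have "\<dots> = counit A a \<odot>\<^bsub>Q\<^esub> (counit C c \<odot>\<^bsub>Q\<^esub> \<one>\<^bsub>Q\<^esub>)"
      using c by (simp only: ii')
    finally show "tensor_lift K Q (\<lambda>u w. tensor_lift K Q (\<lambda>v z. (i u \<otimes>\<^bsub>Q\<^esub> j v) \<otimes>\<^bsub>Q\<^esub> (j' z \<otimes>\<^bsub>Q\<^esub> i' w)) (comult A a)) (comult C c) =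
      counit A a \<odot>\<^bsub>Q\<^esub> (counit C c \<odot>\<^bsub>Q\<^esub> \<one>\<^bsub>Q\<^esub>)" .
  qed
qed

section \<open>Antipodes\<close>

lemma hopf_algebra_coalgebra: "hopf_algebra K H \<Longrightarrow> coalgebra K H"
  by (simp add: hopf_algebra_def bialgebra_def)

lemma hopf_algebra_unital: "hopf_algebra K H \<Longrightarrow> unital_algebra K H"
  by (simp add: hopf_algebra_def bialgebra_def)

text \<open>Writes a coproduct itself as a Sweedler sum, the form in which
  \<open>sweedler_mult\<close> applies to it.\<close>

lemma tensor_lift_pure_tensor:
  assumes M: "module K M" and N: "module K N" and u: "u \<in> carrier (tensor K M N)"
  shows "tensor_lift K (tensor K M N) (pure_tensor K M N) u = u"
  by (rule linear_eq_on_pure[where h' = "\<lambda>u. u", OF M N module_tensor[OF M N]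
      tensor_lift_linear[OF M N module_tensor[OF M N] pure_tensor_bilinear[OF M N]] linear_maps_id _ u])
    (simp add: tensor_lift_pure[OF M N module_tensor[OF M N] pure_tensor_bilinear[OF M N]])

lemma hopf_comult_alg_hom:
  assumes "hopf_algebra K H"
  shows "comult H \<in> alg_homs H (tensor K H H)"
proof -
  interpret hopf_algebra K H by fact
  show ?thesis
    using comult_ring_hom comult_linear by (simp add: alg_homs_def)
qed

lemma hopf_counit_alg_hom:
  assumes "hopf_algebra K H"
  shows "counit H \<in> alg_homs H (self_module K)"
proof -
  interpret hopf_algebra K H by fact
  have "ring_hom H (self_module K) = ring_hom H K"
    by (simp add: ring_hom_def self_module_def)
  then show ?thesis
    using counit_ring_hom counit_linear by (simp add: alg_homs_def)
qed

text \<open>Multiplicativity of the coproduct in the shape of the axiom for module coalgebras: H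
  acts on itself by right multiplication.\<close>

lemma hopf_comult_mult:
  assumes H: "hopf_algebra K H" and c: "c \<in> carrier H" and a: "a \<in> carrier H"
  shows "comult H (c \<otimes>\<^bsub>H\<^esub> a) = tensor_lift K (tensor K H H) (\<lambda>c1 c2. tensor_lift K (tensor K H H)
    (\<lambda>a1 a2. pure_tensor K H H (c1 \<otimes>\<^bsub>H\<^esub> a1) (c2 \<otimes>\<^bsub>H\<^esub> a2)) (comult H a)) (comult H c)"
proof -
  let ?T = "tensor K H H"
  note C = hopf_algebra_coalgebra[OF H] and U = hopf_algebra_unital[OF H]
  note M = module_unital_algebra[OF U]
  note T = unital_algebra_tensor[OF U U] and MT = module_tensor[OF M M]
  note p = pure_tensor_bilinear[OF M M]
  note lin = C U M T MT bilinear_left[OF p] bilinear_right[OF p] bilinear_closed[OF p] c a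
  have "comult H (c \<otimes>\<^bsub>H\<^esub> a) = comult H c \<otimes>\<^bsub>?T\<^esub> comult H a"
    by (rule alg_homs_mult[OF hopf_comult_alg_hom[OF H] c a])
  also have "\<dots> = tensor_lift K ?T (pure_tensor K H H) (comult H c) \<otimes>\<^bsub>?T\<^esub> tensor_lift K ?T (pure_tensor K H H) (comult H a)"
    using c a by (simp add: tensor_lift_pure_tensor[OF M M] coalgebra_comult_closed[OF C])
  also have "\<dots> = tensor_lift K ?T (\<lambda>c1 c2. tensor_lift K ?T
    (\<lambda>a1 a2. pure_tensor K H H c1 c2 \<otimes>\<^bsub>?T\<^esub> pure_tensor K H H a1 a2) (comult H a)) (comult H c)"
    by (rule sweedler_mult[OF C C T p p c a])
  also have "\<dots> = tensor_lift K ?T (\<lambda>c1 c2. tensor_lift K ?T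
    (\<lambda>a1 a2. pure_tensor K H H (c1 \<otimes>\<^bsub>H\<^esub> a1) (c2 \<otimes>\<^bsub>H\<^esub> a2)) (comult H a)) (comult H c)"
    by (rule sweedler_cong[OF C MT c], (assumption | rule lin multilinear)+,
      rule sweedler_cong[OF C MT a], (assumption | rule lin multilinear)+, simp add: pure_tensor_mult[OF U U])
  finally show ?thesis .
qed

text \<open>The case of \<open>convolution_inverse_act\<close> where H acts on itself by right
  multiplication, i and j are the identity, and i' and j' are the antipode.\<close>

lemma hopf_antipode_mult:
  assumes H: "hopf_algebra K H" and c: "c \<in> carrier H" and a: "a \<in> carrier H"
  shows "antipode H (c \<otimes>\<^bsub>H\<^esub> a) = antipode H a \<otimes>\<^bsub>H\<^esub> antipode H c"
proof -
  note C = hopf_algebra_coalgebra[OF H] and U = hopf_algebra_unital[OF H]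
  note S = hopf_algebra.antipode_linear[OF H]
  show ?thesis
    by (rule convolution_inverse_act[OF C C U bilinear_mult[OF U] hopf_comult_mult[OF H] _
          linear_maps_id S linear_maps_id S _ hopf_algebra.antipode_left[OF H] hopf_algebra.antipode_right[OF H]
          hopf_algebra.antipode_right[OF H] c a])
      (simp_all add: alg_homs_mult[OF hopf_counit_alg_hom[OF H]], simp add: self_module_def)
qed

text \<open>As the coproduct of 1 is 1 \<otimes> 1, the antipode axiom at 1 reads S(1) 1 =
  1.\<close>

lemma hopf_antipode_one:
  assumes H: "hopf_algebra K H"
  shows "antipode H \<one>\<^bsub>H\<^esub> = \<one>\<^bsub>H\<^esub>"
proof -
  interpret H: hopf_algebra K H by fact
  note C = hopf_algebra_coalgebra[OF H] and U = hopf_algebra_unital[OF H]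
  note M = module_unital_algebra[OF U]
  note S = hopf_algebra.antipode_linear[OF H]
  have b: "bilinear H H H (\<lambda>y z. antipode H y \<otimes>\<^bsub>H\<^esub> z)"
    by (assumption | rule S linear_maps_comp[OF S] linear_maps_closed[OF S] U multilinear)+
  have "antipode H \<one>\<^bsub>H\<^esub> \<otimes>\<^bsub>H\<^esub> \<one>\<^bsub>H\<^esub> = tensor_lift K H (\<lambda>y z. antipode H y \<otimes>\<^bsub>H\<^esub> z) (comult H \<one>\<^bsub>H\<^esub>)"
    unfolding alg_homs_one[OF hopf_comult_alg_hom[OF H]] tensor_one
    by (rule tensor_lift_pure[OF M M M b, symmetric]) simp_all
  also have "\<dots> = \<one>\<^bsub>H\<^esub>"
    using alg_homs_one[OF hopf_counit_alg_hom[OF H]]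
    by (simp add: H.antipode_left self_module_def)
  finally show ?thesis
    using linear_maps_closed[OF S H.one_closed] by simp
qed

text \<open>Apply the counit to the antipode axiom: it is multiplicative, so the sum becomes that of
  \<epsilon>(S y) \<epsilon>(z), which collapses by the counit law.\<close>

lemma hopf_counit_antipode:
  assumes H: "hopf_algebra K H" and h: "h \<in> carrier H"
  shows "counit H (antipode H h) = counit H h"
proof -
  interpret H: hopf_algebra K H by fact
  note C = hopf_algebra_coalgebra[OF H] and U = hopf_algebra_unital[OF H]
  note M = module_unital_algebra[OF U] and e = hopf_counit_alg_hom[OF H]
  note S = hopf_algebra.antipode_linear[OF H] and el = alg_homs_linear[OF e]
  let ?k = "self_module K"
  have eS: "(\<lambda>x. counit H (antipode H x)) \<in> linear_maps K H ?k"
    by (rule linear_maps_comp[OF el S])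
  note lin = S linear_maps_comp[OF S] linear_maps_closed[OF S] U C M module_self
    unital_algebra_self_module eS linear_maps_closed[OF eS, simplified] linear_maps_comp[OF eS]
  note cl = coalgebra_counit_closed[OF C] linear_maps_closed[OF S]
  have b: "bilinear H H H (\<lambda>y z. antipode H y \<otimes>\<^bsub>H\<^esub> z)"
    by (assumption | rule lin multilinear)+
  have "counit H h = counit H (counit H h \<odot>\<^bsub>H\<^esub> \<one>\<^bsub>H\<^esub>)"
    using h by (simp add: linear_maps_smult[OF el] cl alg_homs_one[OF e]) (simp add: self_module_def cl)
  also have "\<dots> = counit H (tensor_lift K H (\<lambda>y z. antipode H y \<otimes>\<^bsub>H\<^esub> z) (comult H h))"
    by (simp only: H.antipode_left[OF h])
  also have "\<dots> = tensor_lift K ?k (\<lambda>y z. counit H (antipode H y \<otimes>\<^bsub>H\<^esub> z)) (comult H h)"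
    by (rule linear_sweedler[OF C M module_self h b el])
  also have "\<dots> = tensor_lift K ?k (\<lambda>y z. counit H z \<odot>\<^bsub>?k\<^esub> counit H (antipode H y)) (comult H h)"
  proof (rule sweedler_cong[OF C module_self h])
    show "bilinear H H ?k (\<lambda>y z. counit H z \<odot>\<^bsub>?k\<^esub> counit H (antipode H y))"
      by (assumption | rule lin linear_maps_closed[OF eS] multilinear)+
    show "counit H (antipode H y \<otimes>\<^bsub>H\<^esub> z) = counit H z \<odot>\<^bsub>?k\<^esub> counit H (antipode H y)"
      if "y \<in> carrier H" "z \<in> carrier H" for y z
      using that by (simp add: alg_homs_mult[OF e] cl) (simp add: self_module_def cl m_comm)
  qed
  also have "\<dots> = counit H (antipode H h)"
    by (rule sweedler_counit_right[OF C module_self eS h])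
  finally show ?thesis ..
qed

text \<open>Both sides are convolution inverses of the coproduct among linear maps from H to H
  \<otimes> H: the left side is a left inverse because the coproduct is an algebra map, the right
  side is a right inverse by \<open>sweedler_four_cancel\<close>.\<close>

lemma hopf_comult_antipode:
  assumes H: "hopf_algebra K H" and h: "h \<in> carrier H"
  shows "comult H (antipode H h) =
    tensor_lift K (tensor K H H) (\<lambda>x y. pure_tensor K H H (antipode H y) (antipode H x)) (comult H h)"
proof -
  interpret H: hopf_algebra K H by fact
  let ?T = "tensor K H H"
  note C = hopf_algebra_coalgebra[OF H] and U = hopf_algebra_unital[OF H]
  note M = module_unital_algebra[OF U]
  note T = unital_algebra_tensor[OF U U] and MT = module_tensor[OF M M]
  note S = hopf_algebra.antipode_linear[OF H] and D = hopf_comult_alg_hom[OF H]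
  note Dl = alg_homs_linear[OF D]
  note p = pure_tensor_bilinear[OF M M]
  note lin = C U M T MT bilinear_left[OF p] bilinear_right[OF p] bilinear_closed[OF p]
    S linear_maps_comp[OF S] linear_maps_closed[OF S] Dl linear_maps_closed[OF Dl] linear_maps_comp[OF Dl]
  let ?r = "\<lambda>h. tensor_lift K ?T (\<lambda>x y. pure_tensor K H H (antipode H y) (antipode H x)) (comult H h)"
  have l: "(\<lambda>h. comult H (antipode H h)) \<in> linear_maps K H ?T"
    by (rule linear_maps_comp[OF Dl S])
  have r: "?r \<in> linear_maps K H ?T"
    by (assumption | rule lin multilinear)+
  note cl = linear_maps_closed[OF S] linear_maps_closed[OF Dl] coalgebra_counit_closed[OF C]
  show ?thesis
  proof (rule convolution_inverse_unique[OF C T l Dl r _ _ h])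
    fix c assume c: "c \<in> carrier H"
    have b: "bilinear H H H (\<lambda>y z. antipode H y \<otimes>\<^bsub>H\<^esub> z)"
      by (assumption | rule lin multilinear)+
    have "tensor_lift K ?T (\<lambda>x y. comult H (antipode H x) \<otimes>\<^bsub>?T\<^esub> comult H y) (comult H c) =
      tensor_lift K ?T (\<lambda>x y. comult H (antipode H x \<otimes>\<^bsub>H\<^esub> y)) (comult H c)"
      by (rule sweedler_cong[OF C MT c], (assumption | rule lin multilinear)+) (simp add: alg_homs_mult[OF D] cl)
    also have "\<dots> = comult H (tensor_lift K H (\<lambda>y z. antipode H y \<otimes>\<^bsub>H\<^esub> z) (comult H c))"
      by (rule linear_sweedler[OF C M MT c b Dl, symmetric])
    also have "\<dots> = counit H c \<odot>\<^bsub>?T\<^esub> \<one>\<^bsub>?T\<^esub>"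
      using c by (simp add: H.antipode_left linear_maps_smult[OF Dl] cl alg_homs_one[OF D])
    finally show "tensor_lift K ?T (\<lambda>x y. comult H (antipode H x) \<otimes>\<^bsub>?T\<^esub> comult H y) (comult H c) =
      counit H c \<odot>\<^bsub>?T\<^esub> \<one>\<^bsub>?T\<^esub>" .
  next
    fix c assume c: "c \<in> carrier H"
    have "tensor_lift K ?T (\<lambda>x y. comult H x \<otimes>\<^bsub>?T\<^esub> ?r y) (comult H c) =
      tensor_lift K ?T (\<lambda>u v. tensor_lift K ?T (\<lambda>x y. tensor_lift K ?T (\<lambda>z w.
        pure_tensor K H H (x \<otimes>\<^bsub>H\<^esub> antipode H w) (y \<otimes>\<^bsub>H\<^esub> antipode H z)) (comult H v)) (comult H u)) (comult H c)"
    proof (rule sweedler_cong[OF C MT c], (assumption | rule lin multilinear)+)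
      fix u v assume uv: "u \<in> carrier H" "v \<in> carrier H"
      have "comult H u \<otimes>\<^bsub>?T\<^esub> ?r v = tensor_lift K ?T (pure_tensor K H H) (comult H u) \<otimes>\<^bsub>?T\<^esub> ?r v"
        using uv by (simp add: tensor_lift_pure_tensor[OF M M] cl)
      also have "\<dots> = tensor_lift K ?T (\<lambda>x y. tensor_lift K ?T (\<lambda>z w.
        pure_tensor K H H x y \<otimes>\<^bsub>?T\<^esub> pure_tensor K H H (antipode H w) (antipode H z)) (comult H v)) (comult H u)"
        by (rule sweedler_mult[OF C C T p _ uv]) (assumption | rule lin multilinear)+
      also have "\<dots> = tensor_lift K ?T (\<lambda>x y. tensor_lift K ?T (\<lambda>z w.
        pure_tensor K H H (x \<otimes>\<^bsub>H\<^esub> antipode H w) (y \<otimes>\<^bsub>H\<^esub> antipode H z)) (comult H v)) (comult H u)"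
        by (rule sweedler_cong[OF C MT uv(1)], (assumption | rule uv lin multilinear)+,
          rule sweedler_cong[OF C MT uv(2)], (assumption | rule uv lin multilinear)+, simp add: pure_tensor_mult[OF U U] cl)
      finally show "comult H u \<otimes>\<^bsub>?T\<^esub> ?r v = tensor_lift K ?T (\<lambda>x y. tensor_lift K ?T (\<lambda>z w.
        pure_tensor K H H (x \<otimes>\<^bsub>H\<^esub> antipode H w) (y \<otimes>\<^bsub>H\<^esub> antipode H z)) (comult H v)) (comult H u)" .
    qed
    also have "\<dots> = counit H c \<odot>\<^bsub>?T\<^esub> \<one>\<^bsub>?T\<^esub>"
      unfolding tensor_one
      by (rule sweedler_four_cancel[OF C U MT linear_maps_id S p H.antipode_right c])
    finally show "tensor_lift K ?T (\<lambda>x y. comult H x \<otimes>\<^bsub>?T\<^esub> ?r y) (comult H c) = counit H c \<odot>\<^bsub>?T\<^esub> \<one>\<^bsub>?T\<^esub>" .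
  qed
qed

section \<open>Presented and quotient Hopf structures\<close>

text \<open>
  The part of a Hopf algebra structure that passes to quotients by checking generators.  Neither the
  coalgebra nor the antipode axioms are needed for the universal property.
\<close>

definition prehopf :: "('k, 'x, 'm) hopf_scheme \<Rightarrow> bool"
  where "prehopf P \<longleftrightarrow> unital_algebra K P \<and> comult P \<in> alg_homs P (tensor K P P) \<and>
    counit P \<in> alg_homs P (self_module K) \<and> antipode P \<in> alg_homs P (opposite P)"

lemma hopf_algebra_prehopf:
  assumes H: "hopf_algebra K H"
  shows "prehopf H"
proof -
  have "antipode H \<in> alg_homs H (opposite H)"
    using hopf_algebra.antipode_linear[OF H]
    by (intro alg_homsI) (simp_all add: hopf_antipode_mult[OF H] hopf_antipode_one[OF H])
  then show ?thesis
    unfolding prehopf_def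
    using hopf_algebra_unital[OF H] hopf_comult_alg_hom[OF H] hopf_counit_alg_hom[OF H] by simp
qed

section \<open>Transport along \<open>with_hopf\<close>\<close>

lemma with_hopf_simps [simp]:
  "carrier (with_hopf A d e s) = carrier A" "mult (with_hopf A d e s) = mult A" "one (with_hopf A d e s) = one A"
  "zero (with_hopf A d e s) = zero A" "add (with_hopf A d e s) = add A" "smult (with_hopf A d e s) = smult A"
  "comult (with_hopf A d e s) = d" "counit (with_hopf A d e s) = e" "antipode (with_hopf A d e s) = s"
  by (simp_all add: with_hopf_def)

lemma linear_maps_with_hopf [simp]:
  "linear_maps K (with_hopf A d e s) B = linear_maps K A B" "linear_maps K B (with_hopf A d e s) = linear_maps K B A"
  by (simp_all add: linear_maps_def)

lemma alg_homs_with_hopf [simp]: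
  "alg_homs (with_hopf A d e s) B = alg_homs A B" "alg_homs B (with_hopf A d e s) = alg_homs B A"
  "alg_homs B (opposite (with_hopf A d e s)) = alg_homs B (opposite A)"
  by (simp_all add: alg_homs_def ring_hom_def)

text \<open>Tensor products read only the algebra fields of their factors, which
  \<open>with_hopf\<close> copies.\<close>

lemma tensor_with_hopf [simp]: "tensor K (with_hopf A d e s) (with_hopf B d' e' s') = tensor K A B"
  by (simp add: tensor_def tensor_null_def tensor_rels_def DirProd_def)

lemma pure_tensor_with_hopf [simp]:
  "pure_tensor K (with_hopf A d e s) (with_hopf B d' e' s') = pure_tensor K A B"
  by (intro ext) (simp add: pure_tensor_def tensor_null_def tensor_rels_def DirProd_def)

lemma tensor_map_with_hopf [simp]:
  "tensor_map K (with_hopf A d e s) (with_hopf B d' e' s') = tensor_map K A B"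
  by (intro ext) (simp add: tensor_map_def)

text \<open>The result lives in another record type than A, so the axioms are carried over field by
  field.\<close>

lemma unital_algebra_with_hopf:
  assumes A: "unital_algebra K A"
  shows "unital_algebra K (with_hopf A d e s)"
proof -
  interpret A: unital_algebra K A by fact
  let ?H = "with_hopf A d e s"
  have ab: "abelian_group ?H"
  proof (rule abelian_groupI)
    fix x assume "x \<in> carrier ?H"
    then show "\<exists>y\<in>carrier ?H. y \<oplus>\<^bsub>?H\<^esub> x = \<zero>\<^bsub>?H\<^esub>"
      by (intro bexI[of _ "\<ominus>\<^bsub>A\<^esub> x"]) (auto simp: A.l_neg)
  qed (auto simp: A.a_ac)
  have "module K ?H"
    by (rule moduleI[OF is_cring ab]) (auto simp: A.smult_l_distr A.smult_r_distr A.smult_assoc1)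
  moreover have "ring ?H"
    by (rule ringI[OF ab]) (auto intro!: monoidI simp: A.m_assoc A.l_distr A.r_distr)
  ultimately show ?thesis
    by (intro unital_algebra.intro unital_algebra_axioms.intro field_axioms)
      (auto simp: A.smult_mult_left A.smult_mult_right)
qed

lemma hopf_homI:
  assumes "t \<in> alg_homs P H"
    and "\<And>x. x \<in> carrier P \<Longrightarrow> comult H (t x) = tensor_map K H H t t (comult P x)"
    and "\<And>x. x \<in> carrier P \<Longrightarrow> counit H (t x) = counit P x"
    and "\<And>x. x \<in> carrier P \<Longrightarrow> t (antipode P x) = antipode H (t x)"
  shows "t \<in> hopf_hom K P H"
  using assms by (simp add: hopf_hom_def coalgebra_hom_def alg_homs_def)

lemma hopf_homD:
  assumes "t \<in> hopf_hom K P H"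
  shows "t \<in> alg_homs P H"
    and "x \<in> carrier P \<Longrightarrow> comult H (t x) = tensor_map K H H t t (comult P x)"
    and "x \<in> carrier P \<Longrightarrow> counit H (t x) = counit P x"
    and "x \<in> carrier P \<Longrightarrow> t (antipode P x) = antipode H (t x)"
  using assms by (simp_all add: hopf_hom_def coalgebra_hom_def alg_homs_def)

lemma prehopf_with_hopf:
  assumes "unital_algebra K A" "d \<in> alg_homs A (tensor K A A)" "e \<in> alg_homs A (self_module K)" "s \<in> alg_homs A (opposite A)"
  shows "prehopf (with_hopf A d e s)"
  unfolding prehopf_def using assms by (simp add: unital_algebra_with_hopf)

text \<open>The universal property of the presented algebra P, used for the targets P \<otimes> P, K
  and the opposite of P. The hypotheses \<open>kd\<close>, \<open>ke\<close>, \<open>ks\<close> are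
  what remains to be verified in each construction.\<close>

lemma prehopf_presented_hopf:
  assumes R: "R \<subseteq> carrier (free_algebra K X)"
    and d: "\<And>x. x \<in> X \<Longrightarrow> d x \<in> carrier (tensor K (presented_algebra K X R) (presented_algebra K X R))"
    and e: "\<And>x. x \<in> X \<Longrightarrow> e x \<in> carrier K"
    and s: "\<And>x. x \<in> X \<Longrightarrow> s x \<in> carrier (presented_algebra K X R)"
    and kd: "\<And>r. r \<in> R \<Longrightarrow> alg_ext K (tensor K (presented_algebra K X R) (presented_algebra K X R)) d r =
      \<zero>\<^bsub>tensor K (presented_algebra K X R) (presented_algebra K X R)\<^esub>"
    and ke: "\<And>r. r \<in> R \<Longrightarrow> alg_ext K (self_module K) e r = \<zero>\<^bsub>self_module K\<^esub>"
    and ks: "\<And>r. r \<in> R \<Longrightarrow> alg_ext K (opposite (presented_algebra K X R)) s r = \<zero>\<^bsub>presented_algebra K X R\<^esub>"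
  shows "prehopf (presented_hopf K X R d e s)"
    and "x \<in> X \<Longrightarrow> comult (presented_hopf K X R d e s) (generator K X R x) = d x"
    and "x \<in> X \<Longrightarrow> counit (presented_hopf K X R d e s) (generator K X R x) = e x"
    and "x \<in> X \<Longrightarrow> antipode (presented_hopf K X R d e s) (generator K X R x) = s x"
proof -
  note P = unital_algebra_presented_algebra[OF R]
  note D = presented_algebra_lift[where g = d, OF R unital_algebra_tensor[OF P P] d kd]
  note E = presented_algebra_lift[where g = e, OF R unital_algebra_self_module _ ke, simplified, OF e]
  note S = presented_algebra_lift[where g = s, OF R unital_algebra_opposite[OF P], simplified, OF s ks]
  show "prehopf (presented_hopf K X R d e s)"
    unfolding presented_hopf_def Let_def by (rule prehopf_with_hopf[OF P D(1) E(1) S(1)])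
  show "x \<in> X \<Longrightarrow> comult (presented_hopf K X R d e s) (generator K X R x) = d x"
    "x \<in> X \<Longrightarrow> counit (presented_hopf K X R d e s) (generator K X R x) = e x"
    "x \<in> X \<Longrightarrow> antipode (presented_hopf K X R d e s) (generator K X R x) = s x"
    unfolding presented_hopf_def Let_def by (simp_all add: D(2) E(2) S(2))
qed

lemma presented_hopf_simps [simp]:
  "carrier (presented_hopf K X R d e s) = carrier (presented_algebra K X R)"
  "mult (presented_hopf K X R d e s) = mult (presented_algebra K X R)"
  "one (presented_hopf K X R d e s) = one (presented_algebra K X R)"
  "zero (presented_hopf K X R d e s) = zero (presented_algebra K X R)"
  "add (presented_hopf K X R d e s) = add (presented_algebra K X R)"
  "smult (presented_hopf K X R d e s) = smult (presented_algebra K X R)"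
  "linear_maps K (presented_hopf K X R d e s) B = linear_maps K (presented_algebra K X R) B"
  "linear_maps K B (presented_hopf K X R d e s) = linear_maps K B (presented_algebra K X R)"
  "alg_homs (presented_hopf K X R d e s) B = alg_homs (presented_algebra K X R) B"
  "alg_homs B (presented_hopf K X R d e s) = alg_homs B (presented_algebra K X R)"
  "tensor K (presented_hopf K X R d e s) (presented_hopf K X R d e s) =
    tensor K (presented_algebra K X R) (presented_algebra K X R)"
  "pure_tensor K (presented_hopf K X R d e s) (presented_hopf K X R d e s) =
    pure_tensor K (presented_algebra K X R) (presented_algebra K X R)"
  by (simp_all add: presented_hopf_def Let_def)

lemma prehopf_unital: "prehopf P \<Longrightarrow> unital_algebra K P"
  and prehopf_comult: "prehopf P \<Longrightarrow> comult P \<in> alg_homs P (tensor K P P)"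
  and prehopf_counit: "prehopf P \<Longrightarrow> counit P \<in> alg_homs P (self_module K)"
  and prehopf_antipode: "prehopf P \<Longrightarrow> antipode P \<in> alg_homs P (opposite P)"
  by (simp_all add: prehopf_def)

lemma opposite_opposite [simp]: "opposite (opposite A) = A"
  by (simp add: opposite_def)

lemma alg_homs_opposite: "alg_homs (opposite A) (opposite B) = alg_homs A B"
  by (auto simp: alg_homs_def ring_hom_def)

text \<open>In each compatibility both sides are algebra maps in x, so they agree everywhere once
  they agree on generators.\<close>

lemma presented_hopf_hom:
  assumes R: "R \<subseteq> carrier (free_algebra K X)" and P: "prehopf (presented_hopf K X R d e s)" and H: "prehopf H"
    and t: "t \<in> alg_homs (presented_algebra K X R) H"
    and c: "\<And>x. x \<in> X \<Longrightarrow> comult H (t (generator K X R x)) =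
      tensor_map K H H t t (comult (presented_hopf K X R d e s) (generator K X R x))"
    and e: "\<And>x. x \<in> X \<Longrightarrow> counit H (t (generator K X R x)) = counit (presented_hopf K X R d e s) (generator K X R x)"
    and s: "\<And>x. x \<in> X \<Longrightarrow> t (antipode (presented_hopf K X R d e s) (generator K X R x)) = antipode H (t (generator K X R x))"
  shows "t \<in> hopf_hom K (presented_hopf K X R d e s) H"
proof (rule hopf_homI)
  let ?P = "presented_algebra K X R" and ?PH = "presented_hopf K X R d e s"
  note UP = unital_algebra_presented_algebra[OF R] and UH = prehopf_unital[OF H]
  note PD = prehopf_comult[OF P, simplified] and PE = prehopf_counit[OF P, simplified]
  have PS: "antipode ?PH \<in> alg_homs ?P (opposite ?P)"
    using prehopf_antipode[OF P] by (simp add: presented_hopf_def Let_def)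
  note eq = presented_algebra_hom_eq[OF R]
  show "t \<in> alg_homs ?PH H"
    using t by simp
  have tt: "tensor_map K H H t t \<in> alg_homs (tensor K ?P ?P) (tensor K H H)"
    by (rule tensor_map_alg_hom[OF UP UP UH UH t t])
  fix x assume "x \<in> carrier ?PH"
  then have x: "x \<in> carrier ?P"
    by simp
  show "comult H (t x) = tensor_map K H H t t (comult ?PH x)"
    by (rule eq[OF unital_algebra_tensor[OF UH UH] alg_homs_comp[OF prehopf_comult[OF H] t] alg_homs_comp[OF tt PD] c x])
  show "counit H (t x) = counit ?PH x"
    by (rule eq[OF unital_algebra_self_module alg_homs_comp[OF prehopf_counit[OF H] t] PE e x])
  \<comment> \<open>Read between the opposites, t composes with the antipode of the source; both
    composites are then algebra maps into the opposite of H.\<close>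
  have to: "t \<in> alg_homs (opposite ?P) (opposite H)"
    using t by (simp add: alg_homs_opposite)
  show "t (antipode ?PH x) = antipode H (t x)"
    by (rule eq[OF unital_algebra_opposite[OF UH] alg_homs_comp[OF to PS] alg_homs_comp[OF prehopf_antipode[OF H] t] s x])
qed

section \<open>Quotients by an ideal given by generators\<close>

lemma ideal_Idl:
  assumes "unital_algebra K P" "S \<subseteq> carrier P"
  shows "ideal (Idl\<^bsub>P\<^esub> S) P"
  using ring.genideal_ideal[OF ring_unital_algebra[OF assms(1)] assms(2)] .

lemma Idl_coset_eq_zero:
  assumes P: "unital_algebra K P" and S: "S \<subseteq> carrier P" and s: "s \<in> S"
  shows "Idl\<^bsub>P\<^esub> S +>\<^bsub>P\<^esub> s = \<zero>\<^bsub>quot_module P (Idl\<^bsub>P\<^esub> S)\<^esub>"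
proof -
  have "s \<in> Idl\<^bsub>P\<^esub> S"
    using ring.genideal_self[OF ring_unital_algebra[OF P] S] s by (rule subsetD)
  then show ?thesis
    using coset_eq_zero_iff[OF module_unital_algebra[OF P] ideal_submodule[OF P ideal_Idl[OF P S]]] S s
    by (simp add: subset_iff)
qed

text \<open>The Hopf ideal conditions, tested on generators: each structure map followed by the
  projection is an algebra map out of P (into the opposite of Q for the antipode), so it kills the
  ideal once it kills S.\<close>

lemma prehopf_quot_hopf:
  assumes P: "prehopf P" and S: "S \<subseteq> carrier P"
  defines "I \<equiv> Idl\<^bsub>P\<^esub> S" and "Q \<equiv> quot_module P (Idl\<^bsub>P\<^esub> S)" and "\<pi> \<equiv> (\<lambda>x. Idl\<^bsub>P\<^esub> S +>\<^bsub>P\<^esub> x)"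
  assumes kd: "\<And>s. s \<in> S \<Longrightarrow> tensor_map K Q Q \<pi> \<pi> (comult P s) = \<zero>\<^bsub>tensor K Q Q\<^esub>"
    and ke: "\<And>s. s \<in> S \<Longrightarrow> counit P s = \<zero>"
    and ks: "\<And>s. s \<in> S \<Longrightarrow> \<pi> (antipode P s) = \<zero>\<^bsub>Q\<^esub>"
  shows "prehopf (quot_hopf K P I)"
    and "x \<in> carrier P \<Longrightarrow> comult (quot_hopf K P I) (\<pi> x) = tensor_map K Q Q \<pi> \<pi> (comult P x)"
    and "x \<in> carrier P \<Longrightarrow> counit (quot_hopf K P I) (\<pi> x) = counit P x"
    and "x \<in> carrier P \<Longrightarrow> antipode (quot_hopf K P I) (\<pi> x) = \<pi> (antipode P x)"
proof -
  note UP = prehopf_unital[OF P]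
  note I = ideal_Idl[OF UP S, folded I_def]
  have UQ: "unital_algebra K Q"
    unfolding Q_def by (rule unital_algebra_quot_module[OF UP ideal_Idl[OF UP S]])
  have \<pi>: "\<pi> \<in> alg_homs P Q"
    unfolding Q_def \<pi>_def by (rule quot_module_proj_alg_hom[OF UP ideal_Idl[OF UP S]])
  have \<pi>o: "\<pi> \<in> alg_homs (opposite P) (opposite Q)"
    using \<pi> by (simp add: alg_homs_opposite)
  note d = alg_homs_comp[OF tensor_map_alg_hom[OF UP UP UQ UQ \<pi> \<pi>] prehopf_comult[OF P]]
  note e = prehopf_counit[OF P]
  note s = alg_homs_comp[OF \<pi>o prehopf_antipode[OF P]]
  have ke': "counit P n = \<zero>\<^bsub>self_module K\<^esub>" if "n \<in> S" for n
    using ke[OF that] by (simp add: self_module_def)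
  have ks': "\<pi> (antipode P n) = \<zero>\<^bsub>opposite Q\<^esub>" if "n \<in> S" for n
    using ks[OF that] by simp
  note ld = coset_lift_alg_hom[OF UP unital_algebra_tensor[OF UQ UQ] ideal_Idl[OF UP S] d
      alg_hom_kills_Idl[OF UP unital_algebra_tensor[OF UQ UQ] d S kd]]
  note le = coset_lift_alg_hom[OF UP unital_algebra_self_module ideal_Idl[OF UP S] e
      alg_hom_kills_Idl[OF UP unital_algebra_self_module e S ke']]
  note ls = coset_lift_alg_hom[OF UP unital_algebra_opposite[OF UQ] ideal_Idl[OF UP S] s
      alg_hom_kills_Idl[OF UP unital_algebra_opposite[OF UQ] s S ks']]
  have eq: "quot_hopf K P I = with_hopf Q (coset_lift (\<lambda>x. tensor_map K Q Q \<pi> \<pi> (comult P x)))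
      (coset_lift (counit P)) (coset_lift (\<lambda>x. \<pi> (antipode P x)))"
    by (simp add: quot_hopf_def Let_def I_def Q_def \<pi>_def)
  show "prehopf (quot_hopf K P I)"
    unfolding eq by (rule prehopf_with_hopf[OF UQ ld(1)[folded Q_def] le(1)[folded Q_def] ls(1)[folded Q_def]])
  show "x \<in> carrier P \<Longrightarrow> comult (quot_hopf K P I) (\<pi> x) = tensor_map K Q Q \<pi> \<pi> (comult P x)"
    "x \<in> carrier P \<Longrightarrow> counit (quot_hopf K P I) (\<pi> x) = counit P x"
    "x \<in> carrier P \<Longrightarrow> antipode (quot_hopf K P I) (\<pi> x) = \<pi> (antipode P x)"
    unfolding eq with_hopf_simps using ld(2) le(2) ls(2) by (simp_all add: \<pi>_def)
qed

lemma quot_hopf_simps [simp]: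
  "carrier (quot_hopf K P I) = carrier (quot_module P I)"
  "mult (quot_hopf K P I) = mult (quot_module P I)"
  "one (quot_hopf K P I) = one (quot_module P I)"
  "zero (quot_hopf K P I) = zero (quot_module P I)"
  "add (quot_hopf K P I) = add (quot_module P I)"
  "smult (quot_hopf K P I) = smult (quot_module P I)"
  "linear_maps K (quot_hopf K P I) B = linear_maps K (quot_module P I) B"
  "linear_maps K B (quot_hopf K P I) = linear_maps K B (quot_module P I)"
  "alg_homs (quot_hopf K P I) B = alg_homs (quot_module P I) B"
  "alg_homs B (quot_hopf K P I) = alg_homs B (quot_module P I)"
  "tensor K (quot_hopf K P I) (quot_hopf K P I) = tensor K (quot_module P I) (quot_module P I)"
  "pure_tensor K (quot_hopf K P I) (quot_hopf K P I) = pure_tensor K (quot_module P I) (quot_module P I)"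
  by (simp_all add: quot_hopf_def Let_def)

text \<open>Every element of the quotient is some \<pi> x, and there each compatibility of the
  induced map is that of t at x. The hypotheses \<open>c\<close>, \<open>e\<close>, \<open>a\<close>
  are supplied by \<open>prehopf_quot_hopf\<close>.\<close>

lemma quot_hopf_hom:
  assumes P: "prehopf P" and H: "prehopf H" and S: "S \<subseteq> carrier P"
  defines "I \<equiv> Idl\<^bsub>P\<^esub> S" and "Q \<equiv> quot_module P (Idl\<^bsub>P\<^esub> S)" and "\<pi> \<equiv> (\<lambda>x. Idl\<^bsub>P\<^esub> S +>\<^bsub>P\<^esub> x)"
  assumes c: "\<And>x. x \<in> carrier P \<Longrightarrow> comult (quot_hopf K P I) (\<pi> x) = tensor_map K Q Q \<pi> \<pi> (comult P x)"
    and e: "\<And>x. x \<in> carrier P \<Longrightarrow> counit (quot_hopf K P I) (\<pi> x) = counit P x"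
    and a: "\<And>x. x \<in> carrier P \<Longrightarrow> antipode (quot_hopf K P I) (\<pi> x) = \<pi> (antipode P x)"
    and t: "t \<in> hopf_hom K P H" and kill: "\<And>s. s \<in> S \<Longrightarrow> t s = \<zero>\<^bsub>H\<^esub>"
  shows "coset_lift t \<in> hopf_hom K (quot_hopf K P I) H"
    and "x \<in> carrier P \<Longrightarrow> coset_lift t (\<pi> x) = t x"
proof -
  note UP = prehopf_unital[OF P] and UH = prehopf_unital[OF H]
  note I = ideal_Idl[OF UP S]
  note ta = hopf_homD(1)[OF t]
  have UQ: "unital_algebra K Q"
    unfolding Q_def by (rule unital_algebra_quot_module[OF UP I])
  have \<pi>: "\<pi> \<in> alg_homs P Q"
    unfolding Q_def \<pi>_def by (rule quot_module_proj_alg_hom[OF UP I])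
  have kill': "t n = \<zero>\<^bsub>H\<^esub>" if "n \<in> Idl\<^bsub>P\<^esub> S" for n
    by (rule alg_hom_kills_Idl[OF UP UH ta S kill that])
  have l: "coset_lift t \<in> alg_homs Q H"
    unfolding Q_def by (rule coset_lift_alg_hom(1)[OF UP UH I ta kill'])
  have v: "coset_lift t (\<pi> x) = t x" if "x \<in> carrier P" for x
    unfolding \<pi>_def by (rule coset_lift_alg_hom(2)[OF UP UH I ta kill' that])
  show "x \<in> carrier P \<Longrightarrow> coset_lift t (\<pi> x) = t x"
    by (rule v)
  note M = module_unital_algebra[OF UP] module_unital_algebra[OF UQ] module_unital_algebra[OF UH]
  note lin = alg_homs_linear[OF ta] alg_homs_linear[OF \<pi>] alg_homs_linear[OF l]
  show "coset_lift t \<in> hopf_hom K (quot_hopf K P I) H"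
  proof (rule hopf_homI)
    show "coset_lift t \<in> alg_homs (quot_hopf K P I) H"
      using l by (simp add: I_def Q_def)
    fix y assume "y \<in> carrier (quot_hopf K P I)"
    then obtain x where x: "x \<in> carrier P" "y = \<pi> x"
      by (auto simp: I_def \<pi>_def quot_module_carrier)
    have xc: "comult P x \<in> carrier (tensor K P P)"
      by (rule alg_homs_closed[OF prehopf_comult[OF P] x(1)])
    have "tensor_map K H H (coset_lift t) (coset_lift t) (tensor_map K Q Q \<pi> \<pi> (comult P x)) =
        tensor_lift K (tensor K H H) (\<lambda>u v. pure_tensor K H H (coset_lift t (\<pi> u)) (coset_lift t (\<pi> v))) (comult P x)"
      unfolding tensor_map_def[of K H H]
      by (rule tensor_lift_tensor_map[OF M(1,1,2,2) module_tensor[OF M(3,3)] lin(2,2) pure_tensor_maps_bilinear[OF M(3,3) lin(3,3)] xc])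
    also have "\<dots> = tensor_map K H H t t (comult P x)"
      unfolding tensor_map_def
      by (rule tensor_lift_cong[OF M(1,1) module_tensor[OF M(3,3)] pure_tensor_maps_bilinear[OF M(3,3) lin(1,1)] _ xc])
        (simp add: v)
    finally show "comult H (coset_lift t y) = tensor_map K H H (coset_lift t) (coset_lift t) (comult (quot_hopf K P I) y)"
      using x by (simp add: c v hopf_homD(2)[OF t])
    show "counit H (coset_lift t y) = counit (quot_hopf K P I) y"
      using x by (simp add: e v hopf_homD(3)[OF t])
    have "antipode P x \<in> carrier P"
      using alg_homs_closed[OF prehopf_antipode[OF P] x(1)] by simp
    then show "coset_lift t (antipode (quot_hopf K P I) y) = antipode H (coset_lift t y)"
      using x by (simp add: a v hopf_homD(4)[OF t])
  qed
qed

lemma lin_ext_with_hopf [simp]: "lin_ext K (with_hopf A d e s) = lin_ext K A"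
  by (intro ext) (simp add: lin_ext_def finsum_def finprod_def)

lemma tensor_lift_quot_hopf [simp]: "tensor_lift K (quot_hopf K P I) = tensor_lift K (quot_module P I)"
  by (intro ext) (simp add: tensor_lift_def quot_hopf_def Let_def)

lemma minus_eq_zeroD:
  assumes M: "module K M" and "x \<ominus>\<^bsub>M\<^esub> y = \<zero>\<^bsub>M\<^esub>" "x \<in> carrier M" "y \<in> carrier M"
  shows "x = y"
proof -
  interpret M: module K M by fact
  show ?thesis
    using assms(2-) M.minus_equality[of x "\<ominus>\<^bsub>M\<^esub> y"] by (simp add: a_minus_def)
qed

lemma minus_self:
  assumes M: "module K M" and "x \<in> carrier M"
  shows "x \<ominus>\<^bsub>M\<^esub> x = \<zero>\<^bsub>M\<^esub>"
proof -
  interpret M: module K M by fact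
  show ?thesis
    using assms(2) by (simp add: a_minus_def M.r_neg)
qed

lemma presented_algebra_rel_eq:
  assumes R: "R \<subseteq> carrier (free_algebra K X)" and r: "u \<ominus>\<^bsub>free_algebra K X\<^esub> w \<in> R"
    and u: "u \<in> carrier (free_algebra K X)" and w: "w \<in> carrier (free_algebra K X)"
  shows "Idl\<^bsub>free_algebra K X\<^esub> R +>\<^bsub>free_algebra K X\<^esub> u = Idl\<^bsub>free_algebra K X\<^esub> R +>\<^bsub>free_algebra K X\<^esub> w"
proof -
  note \<pi> = presented_algebra_proj[OF R] and UP = unital_algebra_presented_algebra[OF R]
  show ?thesis
    by (rule minus_eq_zeroD[OF module_unital_algebra[OF UP]
        presented_algebra_rel[OF R r, unfolded alg_homs_minus[OF unital_algebra_free_algebra UP \<pi> u w]]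
        alg_homs_closed[OF \<pi> u] alg_homs_closed[OF \<pi> w]])
qed

lemma lin_ext_opposite [simp]: "lin_ext K (opposite Z) = lin_ext K Z"
  by (intro ext) (simp add: lin_ext_def finsum_def opposite_def)

lemma tensor_lift_opposite [simp]: "tensor_lift K (opposite Z) = tensor_lift K Z"
  by (intro ext) (simp add: tensor_lift_def)

text \<open>
  Since \<open>V\<^sub>i\<close> is the co-opposite coalgebra for odd \<open>i\<close>, a convolution product over \<open>V\<^sub>i\<close> becomes one
  over \<open>C\<close> after passing to the opposite algebra.
\<close>

definition parity_algebra :: "nat \<Rightarrow> ('k, 'x, 'm) module_scheme \<Rightarrow> ('k, 'x, 'm) module_scheme"
  where "parity_algebra i A = (if even i then A else opposite A)"

lemma parity_algebra_simps [simp]: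
  "carrier (parity_algebra i A) = carrier A" "\<one>\<^bsub>parity_algebra i A\<^esub> = \<one>\<^bsub>A\<^esub>" "\<zero>\<^bsub>parity_algebra i A\<^esub> = \<zero>\<^bsub>A\<^esub>"
  "x \<oplus>\<^bsub>parity_algebra i A\<^esub> y = x \<oplus>\<^bsub>A\<^esub> y" "a \<odot>\<^bsub>parity_algebra i A\<^esub> x = a \<odot>\<^bsub>A\<^esub> x"
  "parity_algebra i (opposite A) = parity_algebra (Suc i) A"
  by (simp_all add: parity_algebra_def)

lemma linear_maps_parity_algebra [simp]:
  "linear_maps K M (parity_algebra i A) = linear_maps K M A"
  by (simp add: parity_algebra_def)

lemma tensor_lift_parity_algebra [simp]: "tensor_lift K (parity_algebra i A) = tensor_lift K A"
  by (simp add: parity_algebra_def)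

lemma bilinear_parity_algebra [simp]:
  "bilinear (parity_algebra i A) (parity_algebra i B) M g = bilinear A B M g"
  by (simp add: parity_algebra_def)

lemma bilinear_parity_algebra_codomain [simp]: "bilinear M N (parity_algebra i A) g = bilinear M N A g"
  by (simp add: bilinear_def)

lemma unital_algebra_parity_algebra: "unital_algebra K A \<Longrightarrow> unital_algebra K (parity_algebra i A)"
  by (simp add: parity_algebra_def unital_algebra_opposite)

lemma alg_homs_mult_parity:
  assumes "h \<in> alg_homs A B" "x \<in> carrier A" "y \<in> carrier A"
  shows "h (x \<otimes>\<^bsub>parity_algebra i A\<^esub> y) = h x \<otimes>\<^bsub>parity_algebra i B\<^esub> h y"
  using assms by (simp add: parity_algebra_def alg_homs_mult)

text \<open>The order of tensor factors in the coproduct of \<open>V\<^sub>i\<close>: exchanged for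
  odd i, where the coalgebra is co-opposite.\<close>

definition parity_tensor ::
  "('k, 'x, 'm) module_scheme \<Rightarrow> nat \<Rightarrow> 'x \<Rightarrow> 'x \<Rightarrow> ('x \<times> 'x \<Rightarrow> 'k) set"
  where "parity_tensor A i x y = (if even i then pure_tensor K A A x y else pure_tensor K A A y x)"

lemma parity_tensor_bilinear:
  assumes A: "module K A"
  shows "bilinear A A (tensor K A A) (parity_tensor A i)"
proof -
  note p = pure_tensor_bilinear[OF A A]
  show ?thesis
    by (cases "even i")
      (simp_all add: parity_tensor_def[abs_def] bilinearI bilinear_left[OF p linear_maps_id] bilinear_right[OF p linear_maps_id])
qed

text \<open>The parities p and i are unrelated: exchanging tensor factors commutes with reversing
  the multiplication.\<close>

lemma parity_tensor_mult:
  assumes A: "unital_algebra K A" and "x \<in> carrier A" "y \<in> carrier A" "x' \<in> carrier A" "y' \<in> carrier A"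
  shows "parity_tensor A p x y \<otimes>\<^bsub>parity_algebra i (tensor K A A)\<^esub> parity_tensor A p x' y' =
    parity_tensor A p (x \<otimes>\<^bsub>parity_algebra i A\<^esub> x') (y \<otimes>\<^bsub>parity_algebra i A\<^esub> y')"
  using assms by (simp add: parity_tensor_def parity_algebra_def pure_tensor_mult[OF A A])

section \<open>Coproducts\<close>

text \<open>The relations express that g is an algebra map up to the ideal; they die under h as soon
  as the composite of h and g is an algebra map.\<close>

lemma alg_hom_rels_kill:
  assumes A: "unital_algebra K A" and F: "unital_algebra K F" and Y: "unital_algebra K Y"
    and h: "h \<in> alg_homs F Y" and hg: "(\<lambda>x. h (g x)) \<in> alg_homs A Y"
    and g: "\<And>x. x \<in> carrier A \<Longrightarrow> g x \<in> carrier F" and r: "r \<in> alg_hom_rels K A F g"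
  shows "h r = \<zero>\<^bsub>Y\<^esub>"
proof -
  interpret A: unital_algebra K A by fact
  interpret F: unital_algebra K F by fact
  interpret Y: unital_algebra K Y by fact
  note hm = alg_homs_minus[OF F Y h] alg_homs_add[OF h] alg_homs_smult[OF h] alg_homs_mult[OF h] alg_homs_one[OF h]
    alg_homs_add[OF hg] alg_homs_smult[OF hg] alg_homs_mult[OF hg] alg_homs_one[OF hg]
  show ?thesis
    using r unfolding alg_hom_rels_def
    by (auto simp: hm g alg_homs_closed[OF h] minus_self[OF Y.module_axioms])
qed

lemma alg_hom_rels_closed:
  assumes A: "unital_algebra K A" and F: "unital_algebra K F" and g: "\<And>x. x \<in> carrier A \<Longrightarrow> g x \<in> carrier F"
  shows "alg_hom_rels K A F g \<subseteq> carrier F"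
proof -
  interpret A: unital_algebra K A by fact
  interpret F: unital_algebra K F by fact
  show ?thesis
    unfolding alg_hom_rels_def
    by (auto intro!: F.minus_closed F.a_closed F.m_closed F.smult_closed g A.m_closed A.a_closed A.smult_closed)
qed

lemma free_product_gen_closed:
  "x \<in> carrier A \<Longrightarrow> single K [Inl x] \<in> carrier (free_algebra K (free_product_gens A B))"
  "y \<in> carrier B \<Longrightarrow> single K [Inr y] \<in> carrier (free_algebra K (free_product_gens A B))"
  by (auto intro!: free_gen_closed simp: free_product_gens_def)

lemma free_product_rels_closed:
  assumes A: "unital_algebra K A" and B: "unital_algebra K B"
  shows "free_product_rels K A B \<subseteq> carrier (free_algebra K (free_product_gens A B))"
  unfolding free_product_rels_def Let_def
  by (intro Un_least alg_hom_rels_closed[OF A unital_algebra_free_algebra] alg_hom_rels_closed[OF B unital_algebra_free_algebra]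
    free_product_gen_closed)

lemma alg_ext_free_product_rels:
  assumes A: "unital_algebra K A" and B: "unital_algebra K B" and Y: "unital_algebra K Y"
    and gA: "gA \<in> alg_homs A Y" and gB: "gB \<in> alg_homs B Y" and r: "r \<in> free_product_rels K A B"
  shows "alg_ext K Y (case_sum gA gB) r = \<zero>\<^bsub>Y\<^esub>"
proof -
  let ?X = "free_product_gens A B" and ?g = "case_sum gA gB"
  note F = unital_algebra_free_algebra[of ?X]
  have gc: "?g x \<in> carrier Y" if "x \<in> ?X" for x
    using that alg_homs_closed[OF gA] alg_homs_closed[OF gB] by (auto simp: free_product_gens_def)
  note h = alg_ext_alg_hom[where g = ?g and X = ?X, OF Y gc]
  have l: "alg_ext K Y ?g (single K [Inl x]) = gA x" if "x \<in> carrier A" for x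
    using that by (subst h(2)) (auto simp: free_product_gens_def)
  have rr: "alg_ext K Y ?g (single K [Inr x]) = gB x" if "x \<in> carrier B" for x
    using that by (subst h(2)) (auto simp: free_product_gens_def)
  interpret A: unital_algebra K A by fact
  interpret B: unital_algebra K B by fact
  have hl: "(\<lambda>x. alg_ext K Y ?g (single K [Inl x])) \<in> alg_homs A Y"
    by (rule alg_homsI[OF linear_maps_cong[OF A.module_axioms alg_homs_linear[OF gA]]])
      (simp_all add: l alg_homs_mult[OF gA] alg_homs_one[OF gA])
  have hr: "(\<lambda>x. alg_ext K Y ?g (single K [Inr x])) \<in> alg_homs B Y"
    by (rule alg_homsI[OF linear_maps_cong[OF B.module_axioms alg_homs_linear[OF gB]]])
      (simp_all add: rr alg_homs_mult[OF gB] alg_homs_one[OF gB])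
  show ?thesis
    using r unfolding free_product_rels_def Let_def
    using alg_hom_rels_kill[OF A F Y h(1) hl free_product_gen_closed(1)]
      alg_hom_rels_kill[OF B F Y h(1) hr free_product_gen_closed(2)] by blast
qed

text \<open>The converse of \<open>alg_hom_rels_kill\<close>. With h the projection onto the free
  product it shows that the canonical maps are algebra maps.\<close>

lemma alg_hom_of_rels:
  assumes A: "unital_algebra K A" and F: "unital_algebra K F" and Y: "unital_algebra K Y"
    and h: "h \<in> alg_homs F Y" and kill: "\<And>r. r \<in> alg_hom_rels K A F g \<Longrightarrow> h r = \<zero>\<^bsub>Y\<^esub>"
    and g: "\<And>x. x \<in> carrier A \<Longrightarrow> g x \<in> carrier F"
  shows "(\<lambda>x. h (g x)) \<in> alg_homs A Y"
proof -
  interpret A: unital_algebra K A by fact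
  interpret F: unital_algebra K F by fact
  have eq: "h u = h v" if "u \<ominus>\<^bsub>F\<^esub> v \<in> alg_hom_rels K A F g" "u \<in> carrier F" "v \<in> carrier F" for u v
    using kill[OF that(1)] that(2,3)
    by (intro minus_eq_zeroD[OF module_unital_algebra[OF Y], of "h u" "h v"])
      (simp_all add: alg_homs_minus[OF F Y h] alg_homs_closed[OF h])
  show ?thesis
  proof (rule alg_homsI, rule linear_mapsI)
    show "h (g x) \<in> carrier Y" if "x \<in> carrier A" for x
      by (rule alg_homs_closed[OF h g[OF that]])
    show "h (g (x \<oplus>\<^bsub>A\<^esub> y)) = h (g x) \<oplus>\<^bsub>Y\<^esub> h (g y)" if "x \<in> carrier A" "y \<in> carrier A" for x y
    proof -
      have "g (x \<oplus>\<^bsub>A\<^esub> y) \<ominus>\<^bsub>F\<^esub> (g x \<oplus>\<^bsub>F\<^esub> g y) \<in> alg_hom_rels K A F g"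
        unfolding alg_hom_rels_def using that by blast
      then show ?thesis
        using eq[of "g (x \<oplus>\<^bsub>A\<^esub> y)" "g x \<oplus>\<^bsub>F\<^esub> g y"] that by (simp add: g alg_homs_add[OF h])
    qed
    show "h (g (a \<odot>\<^bsub>A\<^esub> x)) = a \<odot>\<^bsub>Y\<^esub> h (g x)" if "a \<in> carrier K" "x \<in> carrier A" for a x
    proof -
      have "g (a \<odot>\<^bsub>A\<^esub> x) \<ominus>\<^bsub>F\<^esub> a \<odot>\<^bsub>F\<^esub> g x \<in> alg_hom_rels K A F g"
        unfolding alg_hom_rels_def using that by blast
      then show ?thesis
        using eq[of "g (a \<odot>\<^bsub>A\<^esub> x)" "a \<odot>\<^bsub>F\<^esub> g x"] that by (simp add: g alg_homs_smult[OF h])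
    qed
    show "h (g (x \<otimes>\<^bsub>A\<^esub> y)) = h (g x) \<otimes>\<^bsub>Y\<^esub> h (g y)" if "x \<in> carrier A" "y \<in> carrier A" for x y
    proof -
      have "g (x \<otimes>\<^bsub>A\<^esub> y) \<ominus>\<^bsub>F\<^esub> g x \<otimes>\<^bsub>F\<^esub> g y \<in> alg_hom_rels K A F g"
        unfolding alg_hom_rels_def using that by blast
      then show ?thesis
        using eq[of "g (x \<otimes>\<^bsub>A\<^esub> y)" "g x \<otimes>\<^bsub>F\<^esub> g y"] that by (simp add: g alg_homs_mult[OF h])
    qed
    have "g \<one>\<^bsub>A\<^esub> \<ominus>\<^bsub>F\<^esub> \<one>\<^bsub>F\<^esub> \<in> alg_hom_rels K A F g"
      unfolding alg_hom_rels_def by blast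
    then show "h (g \<one>\<^bsub>A\<^esub>) = \<one>\<^bsub>Y\<^esub>"
      using eq[of "g \<one>\<^bsub>A\<^esub>" "\<one>\<^bsub>F\<^esub>"] by (simp add: g alg_homs_one[OF h])
  qed
qed

lemma coprod_alg_homs:
  assumes A: "unital_algebra K A" and B: "unital_algebra K B"
  defines "P \<equiv> presented_algebra K (free_product_gens A B) (free_product_rels K A B)"
  shows "coprod_inl K A B \<in> alg_homs A P" and "coprod_inr K A B \<in> alg_homs B P"
proof -
  let ?X = "free_product_gens A B" and ?R = "free_product_rels K A B"
  let ?F = "free_algebra K ?X"
  note R = free_product_rels_closed[OF A B]
  note UP = unital_algebra_presented_algebra[OF R]
  note kill = presented_algebra_rel[OF R]
  have "(\<lambda>x. Idl\<^bsub>?F\<^esub> ?R +>\<^bsub>?F\<^esub> single K [Inl x]) \<in> alg_homs A P"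
    unfolding P_def
    by (rule alg_hom_of_rels[OF A unital_algebra_free_algebra UP presented_algebra_proj[OF R] kill free_product_gen_closed(1)])
      (simp_all add: free_product_rels_def Let_def)
  then show "coprod_inl K A B \<in> alg_homs A P"
    by (simp add: coprod_inl_def[abs_def] generator_def)
  have "(\<lambda>x. Idl\<^bsub>?F\<^esub> ?R +>\<^bsub>?F\<^esub> single K [Inr x]) \<in> alg_homs B P"
    unfolding P_def
    by (rule alg_hom_of_rels[OF B unital_algebra_free_algebra UP presented_algebra_proj[OF R] kill free_product_gen_closed(2)])
      (simp_all add: free_product_rels_def Let_def)
  then show "coprod_inr K A B \<in> alg_homs B P"
    by (simp add: coprod_inr_def[abs_def] generator_def)
qed

lemma hopf_coprod_eq:
  "hopf_coprod K A B = presented_hopf K (free_product_gens A B) (free_product_rels K A B)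
    (case_sum
      (\<lambda>x. tensor_map K (presented_algebra K (free_product_gens A B) (free_product_rels K A B))
        (presented_algebra K (free_product_gens A B) (free_product_rels K A B)) (coprod_inl K A B) (coprod_inl K A B) (comult A x))
      (\<lambda>y. tensor_map K (presented_algebra K (free_product_gens A B) (free_product_rels K A B))
        (presented_algebra K (free_product_gens A B) (free_product_rels K A B)) (coprod_inr K A B) (coprod_inr K A B) (comult B y)))
    (case_sum (counit A) (counit B))
    (case_sum (\<lambda>x. coprod_inl K A B (antipode A x)) (\<lambda>y. coprod_inr K A B (antipode B y)))"
  by (simp add: hopf_coprod_def Let_def)

lemma tensor_map_presented_hopf [simp]:
  "tensor_map K (presented_hopf K X R d e s) (presented_hopf K X R d e s) =
    tensor_map K (presented_algebra K X R) (presented_algebra K X R)"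
  by (simp add: presented_hopf_def Let_def)

text \<open>The prescribed values are composites of algebra maps out of A or B, with the opposite as
  target for the antipode; such values kill the relations of the free product automatically.\<close>

lemma hopf_coprod_structure:
  assumes A: "prehopf A" and B: "prehopf B"
  defines "i \<equiv> coprod_inl K A B" and "j \<equiv> coprod_inr K A B" and "P \<equiv> hopf_coprod K A B"
  shows "prehopf P" and "i \<in> alg_homs A P" and "j \<in> alg_homs B P"
    and "x \<in> carrier A \<Longrightarrow> comult P (i x) = tensor_map K P P i i (comult A x)"
    and "y \<in> carrier B \<Longrightarrow> comult P (j y) = tensor_map K P P j j (comult B y)"
    and "x \<in> carrier A \<Longrightarrow> counit P (i x) = counit A x"
    and "y \<in> carrier B \<Longrightarrow> counit P (j y) = counit B y"
    and "x \<in> carrier A \<Longrightarrow> antipode P (i x) = i (antipode A x)"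
    and "y \<in> carrier B \<Longrightarrow> antipode P (j y) = j (antipode B y)"
proof -
  let ?X = "free_product_gens A B" and ?R = "free_product_rels K A B"
  let ?P = "presented_algebra K ?X ?R"
  note UA = prehopf_unital[OF A] and UB = prehopf_unital[OF B]
  note R = free_product_rels_closed[OF UA UB]
  note UP = unital_algebra_presented_algebra[OF R]
  note UT = unital_algebra_tensor[OF UP UP]
  note ij = coprod_alg_homs[OF UA UB, folded i_def j_def]
  have ijo: "i \<in> alg_homs (opposite A) (opposite ?P)" "j \<in> alg_homs (opposite B) (opposite ?P)"
    using ij by (simp_all add: alg_homs_opposite)
  let ?d = "case_sum (\<lambda>x. tensor_map K ?P ?P i i (comult A x)) (\<lambda>y. tensor_map K ?P ?P j j (comult B y))"
  let ?e = "case_sum (counit A) (counit B)"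
  let ?s = "case_sum (\<lambda>x. i (antipode A x)) (\<lambda>y. j (antipode B y))"
  note d = alg_homs_comp[OF tensor_map_alg_hom[OF UA UA UP UP ij(1) ij(1)] prehopf_comult[OF A]]
    alg_homs_comp[OF tensor_map_alg_hom[OF UB UB UP UP ij(2) ij(2)] prehopf_comult[OF B]]
  note e = prehopf_counit[OF A] prehopf_counit[OF B]
  note s = alg_homs_comp[OF ijo(1) prehopf_antipode[OF A]] alg_homs_comp[OF ijo(2) prehopf_antipode[OF B]]
  have closed: "?d x \<in> carrier (tensor K ?P ?P)" "?e x \<in> carrier K" "?s x \<in> carrier ?P" if "x \<in> ?X" for x
    using that alg_homs_closed[OF d(1)] alg_homs_closed[OF d(2)] alg_homs_closed[OF e(1)] alg_homs_closed[OF e(2)]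
      alg_homs_closed[OF s(1)] alg_homs_closed[OF s(2)] by (auto simp: free_product_gens_def)
  have ks: "alg_ext K (opposite ?P) ?s r = \<zero>\<^bsub>?P\<^esub>" if "r \<in> ?R" for r
    using alg_ext_free_product_rels[OF UA UB unital_algebra_opposite[OF UP] s that] by simp
  note pre = prehopf_presented_hopf[where d = ?d and e = ?e and s = ?s, OF R closed
      alg_ext_free_product_rels[OF UA UB UT d] alg_ext_free_product_rels[OF UA UB unital_algebra_self_module e] ks]
  have P: "P = presented_hopf K ?X ?R ?d ?e ?s"
    by (simp add: P_def hopf_coprod_eq i_def j_def)
  have gi: "i x = generator K ?X ?R (Inl x)" for x
    by (simp add: i_def coprod_inl_def)
  have gj: "j x = generator K ?X ?R (Inr x)" for x
    by (simp add: j_def coprod_inr_def)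
  show "prehopf P"
    unfolding P by (rule pre(1))
  show "i \<in> alg_homs A P" "j \<in> alg_homs B P"
    using ij by (simp_all add: P)
  have X: "x \<in> carrier A \<Longrightarrow> Inl x \<in> ?X" "y \<in> carrier B \<Longrightarrow> Inr y \<in> ?X" for x y
    by (auto simp: free_product_gens_def)
  show "x \<in> carrier A \<Longrightarrow> comult P (i x) = tensor_map K P P i i (comult A x)"
    using pre(2)[OF _ _ _ _ _ _ X(1), of x] unfolding P gi by simp
  show "y \<in> carrier B \<Longrightarrow> comult P (j y) = tensor_map K P P j j (comult B y)"
    using pre(2)[OF _ _ _ _ _ _ X(2), of y] unfolding P gj by simp
  show "x \<in> carrier A \<Longrightarrow> counit P (i x) = counit A x"
    using pre(3)[OF _ _ _ _ _ _ X(1), of x] unfolding P gi by simp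
  show "y \<in> carrier B \<Longrightarrow> counit P (j y) = counit B y"
    using pre(3)[OF _ _ _ _ _ _ X(2), of y] unfolding P gj by simp
  show "x \<in> carrier A \<Longrightarrow> antipode P (i x) = i (antipode A x)"
    using pre(4)[OF _ _ _ _ _ _ X(1), of x] unfolding P gi by simp
  show "y \<in> carrier B \<Longrightarrow> antipode P (j y) = j (antipode B y)"
    using pre(4)[OF _ _ _ _ _ _ X(2), of y] unfolding P gj by simp
qed

lemma hopf_coprod_hom_eq:
  assumes A: "unital_algebra K A" and B: "unital_algebra K B" and Y: "unital_algebra K Y"
    and h: "h \<in> alg_homs (hopf_coprod K A B) Y" and h': "h' \<in> alg_homs (hopf_coprod K A B) Y"
    and inl: "\<And>x. x \<in> carrier A \<Longrightarrow> h (coprod_inl K A B x) = h' (coprod_inl K A B x)"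
    and inr: "\<And>y. y \<in> carrier B \<Longrightarrow> h (coprod_inr K A B y) = h' (coprod_inr K A B y)"
    and u: "u \<in> carrier (hopf_coprod K A B)"
  shows "h u = h' u"
proof (rule presented_algebra_hom_eq[OF free_product_rels_closed[OF A B] Y])
  show "h (generator K (free_product_gens A B) (free_product_rels K A B) x) =
      h' (generator K (free_product_gens A B) (free_product_rels K A B) x)" if "x \<in> free_product_gens A B" for x
    using that inl inr by (auto simp: free_product_gens_def coprod_inl_def coprod_inr_def)
qed (use h h' u in \<open>simp_all add: hopf_coprod_eq\<close>)

lemma hopf_coprod_lift:
  assumes A: "prehopf A" and B: "prehopf B" and H: "prehopf H"
    and f: "f \<in> hopf_hom K A H" and g: "g \<in> hopf_hom K B H"
  obtains t where "t \<in> hopf_hom K (hopf_coprod K A B) H"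
    and "\<And>x. x \<in> carrier A \<Longrightarrow> t (coprod_inl K A B x) = f x"
    and "\<And>y. y \<in> carrier B \<Longrightarrow> t (coprod_inr K A B y) = g y"
proof -
  let ?X = "free_product_gens A B" and ?R = "free_product_rels K A B"
  let ?i = "coprod_inl K A B" and ?j = "coprod_inr K A B"
  let ?P = "presented_algebra K ?X ?R" and ?PH = "hopf_coprod K A B"
  note UA = prehopf_unital[OF A] and UB = prehopf_unital[OF B] and UH = prehopf_unital[OF H]
  note MA = module_unital_algebra[OF UA] and MB = module_unital_algebra[OF UB] and MH = module_unital_algebra[OF UH]
  note R = free_product_rels_closed[OF UA UB]
  note fa = hopf_homD(1)[OF f] and ga = hopf_homD(1)[OF g]
  note str = hopf_coprod_structure[OF A B]
  note UP = prehopf_unital[OF str(1)]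
  note MP = module_unital_algebra[OF UP]
  let ?t = "coset_lift (alg_ext K H (case_sum f g))"
  have c: "case_sum f g x \<in> carrier H" if "x \<in> ?X" for x
    using that alg_homs_closed[OF fa] alg_homs_closed[OF ga] by (auto simp: free_product_gens_def)
  note kill = alg_ext_free_product_rels[OF UA UB UH fa ga]
  have ta: "?t \<in> alg_homs ?P H"
    by (rule presented_algebra_lift(1)[OF R UH c kill])
  have tg: "?t (generator K ?X ?R x) = case_sum f g x" if "x \<in> ?X" for x
    by (rule presented_algebra_lift(2)[OF R UH c kill that])
  have ti: "?t (?i x) = f x" if "x \<in> carrier A" for x
    using tg[of "Inl x"] that by (auto simp: coprod_inl_def free_product_gens_def)
  have tj: "?t (?j x) = g x" if "x \<in> carrier B" for x
    using tg[of "Inr x"] that by (auto simp: coprod_inr_def free_product_gens_def)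
  have taP: "?t \<in> alg_homs ?PH H"
    using ta by (simp add: hopf_coprod_eq)
  \<comment> \<open>Generic in D, so that it serves both canonical maps, whose domains have
    different types.\<close>
  have tt: "tensor_map K H H ?t ?t (tensor_map K ?PH ?PH m m u) = tensor_map K H H k k u"
    if m: "m \<in> alg_homs D ?PH" and D: "module K D" and k: "k \<in> linear_maps K D H"
      and eq: "\<And>x. x \<in> carrier D \<Longrightarrow> ?t (m x) = k x" and u: "u \<in> carrier (tensor K D D)"
    for m k u and D :: "('k, 'z, 'zz) module_scheme"
  proof -
    note tl = alg_homs_linear[OF taP] and ml = alg_homs_linear[OF m]
    have "tensor_map K H H ?t ?t (tensor_map K ?PH ?PH m m u) =
      tensor_lift K (tensor K H H) (\<lambda>x y. pure_tensor K H H (?t (m x)) (?t (m y))) u"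
      unfolding tensor_map_def[of K H H]
      by (rule tensor_lift_tensor_map[OF D D MP MP module_tensor[OF MH MH] ml ml pure_tensor_maps_bilinear[OF MH MH tl tl] u])
    also have "\<dots> = tensor_map K H H k k u"
      unfolding tensor_map_def
      by (rule tensor_lift_cong[OF D D module_tensor[OF MH MH] pure_tensor_maps_bilinear[OF MH MH k k] _ u]) (simp add: eq)
    finally show ?thesis .
  qed
  have th: "?t \<in> hopf_hom K ?PH H"
    unfolding hopf_coprod_eq
  proof (rule presented_hopf_hom[OF R _ H ta]; (fold hopf_coprod_eq)?)
    show "prehopf ?PH"
      by (rule str(1))
    fix x assume "x \<in> ?X"
    then consider (l) a where "x = Inl a" "a \<in> carrier A" | (r) b where "x = Inr b" "b \<in> carrier B"
      by (auto simp: free_product_gens_def)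
    then have "comult H (?t (generator K ?X ?R x)) = tensor_map K H H ?t ?t (comult ?PH (generator K ?X ?R x)) \<and>
      counit H (?t (generator K ?X ?R x)) = counit ?PH (generator K ?X ?R x) \<and>
      ?t (antipode ?PH (generator K ?X ?R x)) = antipode H (?t (generator K ?X ?R x))"
    proof cases
      case l
      have gx: "generator K ?X ?R x = ?i a"
        by (simp add: l coprod_inl_def)
      have "antipode A a \<in> carrier A"
        using alg_homs_closed[OF prehopf_antipode[OF A] l(2)] by simp
      then show ?thesis
        unfolding gx using tt[OF str(2) MA alg_homs_linear[OF fa] ti alg_homs_closed[OF prehopf_comult[OF A] l(2)]] l(2)
        by (simp add: str(4,6,8) ti hopf_homD(2-4)[OF f])
    next
      case r
      have gx: "generator K ?X ?R x = ?j b"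
        by (simp add: r coprod_inr_def)
      have "antipode B b \<in> carrier B"
        using alg_homs_closed[OF prehopf_antipode[OF B] r(2)] by simp
      then show ?thesis
        unfolding gx using tt[OF str(3) MB alg_homs_linear[OF ga] tj alg_homs_closed[OF prehopf_comult[OF B] r(2)]] r(2)
        by (simp add: str(5,7,9) tj hopf_homD(2-4)[OF g])
    qed
    then show "comult H (?t (generator K ?X ?R x)) = tensor_map K H H ?t ?t (comult ?PH (generator K ?X ?R x))"
      "counit H (?t (generator K ?X ?R x)) = counit ?PH (generator K ?X ?R x)"
      "?t (antipode ?PH (generator K ?X ?R x)) = antipode H (?t (generator K ?X ?R x))"
      by simp_all
  qed
  show thesis
    by (rule that[OF th ti tj])
qed

text \<open>Serves in the end for the restriction of a map to its carrier.\<close>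

lemma hopf_hom_cong:
  assumes P: "prehopf P" and H: "unital_algebra K H" and t: "t \<in> hopf_hom K P H"
    and eq: "\<And>x. x \<in> carrier P \<Longrightarrow> t' x = t x"
  shows "t' \<in> hopf_hom K P H"
proof -
  note UP = prehopf_unital[OF P]
  interpret P: unital_algebra K P by (rule UP)
  note ta = hopf_homD(1)[OF t]
  note M = module_unital_algebra[OF UP] module_unital_algebra[OF H]
  have t'l: "t' \<in> linear_maps K P H"
    by (rule linear_maps_cong[OF M(1) alg_homs_linear[OF ta] eq])
  have ac: "antipode P x \<in> carrier P" if "x \<in> carrier P" for x
    using alg_homs_closed[OF prehopf_antipode[OF P] that] by simp
  show ?thesis
  proof (rule hopf_homI)
    show "t' \<in> alg_homs P H"
      by (rule alg_homsI[OF t'l]) (simp_all add: eq alg_homs_mult[OF ta] alg_homs_one[OF ta])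
    fix x assume x: "x \<in> carrier P"
    show "comult H (t' x) = tensor_map K H H t' t' (comult P x)"
      using tensor_map_cong[OF M(1,1,2,2) alg_homs_linear[OF ta] alg_homs_linear[OF ta] eq eq
          alg_homs_closed[OF prehopf_comult[OF P] x]] x
      by (simp add: eq hopf_homD(2)[OF t])
  qed (simp_all add: eq ac hopf_homD(3,4)[OF t])
qed

end

section \<open>Takeuchi's free Hopf algebra\<close>

locale takeuchi = ground_field K for K :: "('k, 'r) ring_scheme" (structure) +
  fixes C :: "('k, 'c, 'm) coalg_scheme"
  assumes C: "coalgebra K C"
begin

abbreviation (input) "gens \<equiv> takeuchi_gens C"
abbreviation (input) "rels \<equiv> takeuchi_linear_rels K C"
abbreviation (input) "T \<equiv> takeuchi_tensor_algebra K C"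
abbreviation (input) "var \<equiv> takeuchi_var K C"

lemma module_C: "module K C"
  by (rule coalgebra_module[OF C])

lemma takeuchi_rels_closed: "rels \<subseteq> carrier (free_algebra K gens)"
proof -
  interpret C: module K C by (rule module_C)
  interpret F: unital_algebra K "free_algebra K gens" by (rule unital_algebra_free_algebra)
  have s: "single K [(c, i)] \<in> carrier (free_algebra K gens)" if "c \<in> carrier C" for c i
    using that by (intro free_gen_closed) (simp add: takeuchi_gens_def)
  show ?thesis
    unfolding takeuchi_linear_rels_def Let_def
    by (auto intro!: F.minus_closed F.a_closed F.smult_closed s)
qed

text \<open>The relations never mix degrees, so linearity of g in each degree separately is
  enough.\<close>

lemma alg_ext_takeuchi_rels:
  assumes Y: "unital_algebra K Y" and g: "\<And>i. (\<lambda>c. g (c, i)) \<in> linear_maps K C Y" and r: "r \<in> rels"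
  shows "alg_ext K Y g r = \<zero>\<^bsub>Y\<^esub>"
proof -
  let ?F = "free_algebra K gens"
  interpret C: module K C by (rule module_C)
  interpret F: unital_algebra K ?F by (rule unital_algebra_free_algebra)
  interpret Y: unital_algebra K Y by fact
  have gc: "g x \<in> carrier Y" if "x \<in> gens" for x
    using that linear_maps_closed[OF g] by (auto simp: takeuchi_gens_def)
  note h = alg_ext_alg_hom[where g = g and X = gens, OF Y gc]
  have s: "single K [(c, i)] \<in> carrier ?F" if "c \<in> carrier C" for c i
    using that by (intro free_gen_closed) (simp add: takeuchi_gens_def)
  have hs: "alg_ext K Y g (single K [(c, i)]) = g (c, i)" if "c \<in> carrier C" for c i
    using that by (intro h(2)) (simp_all add: takeuchi_gens_def)
  note hm = alg_homs_minus[OF F.unital_algebra_axioms Y h(1)] alg_homs_add[OF h(1)] alg_homs_smult[OF h(1)]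
  have gl: "g (c, i) \<in> carrier Y" if "c \<in> carrier C" for c i
    using that by (intro gc) (simp add: takeuchi_gens_def)
  show ?thesis
    using r unfolding takeuchi_linear_rels_def Let_def
    by (auto simp: hm s hs gl linear_maps_add[OF g] linear_maps_smult[OF g] minus_self[OF Y.module_axioms])
qed

lemma takeuchi_tensor_algebra_eq:
  "T = presented_hopf K gens rels
    (\<lambda>(c, i). tensor_lift K (tensor K (presented_algebra K gens rels) (presented_algebra K gens rels))
      (\<lambda>x y. parity_tensor (presented_algebra K gens rels) i (var x i) (var y i)) (comult C c))
    (\<lambda>(c, i). counit C c) (\<lambda>(c, i). var c (Suc i))"
  by (simp add: takeuchi_tensor_algebra_def Let_def parity_tensor_def)

lemma takeuchi_var_closed0: "c \<in> carrier C \<Longrightarrow> var c i \<in> carrier (presented_algebra K gens rels)"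
  unfolding takeuchi_var_def
  by (rule generator_closed[OF takeuchi_rels_closed]) (simp add: takeuchi_gens_def)

text \<open>Stated over the bare presented algebra, because the Hopf structure of the tensor algebra
  is built from it.\<close>

lemma takeuchi_var_linear0: "(\<lambda>c. var c i) \<in> linear_maps K C (presented_algebra K gens rels)"
proof -
  let ?F = "free_algebra K gens" and ?P = "presented_algebra K gens rels"
  interpret C: module K C by (rule module_C)
  interpret F: unital_algebra K ?F by (rule unital_algebra_free_algebra)
  have UP: "unital_algebra K ?P"
    by (rule unital_algebra_presented_algebra[OF takeuchi_rels_closed])
  interpret P: unital_algebra K ?P by (rule UP)
  let ?\<pi> = "\<lambda>u. Idl\<^bsub>?F\<^esub> rels +>\<^bsub>?F\<^esub> u"
  note \<pi> = presented_algebra_proj[OF takeuchi_rels_closed]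
  have s: "single K [(c, i)] \<in> carrier ?F" if "c \<in> carrier C" for c
    using that by (intro free_gen_closed) (simp add: takeuchi_gens_def)
  have v: "var c i = ?\<pi> (single K [(c, i)])" for c
    by (simp add: takeuchi_var_def generator_def)
  have eq: "?\<pi> u = ?\<pi> w" if "u \<ominus>\<^bsub>?F\<^esub> w \<in> rels" "u \<in> carrier ?F" "w \<in> carrier ?F" for u w
    by (rule presented_algebra_rel_eq[OF takeuchi_rels_closed that])
  show ?thesis
  proof (rule linear_mapsI)
    show "var c i \<in> carrier ?P" if "c \<in> carrier C" for c
      by (rule takeuchi_var_closed0[OF that])
    fix c assume c: "c \<in> carrier C"
    { fix d assume d: "d \<in> carrier C"
      have "single K [(c \<oplus>\<^bsub>C\<^esub> d, i)] \<ominus>\<^bsub>?F\<^esub> (single K [(c, i)] \<oplus>\<^bsub>?F\<^esub> single K [(d, i)]) \<in> rels"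
        unfolding takeuchi_linear_rels_def Let_def using c d by blast
      then have "?\<pi> (single K [(c \<oplus>\<^bsub>C\<^esub> d, i)]) = ?\<pi> (single K [(c, i)] \<oplus>\<^bsub>?F\<^esub> single K [(d, i)])"
        by (rule eq) (simp_all add: s c d)
      then show "var (c \<oplus>\<^bsub>C\<^esub> d) i = var c i \<oplus>\<^bsub>?P\<^esub> var d i"
        by (simp add: v alg_homs_add[OF \<pi>] s c d) }
    fix a assume a: "a \<in> carrier K"
    have "single K [(a \<odot>\<^bsub>C\<^esub> c, i)] \<ominus>\<^bsub>?F\<^esub> a \<odot>\<^bsub>?F\<^esub> single K [(c, i)] \<in> rels"
      unfolding takeuchi_linear_rels_def Let_def using a c by blast
    then have "?\<pi> (single K [(a \<odot>\<^bsub>C\<^esub> c, i)]) = ?\<pi> (a \<odot>\<^bsub>?F\<^esub> single K [(c, i)])"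
      by (rule eq) (simp_all add: s a c)
    then show "var (a \<odot>\<^bsub>C\<^esub> c) i = a \<odot>\<^bsub>?P\<^esub> var c i"
      by (simp add: v alg_homs_smult[OF \<pi>] s a c)
  qed
qed

text \<open>The only relations are linear ones and all prescribed values are linear in c, so the
  structure maps exist. For the antipode this is just the linearity of the variable of the next
  degree.\<close>

lemma takeuchi_tensor_algebra_structure:
  shows prehopf_takeuchi_tensor_algebra: "prehopf T"
    and takeuchi_var_linear: "(\<lambda>c. var c i) \<in> linear_maps K C T"
    and takeuchi_comult_var: "c \<in> carrier C \<Longrightarrow> comult T (var c i) =
      tensor_lift K (tensor K T T) (\<lambda>x y. parity_tensor T i (var x i) (var y i)) (comult C c)"
    and takeuchi_counit_var: "c \<in> carrier C \<Longrightarrow> counit T (var c i) = counit C c"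
    and takeuchi_antipode_var: "c \<in> carrier C \<Longrightarrow> antipode T (var c i) = var c (Suc i)"
proof -
  let ?P = "presented_algebra K gens rels"
  let ?TP = "tensor K ?P ?P"
  let ?d = "\<lambda>(c, i). tensor_lift K ?TP (\<lambda>x y. parity_tensor ?P i (var x i) (var y i)) (comult C c)"
  let ?e = "\<lambda>(c, i). counit C c" and ?s = "\<lambda>(c, i). var c (Suc i)"
  have UP: "unital_algebra K ?P"
    by (rule unital_algebra_presented_algebra[OF takeuchi_rels_closed])
  note MP = module_unital_algebra[OF UP]
  note UT = unital_algebra_tensor[OF UP UP] and MT = module_tensor[OF MP MP]
  note pt = parity_tensor_bilinear[OF MP]
  note v = takeuchi_var_linear0
  note lin = C MP MT bilinear_left[OF pt] bilinear_right[OF pt] bilinear_closed[OF pt] v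
    linear_maps_comp[OF v] linear_maps_closed[OF v]
  have dl: "(\<lambda>c. ?d (c, i)) \<in> linear_maps K C ?TP" for i
    unfolding prod.case by (assumption | rule lin multilinear)+
  have el: "(\<lambda>c. ?e (c, i)) \<in> linear_maps K C (self_module K)" for i
    by (simp add: coalgebra_counit_linear[OF C])
  have sl: "(\<lambda>c. ?s (c, i)) \<in> linear_maps K C ?P" for i
    by (simp add: v)
  have genv: "generator K gens rels (c, i) = var c i" for c i
    by (simp add: takeuchi_var_def)
  have g: "(c, i) \<in> gens" if "c \<in> carrier C" for c i
    using that by (simp add: takeuchi_gens_def)
  have closed: "?d x \<in> carrier ?TP" "?e x \<in> carrier K" "?s x \<in> carrier ?P" if gx: "x \<in> gens" for x
  proof -
    obtain c i where x: "x = (c, i)" "c \<in> carrier C"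
      using gx by (auto simp: takeuchi_gens_def)
    then show "?d x \<in> carrier ?TP" "?e x \<in> carrier K" "?s x \<in> carrier ?P"
      using linear_maps_closed[OF dl[of i] x(2)] linear_maps_closed[OF el[of i] x(2)]
        linear_maps_closed[OF sl[of i] x(2)] by simp_all
  qed
  have ks: "alg_ext K (opposite ?P) ?s r = \<zero>\<^bsub>?P\<^esub>" if "r \<in> rels" for r
    using alg_ext_takeuchi_rels[where g = ?s, OF unital_algebra_opposite[OF UP] _ that] sl by simp
  note kd = alg_ext_takeuchi_rels[where g = ?d, OF UT dl]
    and ke = alg_ext_takeuchi_rels[where g = ?e, OF unital_algebra_self_module el]
  note pre = prehopf_presented_hopf[where d = ?d and e = ?e and s = ?s, OF takeuchi_rels_closed closed kd ke ks]
  have pT: "parity_tensor T = parity_tensor ?P"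
    by (intro ext) (simp add: parity_tensor_def takeuchi_tensor_algebra_eq)
  show "prehopf T"
    unfolding takeuchi_tensor_algebra_eq by (rule pre(1))
  show "(\<lambda>c. var c i) \<in> linear_maps K C T"
    using v by (simp add: takeuchi_tensor_algebra_eq)
  show "comult T (var c i) = tensor_lift K (tensor K T T) (\<lambda>x y. parity_tensor T i (var x i) (var y i)) (comult C c)"
    if "c \<in> carrier C"
    unfolding pT using pre(2)[OF _ _ _ _ _ _ g[OF that, of i]] unfolding takeuchi_tensor_algebra_eq genv by simp
  show "counit T (var c i) = counit C c" if "c \<in> carrier C"
    using pre(3)[OF _ _ _ _ _ _ g[OF that, of i]] unfolding takeuchi_tensor_algebra_eq genv by simp
  show "antipode T (var c i) = var c (Suc i)" if "c \<in> carrier C"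
    using pre(4)[OF _ _ _ _ _ _ g[OF that, of i]] unfolding takeuchi_tensor_algebra_eq genv by simp
qed

text \<open>
  The relations of degree \<open>i\<close> that define the free Hopf algebra are those with \<open>{p, q} = {i, i + 1}\<close>;
  which of the two antipode identities each of them expresses depends on the parity of \<open>i\<close>.
\<close>

definition takeuchi_rel :: "'c \<Rightarrow> nat \<Rightarrow> nat \<Rightarrow> nat \<Rightarrow> (('c \<times> nat) list \<Rightarrow> 'k) set"
  where "takeuchi_rel c i p q =
    tensor_lift K T (\<lambda>x y. var x p \<otimes>\<^bsub>parity_algebra i T\<^esub> var y q) (comult C c) \<ominus>\<^bsub>T\<^esub> counit C c \<odot>\<^bsub>T\<^esub> \<one>\<^bsub>T\<^esub>"

definition takeuchi_rels :: "(('c \<times> nat) list \<Rightarrow> 'k) set set"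
  where "takeuchi_rels = (\<Union>c \<in> carrier C. \<Union>i. {takeuchi_rel c i i (Suc i), takeuchi_rel c i (Suc i) i})"

lemma unital_T: "unital_algebra K T"
  by (rule prehopf_unital[OF prehopf_takeuchi_tensor_algebra])

lemma module_T: "module K T"
  by (rule module_unital_algebra[OF unital_T])

lemmas var_linear = takeuchi_var_linear

lemmas var_rules = C unital_T module_T var_linear linear_maps_comp[OF var_linear] linear_maps_closed[OF var_linear]

text \<open>Turns a Sweedler sum over a variable of the tensor algebra into one over C.\<close>

lemma takeuchi_comult_var_lift:
  assumes Z: "module K Z" and g: "bilinear T T Z g" and c: "c \<in> carrier C"
  shows "tensor_lift K Z g (comult T (var c i)) =
    tensor_lift K Z (\<lambda>x y. if even i then g (var x i) (var y i) else g (var y i) (var x i)) (comult C c)"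
proof -
  note MT = module_T and TT = module_tensor[OF module_T module_T]
  note pt = parity_tensor_bilinear[OF MT]
  note lg = tensor_lift_linear[OF MT MT Z g]
  note lin = var_rules TT Z bilinear_left[OF pt] bilinear_right[OF pt] bilinear_closed[OF pt]
    bilinear_left[OF g] bilinear_right[OF g] bilinear_closed[OF g]
  have b: "bilinear C C Z (\<lambda>x y. if even i then g (var x i) (var y i) else g (var y i) (var x i))"
    by (cases "even i"; simp only: if_True if_False) (assumption | rule lin multilinear)+
  have "tensor_lift K Z g (comult T (var c i)) =
    tensor_lift K Z (\<lambda>x y. tensor_lift K Z g (parity_tensor T i (var x i) (var y i))) (comult C c)"
    unfolding takeuchi_comult_var[OF c]
    by (rule linear_sweedler[OF C TT Z c _ lg]) (assumption | rule lin multilinear)+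
  also have "\<dots> = tensor_lift K Z (\<lambda>x y. if even i then g (var x i) (var y i) else g (var y i) (var x i)) (comult C c)"
    by (rule sweedler_cong[OF C Z c b])
      (simp add: parity_tensor_def tensor_lift_pure[OF MT MT Z g] linear_maps_closed[OF var_linear])
  finally show ?thesis .
qed

text \<open>An equality of two-element sets, because the two relations trade places when i is odd:
  exchanging the factors of the coproduct then also exchanges which of them is shifted in
  degree.\<close>

lemma takeuchi_rel_pair:
  assumes c: "c \<in> carrier C"
  shows "{tensor_lift K T (\<lambda>x y. x \<otimes>\<^bsub>T\<^esub> antipode T y) (comult T (var c i)) \<ominus>\<^bsub>T\<^esub> counit T (var c i) \<odot>\<^bsub>T\<^esub> \<one>\<^bsub>T\<^esub>,
      tensor_lift K T (\<lambda>x y. antipode T x \<otimes>\<^bsub>T\<^esub> y) (comult T (var c i)) \<ominus>\<^bsub>T\<^esub> counit T (var c i) \<odot>\<^bsub>T\<^esub> \<one>\<^bsub>T\<^esub>} =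
    {takeuchi_rel c i i (Suc i), takeuchi_rel c i (Suc i) i}"
proof -
  note S = prehopf_antipode[OF prehopf_takeuchi_tensor_algebra]
  have Sl: "antipode T \<in> linear_maps K T T"
    using alg_homs_linear[OF S] by simp
  note lin = var_rules Sl linear_maps_comp[OF Sl] linear_maps_closed[OF Sl]
  have b1: "bilinear T T T (\<lambda>x y. x \<otimes>\<^bsub>T\<^esub> antipode T y)" and b2: "bilinear T T T (\<lambda>x y. antipode T x \<otimes>\<^bsub>T\<^esub> y)"
    by (assumption | rule lin multilinear)+
  note l = takeuchi_comult_var_lift[OF module_T b1 c] takeuchi_comult_var_lift[OF module_T b2 c]
  have p: "bilinear C C T (\<lambda>x y. var x p \<otimes>\<^bsub>parity_algebra i T\<^esub> var y q)" for i p q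
    by (cases "even i"; simp only: parity_algebra_def if_True if_False opposite_simps)
      (assumption | rule lin multilinear)+
  have cong: "tensor_lift K T g (comult C c) = tensor_lift K T (\<lambda>x y. var x p \<otimes>\<^bsub>parity_algebra i T\<^esub> var y q) (comult C c)"
    if "\<And>x y. \<lbrakk>x \<in> carrier C; y \<in> carrier C\<rbrakk> \<Longrightarrow> g x y = var x p \<otimes>\<^bsub>parity_algebra i T\<^esub> var y q" for g p q
    by (rule sweedler_cong[OF C module_T c p that])
  show ?thesis
  proof (cases "even i")
    case True
    then have "tensor_lift K T (\<lambda>x y. x \<otimes>\<^bsub>T\<^esub> antipode T y) (comult T (var c i)) =
        tensor_lift K T (\<lambda>x y. var x i \<otimes>\<^bsub>parity_algebra i T\<^esub> var y (Suc i)) (comult C c)"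
      "tensor_lift K T (\<lambda>x y. antipode T x \<otimes>\<^bsub>T\<^esub> y) (comult T (var c i)) =
        tensor_lift K T (\<lambda>x y. var x (Suc i) \<otimes>\<^bsub>parity_algebra i T\<^esub> var y i) (comult C c)"
      unfolding l by - (rule cong, simp add: takeuchi_antipode_var parity_algebra_def)+
    then show ?thesis
      by (simp add: takeuchi_rel_def takeuchi_counit_var[OF c])
  next
    case False
    then have "tensor_lift K T (\<lambda>x y. x \<otimes>\<^bsub>T\<^esub> antipode T y) (comult T (var c i)) =
        tensor_lift K T (\<lambda>x y. var x (Suc i) \<otimes>\<^bsub>parity_algebra i T\<^esub> var y i) (comult C c)"
      "tensor_lift K T (\<lambda>x y. antipode T x \<otimes>\<^bsub>T\<^esub> y) (comult T (var c i)) =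
        tensor_lift K T (\<lambda>x y. var x i \<otimes>\<^bsub>parity_algebra i T\<^esub> var y (Suc i)) (comult C c)"
      unfolding l by - (rule cong, simp add: takeuchi_antipode_var parity_algebra_def)+
    then show ?thesis
      by (simp add: takeuchi_rel_def takeuchi_counit_var[OF c] insert_commute)
  qed
qed

lemma takeuchi_ideal_eq: "takeuchi_ideal K C = Idl\<^bsub>T\<^esub> takeuchi_rels"
  unfolding takeuchi_ideal_def Let_def takeuchi_rels_def by (simp add: takeuchi_rel_pair)

lemma var_parity_bilinear:
  assumes Y: "unital_algebra K Y" and g: "g \<in> linear_maps K C Y" and g': "g' \<in> linear_maps K C Y"
  shows "bilinear C C Y (\<lambda>x y. g x \<otimes>\<^bsub>parity_algebra i Y\<^esub> g' y)"
proof -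
  note lin = C Y module_unital_algebra[OF Y] g g' linear_maps_comp[OF g] linear_maps_comp[OF g']
    linear_maps_closed[OF g] linear_maps_closed[OF g']
  show ?thesis
    by (cases "even i"; simp only: parity_algebra_def if_True if_False opposite_simps)
      (assumption | rule lin multilinear)+
qed

lemma takeuchi_rel_closed: "c \<in> carrier C \<Longrightarrow> takeuchi_rel c i p q \<in> carrier T"
proof -
  interpret T: unital_algebra K T by (rule unital_T)
  assume c: "c \<in> carrier C"
  show ?thesis
    unfolding takeuchi_rel_def
    by (intro T.minus_closed T.smult_closed T.one_closed coalgebra_counit_closed[OF C c]
      sweedler_closed[OF C module_T var_parity_bilinear[OF unital_T var_linear var_linear] c])
qed

lemma takeuchi_rels_subset: "takeuchi_rels \<subseteq> carrier T"
  unfolding takeuchi_rels_def by (auto simp: takeuchi_rel_closed)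

text \<open>Algebra maps preserve convolution in either parity, so that killing a relation amounts
  to a convolution identity in Y.\<close>

lemma alg_hom_takeuchi_rel:
  assumes Y: "unital_algebra K Y" and h: "h \<in> alg_homs T Y" and c: "c \<in> carrier C"
  shows "h (takeuchi_rel c i p q) =
    tensor_lift K Y (\<lambda>x y. h (var x p) \<otimes>\<^bsub>parity_algebra i Y\<^esub> h (var y q)) (comult C c) \<ominus>\<^bsub>Y\<^esub> counit C c \<odot>\<^bsub>Y\<^esub> \<one>\<^bsub>Y\<^esub>"
proof -
  interpret T: unital_algebra K T by (rule unital_T)
  note MY = module_unital_algebra[OF Y] and hl = alg_homs_linear[OF h]
  have b: "bilinear C C T (\<lambda>x y. var x p \<otimes>\<^bsub>parity_algebra i T\<^esub> var y q)"
    by (rule var_parity_bilinear[OF unital_T var_linear var_linear])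
  have hv: "(\<lambda>x. h (var x r)) \<in> linear_maps K C Y" for r
    by (rule linear_maps_comp[OF hl var_linear])
  have "h (tensor_lift K T (\<lambda>x y. var x p \<otimes>\<^bsub>parity_algebra i T\<^esub> var y q) (comult C c)) =
      tensor_lift K Y (\<lambda>x y. h (var x p \<otimes>\<^bsub>parity_algebra i T\<^esub> var y q)) (comult C c)"
    by (rule linear_sweedler[OF C module_T MY c b hl])
  also have "\<dots> = tensor_lift K Y (\<lambda>x y. h (var x p) \<otimes>\<^bsub>parity_algebra i Y\<^esub> h (var y q)) (comult C c)"
    by (rule sweedler_cong[OF C MY c var_parity_bilinear[OF Y hv hv]])
      (simp add: alg_homs_mult_parity[OF h] linear_maps_closed[OF var_linear])
  finally show ?thesis
    unfolding takeuchi_rel_def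
    using sweedler_closed[OF C module_T b c]
    by (simp add: alg_homs_minus[OF unital_T Y h] alg_homs_smult[OF h] alg_homs_one[OF h] coalgebra_counit_closed[OF C c])
qed

section \<open>The quotient by Takeuchi's ideal\<close>

definition free_hopf_var :: "'c \<Rightarrow> nat \<Rightarrow> (('c \<times> nat) list \<Rightarrow> 'k) set set"
  where "free_hopf_var c i = takeuchi_ideal K C +>\<^bsub>T\<^esub> var c i"

abbreviation (input) "HC \<equiv> free_hopf K C"

lemma free_hopf_eq: "HC = quot_hopf K T (Idl\<^bsub>T\<^esub> takeuchi_rels)"
  by (simp add: free_hopf_def takeuchi_ideal_eq)

text \<open>In the quotient, the maps from C in degrees i and i + 1 are mutually inverse for
  convolution, with values in the opposite algebra if i is odd.\<close>

lemma takeuchi_quot_relation: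
  defines "Q \<equiv> quot_module T (Idl\<^bsub>T\<^esub> takeuchi_rels)"
  assumes c: "c \<in> carrier C" and pq: "(p, q) = (i, Suc i) \<or> (p, q) = (Suc i, i)"
  shows "tensor_lift K Q (\<lambda>x y. free_hopf_var x p \<otimes>\<^bsub>parity_algebra i Q\<^esub> free_hopf_var y q) (comult C c) =
    counit C c \<odot>\<^bsub>Q\<^esub> \<one>\<^bsub>Q\<^esub>"
proof -
  let ?I = "Idl\<^bsub>T\<^esub> takeuchi_rels"
  let ?\<pi> = "\<lambda>x. ?I +>\<^bsub>T\<^esub> x"
  note I = ideal_Idl[OF unital_T takeuchi_rels_subset]
  have UQ: "unital_algebra K Q"
    unfolding Q_def by (rule unital_algebra_quot_module[OF unital_T I])
  have \<pi>: "?\<pi> \<in> alg_homs T Q"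
    unfolding Q_def by (rule quot_module_proj_alg_hom[OF unital_T I])
  have v: "free_hopf_var c i = ?\<pi> (var c i)" for c i
    by (simp add: free_hopf_var_def takeuchi_ideal_eq)
  have w: "(\<lambda>c. free_hopf_var c i) \<in> linear_maps K C Q" for i
    unfolding v by (rule linear_maps_comp[OF alg_homs_linear[OF \<pi>] var_linear])
  have "takeuchi_rel c i p q \<in> takeuchi_rels"
    using c pq by (auto simp: takeuchi_rels_def)
  then have "?\<pi> (takeuchi_rel c i p q) = \<zero>\<^bsub>Q\<^esub>"
    unfolding Q_def by (rule Idl_coset_eq_zero[OF unital_T takeuchi_rels_subset])
  then have "tensor_lift K Q (\<lambda>x y. free_hopf_var x p \<otimes>\<^bsub>parity_algebra i Q\<^esub> free_hopf_var y q) (comult C c) \<ominus>\<^bsub>Q\<^esub>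
      counit C c \<odot>\<^bsub>Q\<^esub> \<one>\<^bsub>Q\<^esub> = \<zero>\<^bsub>Q\<^esub>"
    unfolding alg_hom_takeuchi_rel[OF UQ \<pi> c] v .
  then show ?thesis
    by (rule minus_eq_zeroD[OF module_unital_algebra[OF UQ]])
      (intro sweedler_closed[OF C module_unital_algebra[OF UQ] var_parity_bilinear[OF UQ w w] c]
        smult_closed[OF module_unital_algebra[OF UQ]] algebra_one_closed[OF UQ] coalgebra_counit_closed[OF C c])+
qed

text \<open>If w' is a right convolution inverse of w, the same holds for their coproducts taken in
  degrees of opposite parity. Exactly one of the two coproducts has its factors exchanged, which
  produces the pairing c1 with c4 and c2 with c3 of \<open>sweedler_four_cancel\<close>. The choice
  of multiplication, governed by i, is independent of this.\<close>

lemma sweedler_parity_cancel: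
  assumes Q: "unital_algebra K Q" and w: "w \<in> linear_maps K C Q" and w': "w' \<in> linear_maps K C Q"
    and conv: "\<And>c. c \<in> carrier C \<Longrightarrow>
      tensor_lift K Q (\<lambda>x y. w x \<otimes>\<^bsub>parity_algebra i Q\<^esub> w' y) (comult C c) = counit C c \<odot>\<^bsub>Q\<^esub> \<one>\<^bsub>Q\<^esub>"
    and pq: "even p \<noteq> even q" and c: "c \<in> carrier C"
  defines "h \<equiv> (\<lambda>w p x. tensor_lift K (tensor K Q Q) (\<lambda>a b. parity_tensor Q p (w a) (w b)) (comult C x))"
  shows "tensor_lift K (tensor K Q Q) (\<lambda>x y. h w p x \<otimes>\<^bsub>parity_algebra i (tensor K Q Q)\<^esub> h w' q y) (comult C c) =
    counit C c \<odot>\<^bsub>tensor K Q Q\<^esub> \<one>\<^bsub>tensor K Q Q\<^esub>"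
proof -
  let ?Y = "tensor K Q Q"
  note MQ = module_unital_algebra[OF Q]
  note UY = unital_algebra_tensor[OF Q Q] and MY = module_tensor[OF MQ MQ]
  note UYi = unital_algebra_parity_algebra[OF UY] and UQi = unital_algebra_parity_algebra[OF Q]
  note pt = parity_tensor_bilinear[OF MQ]
  note cl = linear_maps_closed[OF w] linear_maps_closed[OF w']
  have h_lin: "(\<lambda>x. h u r x) \<in> linear_maps K C ?Y" and b: "bilinear C C ?Y (\<lambda>a b. parity_tensor Q r (u a) (u b))"
    if "u \<in> linear_maps K C Q" for u r
  proof -
    note lin = C MQ MY bilinear_left[OF pt] bilinear_right[OF pt] bilinear_closed[OF pt] that linear_maps_comp[OF that]
      linear_maps_closed[OF that]
    show "(\<lambda>x. h u r x) \<in> linear_maps K C ?Y"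
      unfolding h_def by (assumption | rule lin multilinear)+
    show "bilinear C C ?Y (\<lambda>a b. parity_tensor Q r (u a) (u b))"
      by (assumption | rule lin multilinear)+
  qed
  have b_swap: "bilinear C C ?Y (\<lambda>a b. parity_tensor Q p (w' b) (w' a))"
    by (rule bilinearI; rule linear_maps_comp[OF _ w'])
      (simp_all add: bilinear_left[OF pt linear_maps_id] bilinear_right[OF pt linear_maps_id] cl)
  \<comment> \<open>This exchange is what pairs the outer and the inner components.\<close>
  have swap: "parity_tensor Q q x y = parity_tensor Q p y x" for x y
    using pq by (auto simp: parity_tensor_def)
  have b4: "bilinear C C ?Y (\<lambda>z u. parity_tensor Q p (w x \<otimes>\<^bsub>parity_algebra i Q\<^esub> w' u) (w y \<otimes>\<^bsub>parity_algebra i Q\<^esub> w' z))"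
    if "x \<in> carrier C" "y \<in> carrier C" for x y
  proof -
    have m: "(\<lambda>z. w x \<otimes>\<^bsub>parity_algebra i Q\<^esub> w' z) \<in> linear_maps K C Q" if "x \<in> carrier C" for x
      by (rule linear_maps_mult_right[OF UQi, simplified, OF w' cl(1)[OF that]])
    show ?thesis
      by (rule bilinearI; rule linear_maps_comp[OF _ m])
        (simp_all add: bilinear_left[OF pt linear_maps_id] bilinear_right[OF pt linear_maps_id]
          linear_maps_closed[OF m] that)
  qed
  have prod: "h w p x \<otimes>\<^bsub>parity_algebra i ?Y\<^esub> h w' q y =
    tensor_lift K ?Y (\<lambda>a b. tensor_lift K ?Y (\<lambda>z u.
      parity_tensor Q p (w a \<otimes>\<^bsub>parity_algebra i Q\<^esub> w' u) (w b \<otimes>\<^bsub>parity_algebra i Q\<^esub> w' z)) (comult C y)) (comult C x)"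
    if xy: "x \<in> carrier C" "y \<in> carrier C" for x y
  proof -
    have "h w p x \<otimes>\<^bsub>parity_algebra i ?Y\<^esub> h w' q y =
      tensor_lift K ?Y (\<lambda>a b. tensor_lift K ?Y (\<lambda>z u.
        parity_tensor Q p (w a) (w b) \<otimes>\<^bsub>parity_algebra i ?Y\<^esub> parity_tensor Q p (w' u) (w' z)) (comult C y)) (comult C x)"
      unfolding h_def swap
      using sweedler_mult[OF C C UYi[of i], of "\<lambda>a b. parity_tensor Q p (w a) (w b)" "\<lambda>a b. parity_tensor Q p (w' b) (w' a)" x y]
        b[OF w, of p] b_swap xy
      by simp
    also have "\<dots> = tensor_lift K ?Y (\<lambda>a b. tensor_lift K ?Y (\<lambda>z u.
      parity_tensor Q p (w a \<otimes>\<^bsub>parity_algebra i Q\<^esub> w' u) (w b \<otimes>\<^bsub>parity_algebra i Q\<^esub> w' z)) (comult C y)) (comult C x)"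
    proof (rule sweedler_cong[OF C MY xy(1)])
      show "tensor_lift K ?Y (\<lambda>z u. parity_tensor Q p (w a) (w b) \<otimes>\<^bsub>parity_algebra i ?Y\<^esub> parity_tensor Q p (w' u) (w' z)) (comult C y) =
        tensor_lift K ?Y (\<lambda>z u. parity_tensor Q p (w a \<otimes>\<^bsub>parity_algebra i Q\<^esub> w' u) (w b \<otimes>\<^bsub>parity_algebra i Q\<^esub> w' z)) (comult C y)"
        if "a \<in> carrier C" "b \<in> carrier C" for a b
        by (rule sweedler_cong[OF C MY xy(2) b4[OF that]]) (simp add: parity_tensor_mult[OF Q] cl that)
      have m: "(\<lambda>a. w a \<otimes>\<^bsub>parity_algebra i Q\<^esub> w' z) \<in> linear_maps K C Q" if "z \<in> carrier C" for z
        by (rule linear_maps_mult_left[OF UQi, simplified, OF w cl(2)[OF that]])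
      have mc: "w x \<otimes>\<^bsub>parity_algebra i Q\<^esub> w' z \<in> carrier Q" if "x \<in> carrier C" "z \<in> carrier C" for x z
        using linear_maps_closed[OF m[OF that(2)] that(1)] .
      show "bilinear C C ?Y (\<lambda>a b. tensor_lift K ?Y (\<lambda>z u.
        parity_tensor Q p (w a \<otimes>\<^bsub>parity_algebra i Q\<^esub> w' u) (w b \<otimes>\<^bsub>parity_algebra i Q\<^esub> w' z)) (comult C y))"
        by (rule bilinearI; rule sweedler_param_linear[OF C MY module_C xy(2)])
          (use bilinear_left[OF pt m] bilinear_right[OF pt m] mc b4 in auto)
    qed
    finally show ?thesis .
  qed
  have "tensor_lift K ?Y (\<lambda>x y. h w p x \<otimes>\<^bsub>parity_algebra i ?Y\<^esub> h w' q y) (comult C c) =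
    tensor_lift K ?Y (\<lambda>x y. tensor_lift K ?Y (\<lambda>a b. tensor_lift K ?Y (\<lambda>z u.
      parity_tensor Q p (w a \<otimes>\<^bsub>parity_algebra i Q\<^esub> w' u) (w b \<otimes>\<^bsub>parity_algebra i Q\<^esub> w' z)) (comult C y)) (comult C x)) (comult C c)"
    by (rule sweedler_cong[OF C MY c, symmetric])
      (simp_all add: prod var_parity_bilinear[OF UY h_lin[OF w] h_lin[OF w']])
  also have "\<dots> = counit C c \<odot>\<^bsub>?Y\<^esub> parity_tensor Q p \<one>\<^bsub>Q\<^esub> \<one>\<^bsub>Q\<^esub>"
    using sweedler_four_cancel[OF C UQi[of i] MY, of w w' "parity_tensor Q p" c] w w' pt c conv by simp
  finally show ?thesis
    by (simp add: tensor_one parity_tensor_def)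
qed

abbreviation (input) "TI \<equiv> Idl\<^bsub>T\<^esub> takeuchi_rels"
abbreviation (input) "TQ \<equiv> quot_module T TI"
abbreviation (input) "tproj \<equiv> (\<lambda>x. TI +>\<^bsub>T\<^esub> x)"

lemma takeuchi_quot:
  shows ideal_TI: "ideal TI T"
    and unital_TQ: "unital_algebra K TQ"
    and tproj: "tproj \<in> alg_homs T TQ"
    and free_hopf_var_eq: "free_hopf_var c i = tproj (var c i)"
    and free_hopf_var_linear_quot: "(\<lambda>c. free_hopf_var c i) \<in> linear_maps K C TQ"
proof -
  show I: "ideal TI T"
    by (rule ideal_Idl[OF unital_T takeuchi_rels_subset])
  show "unital_algebra K TQ"
    by (rule unital_algebra_quot_module[OF unital_T I])
  show \<pi>: "tproj \<in> alg_homs T TQ"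
    by (rule quot_module_proj_alg_hom[OF unital_T I])
  show v: "free_hopf_var c i = tproj (var c i)" for c i
    by (simp add: free_hopf_var_def takeuchi_ideal_eq)
  show "(\<lambda>c. free_hopf_var c i) \<in> linear_maps K C TQ"
    unfolding v by (rule linear_maps_comp[OF alg_homs_linear[OF \<pi>] var_linear])
qed

lemma takeuchi_comult_quot_var:
  assumes c: "c \<in> carrier C"
  shows "tensor_map K TQ TQ tproj tproj (comult T (var c i)) =
    tensor_lift K (tensor K TQ TQ) (\<lambda>x y. parity_tensor TQ i (free_hopf_var x i) (free_hopf_var y i)) (comult C c)"
proof -
  let ?Y = "tensor K TQ TQ"
  note MQ = module_unital_algebra[OF unital_TQ]
  note MY = module_tensor[OF MQ MQ]
  note \<pi>l = alg_homs_linear[OF tproj] and v = free_hopf_var_eq and w = free_hopf_var_linear_quot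
  note tm = tensor_map_linear[OF module_T module_T MQ MQ \<pi>l \<pi>l]
  note ptT = parity_tensor_bilinear[OF module_T] and ptQ = parity_tensor_bilinear[OF MQ]
  note lin = var_rules MQ MY module_tensor[OF module_T module_T] w linear_maps_comp[OF w] linear_maps_closed[OF w]
    bilinear_left[OF ptT] bilinear_right[OF ptT] bilinear_closed[OF ptT]
    bilinear_left[OF ptQ] bilinear_right[OF ptQ] bilinear_closed[OF ptQ]
  have "tensor_map K TQ TQ tproj tproj (comult T (var c i)) =
    tensor_lift K ?Y (\<lambda>x y. tensor_map K TQ TQ tproj tproj (parity_tensor T i (var x i) (var y i))) (comult C c)"
    unfolding takeuchi_comult_var[OF c]
    by (rule linear_sweedler[OF C _ MY c _ tm]) (assumption | rule lin multilinear)+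
  also have "\<dots> = tensor_lift K ?Y (\<lambda>x y. parity_tensor TQ i (free_hopf_var x i) (free_hopf_var y i)) (comult C c)"
    by (rule sweedler_cong[OF C MY c], (assumption | rule lin multilinear)+)
      (simp add: parity_tensor_def v tensor_map_pure[OF module_T module_T MQ MQ \<pi>l \<pi>l] linear_maps_closed[OF var_linear])
  finally show ?thesis .
qed

lemma takeuchi_relsE:
  assumes "s \<in> takeuchi_rels"
  obtains c i p q where "c \<in> carrier C" "(p, q) = (i, Suc i) \<or> (p, q) = (Suc i, i)" "s = takeuchi_rel c i p q"
  using assms unfolding takeuchi_rels_def by blast

text \<open>Takeuchi's ideal is a Hopf ideal. Coproduct: consecutive degrees have opposite parity,
  so \<open>sweedler_parity_cancel\<close> applies. Counit: the convolution of \<epsilon> with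
  itself is \<epsilon>. Antipode: it raises both degrees by one and reverses products, which turns a
  relation of degree i into one of degree i + 1.\<close>

lemma takeuchi_rels_kill:
  assumes "s \<in> takeuchi_rels"
  shows takeuchi_rels_comult: "tensor_map K TQ TQ tproj tproj (comult T s) = \<zero>\<^bsub>tensor K TQ TQ\<^esub>"
    and takeuchi_rels_counit: "counit T s = \<zero>"
    and takeuchi_rels_antipode: "tproj (antipode T s) = \<zero>\<^bsub>TQ\<^esub>"
proof -
  note UQ = unital_TQ
  note MQ = module_unital_algebra[OF UQ]
  let ?Y = "tensor K TQ TQ"
  note UY = unital_algebra_tensor[OF UQ UQ] and MY = module_tensor[OF MQ MQ]
  note preT = prehopf_takeuchi_tensor_algebra
  note \<pi> = tproj and v = free_hopf_var_eq and w = free_hopf_var_linear_quot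
  let ?D = "\<lambda>x. tensor_map K TQ TQ tproj tproj (comult T x)"
  note tm = tensor_map_alg_hom[OF unital_T unital_T UQ UQ \<pi> \<pi>]
  have D: "?D \<in> alg_homs T ?Y"
    by (rule alg_homs_comp[OF tm prehopf_comult[OF preT]])
  note Dv = takeuchi_comult_quot_var
  obtain c i p q where c: "c \<in> carrier C" and pq: "(p, q) = (i, Suc i) \<or> (p, q) = (Suc i, i)"
      and s: "s = takeuchi_rel c i p q"
    using assms by (rule takeuchi_relsE)
  note rel = takeuchi_quot_relation
  show "?D s = \<zero>\<^bsub>?Y\<^esub>"
  proof -
    have pq': "even p \<noteq> even q"
      using pq by auto
    let ?h = "\<lambda>p x. tensor_lift K ?Y (\<lambda>a b. parity_tensor TQ p (free_hopf_var a p) (free_hopf_var b p)) (comult C x)"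
    have hl: "(\<lambda>x. ?h p x) \<in> linear_maps K C ?Y" for p
      by (rule linear_maps_cong[OF module_C linear_maps_comp[OF alg_homs_linear[OF D] var_linear[of p]]]) (simp add: Dv)
    have "tensor_lift K ?Y (\<lambda>x y. ?D (var x p) \<otimes>\<^bsub>parity_algebra i ?Y\<^esub> ?D (var y q)) (comult C c) =
      tensor_lift K ?Y (\<lambda>x y. ?h p x \<otimes>\<^bsub>parity_algebra i ?Y\<^esub> ?h q y) (comult C c)"
      by (rule sweedler_cong[OF C MY c var_parity_bilinear[OF UY hl hl]]) (simp add: Dv)
    also have "\<dots> = counit C c \<odot>\<^bsub>?Y\<^esub> \<one>\<^bsub>?Y\<^esub>"
      by (rule sweedler_parity_cancel[OF UQ w w rel[OF _ pq] pq' c])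
    finally show "?D s = \<zero>\<^bsub>?Y\<^esub>"
      unfolding s alg_hom_takeuchi_rel[OF UY D c]
      by (simp add: minus_self[OF MY] smult_closed[OF MY] algebra_one_closed[OF UY] coalgebra_counit_closed[OF C c])
  qed
  let ?k = "self_module K"
  show "counit T s = \<zero>"
  proof -
    note E = prehopf_counit[OF preT]
    have cl: "counit C x \<in> carrier K" if "x \<in> carrier C" for x
      by (rule coalgebra_counit_closed[OF C that])
    \<comment> \<open>By commutativity of K both parities give the same product, and what remains is
      the counit law of C.\<close>
    have "tensor_lift K ?k (\<lambda>x y. counit T (var x p) \<otimes>\<^bsub>parity_algebra i ?k\<^esub> counit T (var y q)) (comult C c) =
      tensor_lift K ?k (\<lambda>x y. counit C x \<odot>\<^bsub>?k\<^esub> counit C y) (comult C c)"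
    proof (rule sweedler_cong[OF C module_self c])
      show "bilinear C C ?k (\<lambda>x y. counit C x \<odot>\<^bsub>?k\<^esub> counit C y)"
        by (assumption | rule C module_self linear_maps_closed[OF coalgebra_counit_linear[OF C]] multilinear)+
      show "counit T (var x p) \<otimes>\<^bsub>parity_algebra i ?k\<^esub> counit T (var y q) = counit C x \<odot>\<^bsub>?k\<^esub> counit C y"
        if "x \<in> carrier C" "y \<in> carrier C" for x y
        using that by (simp add: takeuchi_counit_var parity_algebra_def) (simp add: self_module_def cl m_comm)
    qed
    also have "\<dots> = counit C c"
      by (rule sweedler_counit_left[OF C module_self coalgebra_counit_linear[OF C] c])
    also have "\<dots> = counit C c \<odot>\<^bsub>?k\<^esub> \<one>\<^bsub>?k\<^esub>"
      by (simp add: self_module_def cl c)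
    finally have "counit T s = \<zero>\<^bsub>?k\<^esub>"
      unfolding s alg_hom_takeuchi_rel[OF unital_algebra_self_module E c]
      by (simp only: minus_self[OF module_self smult_closed[OF module_self cl[OF c] algebra_one_closed[OF unital_algebra_self_module]]])
    then show "counit T s = \<zero>"
      by (simp add: self_module_def)
  qed
  show "tproj (antipode T s) = \<zero>\<^bsub>TQ\<^esub>"
  proof -
    have \<pi>o: "tproj \<in> alg_homs (opposite T) (opposite TQ)"
      using \<pi> by (simp add: alg_homs_opposite)
    note S = alg_homs_comp[OF \<pi>o prehopf_antipode[OF preT]]
    have pq': "(Suc p, Suc q) = (Suc i, Suc (Suc i)) \<or> (Suc p, Suc q) = (Suc (Suc i), Suc i)"
      using pq by auto
    have "tensor_lift K TQ (\<lambda>x y. tproj (antipode T (var x p)) \<otimes>\<^bsub>parity_algebra (Suc i) TQ\<^esub> tproj (antipode T (var y q))) (comult C c) =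
      tensor_lift K TQ (\<lambda>x y. free_hopf_var x (Suc p) \<otimes>\<^bsub>parity_algebra (Suc i) TQ\<^esub> free_hopf_var y (Suc q)) (comult C c)"
      by (rule sweedler_cong[OF C MQ c var_parity_bilinear[OF UQ w w]]) (simp add: takeuchi_antipode_var v)
    also have "\<dots> = counit C c \<odot>\<^bsub>TQ\<^esub> \<one>\<^bsub>TQ\<^esub>"
      by (rule rel[OF c pq'])
    finally have "tproj (antipode T s) = counit C c \<odot>\<^bsub>opposite TQ\<^esub> \<one>\<^bsub>opposite TQ\<^esub> \<ominus>\<^bsub>opposite TQ\<^esub> counit C c \<odot>\<^bsub>opposite TQ\<^esub> \<one>\<^bsub>opposite TQ\<^esub>"
      unfolding s alg_hom_takeuchi_rel[OF unital_algebra_opposite[OF UQ] S c] by simp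
    also have "\<dots> = \<zero>\<^bsub>opposite TQ\<^esub>"
      by (rule minus_self[OF module_unital_algebra[OF unital_algebra_opposite[OF UQ]]])
        (simp add: smult_closed[OF MQ] algebra_one_closed[OF UQ] coalgebra_counit_closed[OF C c])
    finally show "tproj (antipode T s) = \<zero>\<^bsub>TQ\<^esub>"
      by simp
  qed
qed

lemmas takeuchi_quot_hopf = prehopf_quot_hopf[OF prehopf_takeuchi_tensor_algebra takeuchi_rels_subset
  takeuchi_rels_comult takeuchi_rels_counit takeuchi_rels_antipode]

lemma free_hopf_structure:
  shows prehopf_free_hopf: "prehopf HC"
    and free_hopf_var_linear: "(\<lambda>c. free_hopf_var c i) \<in> linear_maps K C HC"
    and free_hopf_comult_var: "c \<in> carrier C \<Longrightarrow> comult HC (free_hopf_var c i) =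
      tensor_lift K (tensor K HC HC) (\<lambda>x y. parity_tensor HC i (free_hopf_var x i) (free_hopf_var y i)) (comult C c)"
    and free_hopf_counit_var: "c \<in> carrier C \<Longrightarrow> counit HC (free_hopf_var c i) = counit C c"
    and free_hopf_antipode_var: "c \<in> carrier C \<Longrightarrow> antipode HC (free_hopf_var c i) = free_hopf_var c (Suc i)"
    and free_hopf_relation: "\<lbrakk>c \<in> carrier C; (p, q) = (i, Suc i) \<or> (p, q) = (Suc i, i)\<rbrakk> \<Longrightarrow>
      tensor_lift K HC (\<lambda>x y. free_hopf_var x p \<otimes>\<^bsub>parity_algebra i HC\<^esub> free_hopf_var y q) (comult C c) =
      counit C c \<odot>\<^bsub>HC\<^esub> \<one>\<^bsub>HC\<^esub>"
proof -
  note pre = takeuchi_quot_hopf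
  note w = free_hopf_var_linear_quot and v = free_hopf_var_eq
  have pT: "parity_tensor HC = parity_tensor TQ"
    by (intro ext) (simp add: parity_tensor_def free_hopf_eq)
  \<comment> \<open>The two algebras have different record types, so only their multiplications can
    be equated.\<close>
  have pA: "mult (parity_algebra i HC) = mult (parity_algebra i TQ)" for i
    by (intro ext) (simp add: parity_algebra_def free_hopf_eq)
  show "prehopf HC"
    unfolding free_hopf_eq by (rule pre(1))
  show "(\<lambda>c. free_hopf_var c i) \<in> linear_maps K C HC"
    using w by (simp add: free_hopf_eq)
  show "comult HC (free_hopf_var c i) =
      tensor_lift K (tensor K HC HC) (\<lambda>x y. parity_tensor HC i (free_hopf_var x i) (free_hopf_var y i)) (comult C c)"
    if "c \<in> carrier C"
    unfolding pT
    unfolding free_hopf_eq quot_hopf_simps takeuchi_comult_quot_var[OF that, symmetric] v[of c]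
    by (rule pre(2)) (use linear_maps_closed[OF var_linear that] in auto)
  show "counit HC (free_hopf_var c i) = counit C c" if "c \<in> carrier C"
    unfolding free_hopf_eq takeuchi_counit_var[OF that, of i, symmetric] v[of c]
    by (rule pre(3)) (use linear_maps_closed[OF var_linear that] in auto)
  show "antipode HC (free_hopf_var c i) = free_hopf_var c (Suc i)" if "c \<in> carrier C"
    unfolding free_hopf_eq v takeuchi_antipode_var[OF that, symmetric]
    by (rule pre(4)) (use linear_maps_closed[OF var_linear that] in auto)
  show "tensor_lift K HC (\<lambda>x y. free_hopf_var x p \<otimes>\<^bsub>parity_algebra i HC\<^esub> free_hopf_var y q) (comult C c) =
      counit C c \<odot>\<^bsub>HC\<^esub> \<one>\<^bsub>HC\<^esub>" if "c \<in> carrier C" "(p, q) = (i, Suc i) \<or> (p, q) = (Suc i, i)"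
    unfolding pA
    unfolding free_hopf_eq tensor_lift_quot_hopf takeuchi_quot_relation[OF that] by (simp add: free_hopf_eq)
qed

section \<open>Universal property of the free Hopf algebra\<close>

lemma free_hopf_incl_eq: "free_hopf_incl K C c = free_hopf_var c 0"
  by (simp add: free_hopf_incl_def free_hopf_var_def)

text \<open>For algebra maps agreement on C alone would not do: as an algebra H(C) is generated by
  the variables of all degrees.\<close>

lemma free_hopf_hom_eq:
  assumes Y: "unital_algebra K Y" and h: "h \<in> alg_homs HC Y" and h': "h' \<in> alg_homs HC Y"
    and eq: "\<And>c i. c \<in> carrier C \<Longrightarrow> h (free_hopf_var c i) = h' (free_hopf_var c i)"
    and u: "u \<in> carrier HC"
  shows "h u = h' u"
proof -
  let ?I = "Idl\<^bsub>T\<^esub> takeuchi_rels"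
  let ?\<pi> = "\<lambda>x. ?I +>\<^bsub>T\<^esub> x"
  have \<pi>: "?\<pi> \<in> alg_homs T HC"
    using quot_module_proj_alg_hom[OF unital_T ideal_Idl[OF unital_T takeuchi_rels_subset]]
    by (simp add: free_hopf_eq)
  have hT: "alg_homs T Y = alg_homs (presented_algebra K gens rels) Y" for Y :: "('k, 'y, 'z) module_scheme"
    by (simp add: takeuchi_tensor_algebra_eq)
  have "h (?\<pi> x) = h' (?\<pi> x)" if x: "x \<in> carrier T" for x
  proof (rule presented_algebra_hom_eq[OF takeuchi_rels_closed Y])
    show "(\<lambda>x. h (?\<pi> x)) \<in> alg_homs (presented_algebra K gens rels) Y"
      "(\<lambda>x. h' (?\<pi> x)) \<in> alg_homs (presented_algebra K gens rels) Y"
      unfolding hT[symmetric] by (rule alg_homs_comp[OF h \<pi>], rule alg_homs_comp[OF h' \<pi>])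
    show "x \<in> carrier (presented_algebra K gens rels)"
      using x by (simp add: takeuchi_tensor_algebra_eq)
    show "h (?\<pi> (generator K gens rels g)) = h' (?\<pi> (generator K gens rels g))" if "g \<in> gens" for g
      using that eq by (auto simp: takeuchi_gens_def free_hopf_var_def takeuchi_ideal_eq takeuchi_var_def)
  qed
  then show ?thesis
    using u by (auto simp: free_hopf_eq quot_module_carrier)
qed

text \<open>The map is first built on the tensor algebra, where it already respects coproduct,
  counit and S. The defining relations, being the antipode identities for S, are then carried to
  antipode identities of H, which hold.\<close>

lemma free_hopf_lift:
  fixes H :: "('k, 'h, 'p) hopf_scheme"
  assumes H: "hopf_algebra K H" and f: "f \<in> coalgebra_hom K C H"
  obtains t where "t \<in> hopf_hom K HC H"
    and "\<And>c i. c \<in> carrier C \<Longrightarrow> t (free_hopf_var c i) = (antipode H ^^ i) (f c)"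
proof -
  let ?P = "presented_algebra K gens rels"
  let ?g = "\<lambda>(c, i). (antipode H ^^ i) (f c)"
  note CH = hopf_algebra_coalgebra[OF H] and UH = hopf_algebra_unital[OF H] and preH = hopf_algebra_prehopf[OF H]
  note MH = module_unital_algebra[OF UH]
  let ?HH = "tensor K H H"
  note MHH = module_tensor[OF MH MH]
  note preT = prehopf_takeuchi_tensor_algebra
  note S = hopf_algebra.antipode_linear[OF H]
  have fl: "f \<in> linear_maps K C H" and fc: "\<And>c. c \<in> carrier C \<Longrightarrow> comult H (f c) = tensor_map K H H f f (comult C c)"
    and fe: "\<And>c. c \<in> carrier C \<Longrightarrow> counit H (f c) = counit C c"
    using f by (auto simp: coalgebra_hom_def)
  have gl: "(\<lambda>c. ?g (c, i)) \<in> linear_maps K C H" for i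
    unfolding prod.case
  proof (induction i)
    case (Suc i)
    show ?case
      using linear_maps_comp[OF S Suc] by simp
  qed (simp add: fl)
  have gcl: "(antipode H ^^ i) (f c) \<in> carrier H" if "c \<in> carrier C" for c i
    using linear_maps_closed[OF gl that, of i] by simp
  have gc: "?g x \<in> carrier H" if "x \<in> gens" for x
    using that gcl by (auto simp: takeuchi_gens_def)
  let ?t = "coset_lift (alg_ext K H ?g)"
  have ta: "?t \<in> alg_homs ?P H"
    by (rule presented_algebra_lift(1)[OF takeuchi_rels_closed UH gc alg_ext_takeuchi_rels[OF UH gl]])
  have tgen: "?t (generator K gens rels x) = ?g x" if "x \<in> gens" for x
    by (rule presented_algebra_lift(2)[OF takeuchi_rels_closed UH gc alg_ext_takeuchi_rels[OF UH gl] that])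
  have tv: "?t (var c i) = (antipode H ^^ i) (f c)" if "c \<in> carrier C" for c i
    using tgen[of "(c, i)"] that by (simp add: takeuchi_var_def takeuchi_gens_def)
  have pt: "bilinear H H ?HH (parity_tensor H i)" for i
    by (rule parity_tensor_bilinear[OF MH])
  have bg: "bilinear C C ?HH (\<lambda>x y. parity_tensor H i ((antipode H ^^ j) (f x)) ((antipode H ^^ j) (f y)))" for i j
    by (intro bilinearI bilinear_left[OF pt gl[of j, unfolded prod.case] gcl] bilinear_right[OF pt gl[of j, unfolded prod.case] gcl])
  \<comment> \<open>Each further antipode reverses the coproduct once more, in step with the
    alternation of the coproduct of \<open>V\<^sub>i\<close>.\<close>
  have comult_g: "comult H ((antipode H ^^ i) (f c)) =
      tensor_lift K ?HH (\<lambda>x y. parity_tensor H i ((antipode H ^^ i) (f x)) ((antipode H ^^ i) (f y))) (comult C c)"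
    if c: "c \<in> carrier C" for c i
  proof (induction i)
    case 0
    show ?case
      by (simp add: fc[OF c] tensor_map_def parity_tensor_def)
  next
    case (Suc i)
    let ?s = "\<lambda>x y. pure_tensor K H H (antipode H y) (antipode H x)"
    note p = pure_tensor_bilinear[OF MH MH]
    have bs: "bilinear H H ?HH ?s"
      by (intro bilinearI bilinear_left[OF p S] bilinear_right[OF p S] linear_maps_closed[OF S])
    note ls = tensor_lift_linear[OF MH MH MHH bs]
    have "comult H ((antipode H ^^ Suc i) (f c)) = tensor_lift K ?HH ?s (comult H ((antipode H ^^ i) (f c)))"
      by (simp add: hopf_comult_antipode[OF H gcl[OF c]])
    also have "\<dots> = tensor_lift K ?HH (\<lambda>x y. tensor_lift K ?HH ?s
        (parity_tensor H i ((antipode H ^^ i) (f x)) ((antipode H ^^ i) (f y)))) (comult C c)"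
      unfolding Suc by (rule linear_sweedler[OF C MHH MHH c bg ls])
    also have "\<dots> = tensor_lift K ?HH (\<lambda>x y. parity_tensor H (Suc i) ((antipode H ^^ Suc i) (f x)) ((antipode H ^^ Suc i) (f y))) (comult C c)"
      by (rule sweedler_cong[OF C MHH c bg]) (simp add: parity_tensor_def tensor_lift_pure[OF MH MH MHH bs] gcl)
    finally show ?case .
  qed
  have Tpres: "linear_maps K T H = linear_maps K ?P H"
    by (simp add: takeuchi_tensor_algebra_eq)
  have tl: "?t \<in> linear_maps K T H"
    using alg_homs_linear[OF ta] by (simp add: Tpres)
  have tt: "tensor_map K H H ?t ?t (comult T (var c i)) = comult H (?t (var c i))" if c: "c \<in> carrier C" for c i
  proof -
    note ptT = parity_tensor_bilinear[OF module_T]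
    note lin = var_rules bilinear_left[OF ptT] bilinear_right[OF ptT] bilinear_closed[OF ptT]
    have "tensor_map K H H ?t ?t (comult T (var c i)) =
      tensor_lift K ?HH (\<lambda>x y. tensor_map K H H ?t ?t (parity_tensor T i (var x i) (var y i))) (comult C c)"
      unfolding takeuchi_comult_var[OF c]
      by (rule linear_sweedler[OF C module_tensor[OF module_T module_T] MHH c _ tensor_map_linear[OF module_T module_T MH MH tl tl]])
        (assumption | rule lin multilinear module_tensor)+
    also have "\<dots> = tensor_lift K ?HH (\<lambda>x y. parity_tensor H i ((antipode H ^^ i) (f x)) ((antipode H ^^ i) (f y))) (comult C c)"
      by (rule sweedler_cong[OF C MHH c bg])
        (simp add: parity_tensor_def tensor_map_pure[OF module_T module_T MH MH tl tl] linear_maps_closed[OF var_linear] tv)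
    also have "\<dots> = comult H (?t (var c i))"
      by (simp add: tv[OF c] comult_g[OF c])
    finally show ?thesis .
  qed
  have ce: "counit H ((antipode H ^^ i) (f c)) = counit C c" if "c \<in> carrier C" for c i
    by (induction i) (simp_all add: fe that hopf_counit_antipode[OF H gcl[OF that]])
  \<comment> \<open>Membership in \<open>hopf_hom\<close> asks only for compatibility with the
    operations, so it makes sense for the tensor algebra, whose \<open>antipode\<close> is just the
    map S.\<close>
  have th: "?t \<in> hopf_hom K T H"
    unfolding takeuchi_tensor_algebra_eq
  proof (rule presented_hopf_hom[OF takeuchi_rels_closed _ preH ta]; (fold takeuchi_tensor_algebra_eq)?)
    show "prehopf T"
      by (rule preT)
    fix x assume "x \<in> gens"
    then obtain c i where x: "x = (c, i)" "c \<in> carrier C"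
      by (auto simp: takeuchi_gens_def)
    have g: "generator K gens rels x = var c i"
      by (simp add: x takeuchi_var_def)
    show "comult H (?t (generator K gens rels x)) = tensor_map K H H ?t ?t (comult T (generator K gens rels x))"
      unfolding g by (rule tt[OF x(2), symmetric])
    show "counit H (?t (generator K gens rels x)) = counit T (generator K gens rels x)"
      unfolding g by (simp add: tv takeuchi_counit_var x(2) ce)
    show "?t (antipode T (generator K gens rels x)) = antipode H (?t (generator K gens rels x))"
      unfolding g by (simp add: tv takeuchi_antipode_var x(2))
  qed
  note taT = hopf_homD(1)[OF th]
  \<comment> \<open>Used below with m the product after S has been applied to one factor, and with
    m' the same in H.\<close>
  have conv: "?t (tensor_lift K T m (comult T z)) = tensor_lift K H m' (comult H (?t z))"
    if z: "z \<in> carrier T" and m: "bilinear T T T m" and m': "bilinear H H H m'"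
      and eq: "\<And>x y. \<lbrakk>x \<in> carrier T; y \<in> carrier T\<rbrakk> \<Longrightarrow> ?t (m x y) = m' (?t x) (?t y)" for z m m'
  proof -
    note cz = alg_homs_closed[OF prehopf_comult[OF preT] z]
    have b: "bilinear T T H (\<lambda>x y. m' (?t x) (?t y))"
      by (intro bilinearI bilinear_left[OF m' tl linear_maps_closed[OF tl]] bilinear_right[OF m' tl linear_maps_closed[OF tl]])
    have "?t (tensor_lift K T m (comult T z)) = tensor_lift K H (\<lambda>x y. ?t (m x y)) (comult T z)"
      by (rule linear_tensor_lift[OF module_T module_T module_T MH m tl cz])
    also have "\<dots> = tensor_lift K H (\<lambda>x y. m' (?t x) (?t y)) (comult T z)"
      by (rule tensor_lift_cong[OF module_T module_T MH b eq cz])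
    also have "\<dots> = tensor_lift K H m' (comult H (?t z))"
      unfolding hopf_homD(2)[OF th z]
      by (rule tensor_lift_tensor_map[OF module_T module_T MH MH MH tl tl m' cz, symmetric])
    finally show ?thesis .
  qed
  have kill: "?t s = \<zero>\<^bsub>H\<^esub>" if "s \<in> takeuchi_rels" for s
  proof -
    interpret T: unital_algebra K T by (rule unital_T)
    have ST: "antipode T \<in> linear_maps K T T"
      using alg_homs_linear[OF prehopf_antipode[OF preT]] by simp
    note lin = UH MH S linear_maps_comp[OF S] linear_maps_closed[OF S]
      unital_T module_T ST linear_maps_comp[OF ST] linear_maps_closed[OF ST]
    have b: "bilinear T T T (\<lambda>x y. x \<otimes>\<^bsub>T\<^esub> antipode T y)" "bilinear T T T (\<lambda>x y. antipode T x \<otimes>\<^bsub>T\<^esub> y)"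
      "bilinear H H H (\<lambda>x y. x \<otimes>\<^bsub>H\<^esub> antipode H y)" "bilinear H H H (\<lambda>x y. antipode H x \<otimes>\<^bsub>H\<^esub> y)"
      by (assumption | rule lin multilinear)+
    obtain c i where c: "c \<in> carrier C"
      and s: "s \<in> {takeuchi_rel c i i (Suc i), takeuchi_rel c i (Suc i) i}"
      using \<open>s \<in> takeuchi_rels\<close> unfolding takeuchi_rels_def by blast
    note vc = linear_maps_closed[OF var_linear c, of i]
    note tc = alg_homs_closed[OF taT vc]
    have "?t (tensor_lift K T (\<lambda>x y. x \<otimes>\<^bsub>T\<^esub> antipode T y) (comult T (var c i))) = counit H (?t (var c i)) \<odot>\<^bsub>H\<^esub> \<one>\<^bsub>H\<^esub>"
      by (subst conv[OF vc b(1,3)])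
        (simp_all add: alg_homs_mult[OF taT] linear_maps_closed[OF ST] hopf_homD(4)[OF th] hopf_algebra.antipode_right[OF H tc])
    moreover have "?t (tensor_lift K T (\<lambda>x y. antipode T x \<otimes>\<^bsub>T\<^esub> y) (comult T (var c i))) = counit H (?t (var c i)) \<odot>\<^bsub>H\<^esub> \<one>\<^bsub>H\<^esub>"
      by (subst conv[OF vc b(2,4)])
        (simp_all add: alg_homs_mult[OF taT] linear_maps_closed[OF ST] hopf_homD(4)[OF th] hopf_algebra.antipode_left[OF H tc])
    moreover have "tensor_lift K T g (comult T (var c i)) \<in> carrier T" if "bilinear T T T g" for g
      by (rule linear_maps_closed[OF tensor_lift_linear[OF module_T module_T module_T that] alg_homs_closed[OF prehopf_comult[OF preT] vc]])
    moreover have "counit T (var c i) \<in> carrier K"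
      using coalgebra_counit_closed[OF C c] by (simp add: takeuchi_counit_var c)
    ultimately show ?thesis
      \<comment> \<open>Passing back from the degree form of the relations to the antipode
        identities spares a case distinction on parity.\<close>
      using s unfolding takeuchi_rel_pair[OF c, symmetric]
      by (auto simp: b alg_homs_minus[OF unital_T UH taT] alg_homs_smult[OF taT] alg_homs_one[OF taT] hopf_homD(3)[OF th vc]
        minus_self[OF MH] smult_closed[OF MH] algebra_one_closed[OF UH])
  qed
  note lift = quot_hopf_hom[OF preT preH takeuchi_rels_subset takeuchi_quot_hopf(2,3,4) th kill]
  show thesis
  proof (rule that)
    show "coset_lift ?t \<in> hopf_hom K HC H"
      unfolding free_hopf_eq by (rule lift(1))
    show "coset_lift ?t (free_hopf_var c i) = (antipode H ^^ i) (f c)" if c: "c \<in> carrier C" for c i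
      unfolding free_hopf_var_eq tv[OF c, symmetric]
      by (rule lift(2)) (use linear_maps_closed[OF var_linear c] in auto)
  qed
qed

end

section \<open>The Hopf algebra \<open>H(C, A)\<close>\<close>

locale takeuchi_module_coalgebra = takeuchi K C
  for K :: "('k, 'r) ring_scheme" (structure) and C :: "('k, 'c, 'm) coalg_scheme" +
  fixes A :: "('k, 'a, 'n) hopf_scheme" and act :: "'c \<Rightarrow> 'a \<Rightarrow> 'c"
  assumes A: "hopf_algebra K A" and act: "module_coalgebra K A C act"
begin

abbreviation (input) "P \<equiv> hopf_coprod K HC A"
abbreviation (input) "inl \<equiv> coprod_inl K HC A"
abbreviation (input) "inr \<equiv> coprod_inr K HC A"

definition HCA_rels :: "('k, 'c, 'a) HCA_pre set"
  where "HCA_rels = {inl (free_hopf_var (act c a) 0) \<ominus>\<^bsub>P\<^esub> inl (free_hopf_var c 0) \<otimes>\<^bsub>P\<^esub> inr a | c a.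
    c \<in> carrier C \<and> a \<in> carrier A}"

abbreviation (input) "HI \<equiv> Idl\<^bsub>P\<^esub> HCA_rels"
abbreviation (input) "HQ \<equiv> quot_module P HI"
abbreviation (input) "hproj \<equiv> (\<lambda>x. HI +>\<^bsub>P\<^esub> x)"

lemma HCA_eq: "HCA K C A act = quot_hopf K P HI"
  by (simp add: HCA_def HCA_ideal_def Let_def HCA_rels_def free_hopf_incl_eq)

lemma HCA_ideal_eq: "HCA_ideal K C A act = HI"
  by (simp add: HCA_ideal_def Let_def HCA_rels_def free_hopf_incl_eq)

lemmas P_structure = hopf_coprod_structure[OF prehopf_free_hopf hopf_algebra_prehopf[OF A]]

lemma coalgebra_A: "coalgebra K A"
  by (rule hopf_algebra_coalgebra[OF A])

lemma act_bilinear: "bilinear C A C act"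
proof -
  interpret M: module_coalgebra K A C act by (rule act)
  show ?thesis
    by (rule bilinearI; rule linear_mapsI)
      (simp_all add: M.act_closed M.act_add_left M.act_add_right M.act_smult_left M.act_smult_right)
qed

lemma act_comult: "\<lbrakk>c \<in> carrier C; a \<in> carrier A\<rbrakk> \<Longrightarrow>
  comult C (act c a) = tensor_lift K (tensor K C C) (\<lambda>c1 c2. tensor_lift K (tensor K C C)
    (\<lambda>a1 a2. pure_tensor K C C (act c1 a1) (act c2 a2)) (comult A a)) (comult C c)"
  by (rule module_coalgebra.act_comult[OF act])

lemma act_counit: "\<lbrakk>c \<in> carrier C; a \<in> carrier A\<rbrakk> \<Longrightarrow> counit C (act c a) = counit C c \<otimes> counit A a"
  by (rule module_coalgebra.act_counit[OF act])

lemma unital_P: "unital_algebra K P"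
  by (rule prehopf_unital[OF P_structure(1)])

lemma HC_closed: "c \<in> carrier C \<Longrightarrow> free_hopf_var c i \<in> carrier HC"
  by (rule linear_maps_closed[OF free_hopf_var_linear])

section \<open>The quotient that defines H(C, A)\<close>

lemma HCA_rels_subset: "HCA_rels \<subseteq> carrier P"
proof -
  interpret P: unital_algebra K P by (rule unital_P)
  show ?thesis
    unfolding HCA_rels_def
    by (auto intro!: P.minus_closed P.m_closed alg_homs_closed[OF P_structure(2)] alg_homs_closed[OF P_structure(3)]
      HC_closed bilinear_closed[OF act_bilinear])
qed

lemma unital_HQ: "unital_algebra K HQ"
  by (rule unital_algebra_quot_module[OF unital_P ideal_Idl[OF unital_P HCA_rels_subset]])

lemma hproj: "hproj \<in> alg_homs P HQ"
  by (rule quot_module_proj_alg_hom[OF unital_P ideal_Idl[OF unital_P HCA_rels_subset]])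

lemma hproj_inl: "(\<lambda>x. hproj (inl x)) \<in> alg_homs HC HQ"
  by (rule alg_homs_comp[OF hproj P_structure(2)])

lemma hproj_inr: "(\<lambda>x. hproj (inr x)) \<in> alg_homs A HQ"
  by (rule alg_homs_comp[OF hproj P_structure(3)])

lemma hproj_var_linear: "(\<lambda>c. hproj (inl (free_hopf_var c i))) \<in> linear_maps K C HQ"
  by (rule linear_maps_comp[OF alg_homs_linear[OF hproj_inl] free_hopf_var_linear])

lemma act_closed: "\<lbrakk>c \<in> carrier C; a \<in> carrier A\<rbrakk> \<Longrightarrow> act c a \<in> carrier C"
  by (rule bilinear_closed[OF act_bilinear])

lemma inl_var_closed: "c \<in> carrier C \<Longrightarrow> inl (free_hopf_var c i) \<in> carrier P"
  by (rule alg_homs_closed[OF P_structure(2) HC_closed])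

lemma inr_closed: "a \<in> carrier A \<Longrightarrow> inr a \<in> carrier P"
  by (rule alg_homs_closed[OF P_structure(3)])

lemma alg_hom_HCA_rel:
  assumes Y: "unital_algebra K Y" and h: "h \<in> alg_homs P Y" and "c \<in> carrier C" "a \<in> carrier A"
  shows "h (inl (free_hopf_var (act c a) 0) \<ominus>\<^bsub>P\<^esub> inl (free_hopf_var c 0) \<otimes>\<^bsub>P\<^esub> inr a) =
    h (inl (free_hopf_var (act c a) 0)) \<ominus>\<^bsub>Y\<^esub> h (inl (free_hopf_var c 0)) \<otimes>\<^bsub>Y\<^esub> h (inr a)"
  using assms by (simp add: alg_homs_minus[OF unital_P Y h] alg_homs_mult[OF h] inl_var_closed inr_closed act_closed
    algebra_mult_closed[OF unital_P])

lemma hproj_act: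
  assumes "c \<in> carrier C" "a \<in> carrier A"
  shows "hproj (inl (free_hopf_var (act c a) 0)) = hproj (inl (free_hopf_var c 0)) \<otimes>\<^bsub>HQ\<^esub> hproj (inr a)"
proof (rule minus_eq_zeroD[OF module_unital_algebra[OF unital_HQ]])
  have "inl (free_hopf_var (act c a) 0) \<ominus>\<^bsub>P\<^esub> inl (free_hopf_var c 0) \<otimes>\<^bsub>P\<^esub> inr a \<in> HCA_rels"
    unfolding HCA_rels_def using assms by blast
  then have "hproj (inl (free_hopf_var (act c a) 0) \<ominus>\<^bsub>P\<^esub> inl (free_hopf_var c 0) \<otimes>\<^bsub>P\<^esub> inr a) = \<zero>\<^bsub>HQ\<^esub>"
    by (rule Idl_coset_eq_zero[OF unital_P HCA_rels_subset])
  then show "hproj (inl (free_hopf_var (act c a) 0)) \<ominus>\<^bsub>HQ\<^esub> hproj (inl (free_hopf_var c 0)) \<otimes>\<^bsub>HQ\<^esub> hproj (inr a) = \<zero>\<^bsub>HQ\<^esub>"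
    unfolding alg_hom_HCA_rel[OF unital_HQ hproj assms] .
qed (use assms in \<open>simp_all add: alg_homs_closed[OF hproj] inl_var_closed inr_closed act_closed algebra_mult_closed[OF unital_HQ]\<close>)

text \<open>The map from C to the quotient respects coproducts, as a composite of maps that do;
  degree 0 is even, so no factors are exchanged.\<close>

lemma hproj_comult_var:
  assumes c: "c \<in> carrier C"
  shows "tensor_map K HQ HQ hproj hproj (comult P (inl (free_hopf_var c 0))) =
    tensor_lift K (tensor K HQ HQ) (\<lambda>x y. pure_tensor K HQ HQ (hproj (inl (free_hopf_var x 0))) (hproj (inl (free_hopf_var y 0)))) (comult C c)"
proof -
  note MHC = module_unital_algebra[OF prehopf_unital[OF prehopf_free_hopf]]
    and MP = module_unital_algebra[OF unital_P] and MQ = module_unital_algebra[OF unital_HQ]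
  note MY = module_tensor[OF MQ MQ]
  note il = alg_homs_linear[OF P_structure(2)] and \<pi>l = alg_homs_linear[OF hproj] and w = hproj_var_linear
    and \<pi>i = alg_homs_linear[OF hproj_inl]
  note pHC = pure_tensor_bilinear[OF MHC MHC] and pQ = pure_tensor_bilinear[OF MQ MQ]
  note fv = free_hopf_var_linear
  note lin = C MHC MP MQ MY fv linear_maps_comp[OF fv] linear_maps_closed[OF fv] w linear_maps_comp[OF w] linear_maps_closed[OF w]
    bilinear_left[OF pHC] bilinear_right[OF pHC] bilinear_closed[OF pHC]
    bilinear_left[OF pQ] bilinear_right[OF pQ] bilinear_closed[OF pQ]
  note v = HC_closed[OF c, of 0]
  have cm: "comult HC (free_hopf_var c 0) \<in> carrier (tensor K HC HC)"
    by (rule alg_homs_closed[OF prehopf_comult[OF prehopf_free_hopf] v])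
  let ?g = "\<lambda>x y. pure_tensor K HQ HQ (hproj (inl x)) (hproj (inl y))"
  have bg: "bilinear HC HC (tensor K HQ HQ) ?g"
    by (rule pure_tensor_maps_bilinear[OF MQ MQ \<pi>i \<pi>i])
  have "tensor_map K HQ HQ hproj hproj (comult P (inl (free_hopf_var c 0))) =
    tensor_lift K (tensor K HQ HQ) (\<lambda>x y. pure_tensor K HQ HQ (hproj x) (hproj y))
      (tensor_map K P P inl inl (comult HC (free_hopf_var c 0)))"
    unfolding P_structure(4)[OF v] tensor_map_def[of K HQ HQ] ..
  also have "\<dots> = tensor_lift K (tensor K HQ HQ) ?g (comult HC (free_hopf_var c 0))"
    by (rule tensor_lift_tensor_map[OF MHC MHC MP MP MY il il pure_tensor_maps_bilinear[OF MQ MQ \<pi>l \<pi>l] cm])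
  also have "\<dots> = tensor_lift K (tensor K HQ HQ) (\<lambda>x y. tensor_lift K (tensor K HQ HQ) ?g
      (pure_tensor K HC HC (free_hopf_var x 0) (free_hopf_var y 0))) (comult C c)"
    unfolding free_hopf_comult_var[OF c] parity_tensor_def
    by (simp, rule linear_sweedler[OF C module_tensor[OF MHC MHC] MY c _ tensor_lift_linear[OF MHC MHC MY bg]])
      (assumption | rule lin multilinear)+
  also have "\<dots> = tensor_lift K (tensor K HQ HQ) (\<lambda>x y. ?g (free_hopf_var x 0) (free_hopf_var y 0)) (comult C c)"
    by (rule sweedler_cong[OF C MY c], (assumption | rule lin multilinear)+)
      (simp add: tensor_lift_pure[OF MHC MHC MY bg] HC_closed)
  finally show ?thesis .
qed

text \<open>By the module coalgebra axiom the coproduct of i(c a) is the double sum of i(c1 a1)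
  \<otimes> i(c2 a2). In the quotient each factor splits by the relation itself, and the sum becomes
  the product of the coproducts of i(c) and j(a).\<close>

lemma HCA_rels_comult:
  assumes s: "s \<in> HCA_rels"
  shows "tensor_map K HQ HQ hproj hproj (comult P s) = \<zero>\<^bsub>tensor K HQ HQ\<^esub>"
proof -
  let ?Y = "tensor K HQ HQ"
  obtain c a where c: "c \<in> carrier C" and a: "a \<in> carrier A"
    and s: "s = inl (free_hopf_var (act c a) 0) \<ominus>\<^bsub>P\<^esub> inl (free_hopf_var c 0) \<otimes>\<^bsub>P\<^esub> inr a"
    using s unfolding HCA_rels_def by blast
  note UQ = unital_HQ and UA = hopf_algebra_unital[OF A]
  note UY = unital_algebra_tensor[OF UQ UQ]
  note MA = module_unital_algebra[OF UA] and MQ = module_unital_algebra[OF UQ]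
  note MY = module_tensor[OF MQ MQ] and MP = module_unital_algebra[OF unital_P]
  note CA = coalgebra_A
  let ?D = "\<lambda>x. tensor_map K HQ HQ hproj hproj (comult P x)"
  have D: "?D \<in> alg_homs P ?Y"
    by (rule alg_homs_comp[OF tensor_map_alg_hom[OF unital_P unital_P UQ UQ hproj hproj] prehopf_comult[OF P_structure(1)]])
  note w = hproj_var_linear and j = alg_homs_linear[OF hproj_inr] and pQ = pure_tensor_bilinear[OF MQ MQ]
  let ?i = "\<lambda>c. hproj (inl (free_hopf_var c 0))" and ?j = "\<lambda>a. hproj (inr a)"
  note lin = C CA MA MQ MY UY UQ w linear_maps_comp[OF w] linear_maps_closed[OF w] j linear_maps_comp[OF j] linear_maps_closed[OF j]
    bilinear_left[OF pQ] bilinear_right[OF pQ] bilinear_closed[OF pQ]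
    bilinear_left[OF act_bilinear] bilinear_right[OF act_bilinear] bilinear_closed[OF act_bilinear]
    bilinear_left[OF act_bilinear linear_maps_id] bilinear_right[OF act_bilinear linear_maps_id]
  have bi: "bilinear C C ?Y (\<lambda>x y. pure_tensor K HQ HQ (?i x) (?i y))"
    by (assumption | rule lin multilinear)+
  have bj: "bilinear A A ?Y (\<lambda>x y. pure_tensor K HQ HQ (?j x) (?j y))"
    by (assumption | rule lin multilinear)+
  have Dj: "?D (inr a) = tensor_lift K ?Y (\<lambda>x y. pure_tensor K HQ HQ (?j x) (?j y)) (comult A a)"
    unfolding P_structure(5)[OF a] tensor_map_def[of K HQ HQ]
    by (rule tensor_lift_tensor_map[OF MA MA MP MP MY alg_homs_linear[OF P_structure(3)] alg_homs_linear[OF P_structure(3)]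
        pure_tensor_maps_bilinear[OF MQ MQ alg_homs_linear[OF hproj] alg_homs_linear[OF hproj]] coalgebra_comult_closed[OF CA a]])
  have "?D (inl (free_hopf_var (act c a) 0)) =
    tensor_lift K ?Y (\<lambda>c1 c2. tensor_lift K ?Y (\<lambda>a1 a2. pure_tensor K HQ HQ (?i (act c1 a1)) (?i (act c2 a2))) (comult A a)) (comult C c)"
    unfolding hproj_comult_var[OF act_closed[OF c a]]
    by (rule sweedler_act[OF C CA MY act_bilinear act_comult[OF c a] bi c a])
  also have "\<dots> = tensor_lift K ?Y (\<lambda>c1 c2. tensor_lift K ?Y (\<lambda>a1 a2.
      pure_tensor K HQ HQ (?i c1) (?i c2) \<otimes>\<^bsub>?Y\<^esub> pure_tensor K HQ HQ (?j a1) (?j a2)) (comult A a)) (comult C c)"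
    by (rule sweedler_cong[OF C MY c], (assumption | rule a lin multilinear)+,
      rule sweedler_cong[OF CA MY a], (assumption | rule a lin multilinear)+,
      simp add: hproj_act pure_tensor_mult[OF UQ UQ] linear_maps_closed[OF w] linear_maps_closed[OF j])
  also have "\<dots> = ?D (inl (free_hopf_var c 0)) \<otimes>\<^bsub>?Y\<^esub> ?D (inr a)"
    unfolding hproj_comult_var[OF c] Dj by (rule sweedler_mult[OF C CA UY bi bj c a, symmetric])
  finally have eq: "?D (inl (free_hopf_var (act c a) 0)) = ?D (inl (free_hopf_var c 0)) \<otimes>\<^bsub>?Y\<^esub> ?D (inr a)" .
  show ?thesis
    unfolding s alg_hom_HCA_rel[OF UY D c a] eq
    by (rule minus_self[OF MY algebra_mult_closed[OF UY]])
      (simp_all add: alg_homs_closed[OF D] inl_var_closed inr_closed c a)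
qed

lemma HCA_rels_counit:
  assumes s: "s \<in> HCA_rels"
  shows "counit P s = \<zero>"
proof -
  obtain c a where c: "c \<in> carrier C" and a: "a \<in> carrier A"
    and s: "s = inl (free_hopf_var (act c a) 0) \<ominus>\<^bsub>P\<^esub> inl (free_hopf_var c 0) \<otimes>\<^bsub>P\<^esub> inr a"
    using s unfolding HCA_rels_def by blast
  note E = prehopf_counit[OF P_structure(1)]
  have "counit P (inl (free_hopf_var (act c a) 0)) = counit P (inl (free_hopf_var c 0)) \<otimes>\<^bsub>self_module K\<^esub> counit P (inr a)"
    using c a by (simp add: P_structure(6,7) HC_closed act_closed free_hopf_counit_var act_counit) (simp add: self_module_def)
  then have "counit P s = \<zero>\<^bsub>self_module K\<^esub>"
    unfolding s alg_hom_HCA_rel[OF unital_algebra_self_module E c a]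
    by (metis minus_self[OF module_self] alg_homs_closed[OF E inl_var_closed[OF act_closed[OF c a]]])
  then show ?thesis
    by (simp add: self_module_def)
qed

text \<open>The claim amounts to i'(c a) = j'(a) i'(c). Takeuchi's relations in degree 0 make i' a
  two-sided convolution inverse of i, and the antipode of A makes j' a right inverse of j, so
  \<open>convolution_inverse_act\<close> applies.\<close>

lemma HCA_rels_antipode:
  assumes s: "s \<in> HCA_rels"
  shows "hproj (antipode P s) = \<zero>\<^bsub>HQ\<^esub>"
proof -
  obtain c a where c: "c \<in> carrier C" and a: "a \<in> carrier A"
    and s: "s = inl (free_hopf_var (act c a) 0) \<ominus>\<^bsub>P\<^esub> inl (free_hopf_var c 0) \<otimes>\<^bsub>P\<^esub> inr a"
    using s unfolding HCA_rels_def by blast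
  note UQ = unital_HQ
  note MQ = module_unital_algebra[OF UQ]
  note UHC = prehopf_unital[OF prehopf_free_hopf]
  note MHC = module_unital_algebra[OF UHC]
  have \<pi>o: "hproj \<in> alg_homs (opposite P) (opposite HQ)"
    using hproj by (simp add: alg_homs_opposite)
  let ?S = "\<lambda>x. hproj (antipode P x)"
  have S: "?S \<in> alg_homs P (opposite HQ)"
    by (rule alg_homs_comp[OF \<pi>o prehopf_antipode[OF P_structure(1)]])
  \<comment> \<open>In H(C) the variable of degree 1 is the antipode of the one of degree 0, so i'
    is i followed by the antipode.\<close>
  let ?i = "\<lambda>c. hproj (inl (free_hopf_var c 0))" and ?i' = "\<lambda>c. hproj (inl (free_hopf_var c 1))"
  let ?j = "\<lambda>a. hproj (inr a)" and ?j' = "\<lambda>a. hproj (inr (antipode A a))"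
  note j = alg_homs_linear[OF hproj_inr] and w = hproj_var_linear
  note SA = hopf_algebra.antipode_linear[OF A]
  have j': "?j' \<in> linear_maps K A HQ"
    by (rule linear_maps_comp[OF j SA])
  have conv: "tensor_lift K HQ (\<lambda>x y. hproj (inl (free_hopf_var x p)) \<otimes>\<^bsub>HQ\<^esub> hproj (inl (free_hopf_var y q))) (comult C c) =
    counit C c \<odot>\<^bsub>HQ\<^esub> \<one>\<^bsub>HQ\<^esub>" if c: "c \<in> carrier C" and pq: "(p, q) = (0, Suc 0) \<or> (p, q) = (Suc 0, 0)" for c p q
  proof -
    note fv = free_hopf_var_linear
    note lin = C UHC MHC UQ MQ fv linear_maps_comp[OF fv] linear_maps_closed[OF fv] w linear_maps_comp[OF w] linear_maps_closed[OF w]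
    have b: "bilinear C C HC (\<lambda>x y. free_hopf_var x p \<otimes>\<^bsub>HC\<^esub> free_hopf_var y q)"
      by (assumption | rule lin multilinear)+
    have "hproj (inl (tensor_lift K HC (\<lambda>x y. free_hopf_var x p \<otimes>\<^bsub>HC\<^esub> free_hopf_var y q) (comult C c))) =
      tensor_lift K HQ (\<lambda>x y. hproj (inl (free_hopf_var x p \<otimes>\<^bsub>HC\<^esub> free_hopf_var y q))) (comult C c)"
      by (rule linear_sweedler[OF C MHC MQ c b alg_homs_linear[OF hproj_inl]])
    also have "\<dots> = tensor_lift K HQ (\<lambda>x y. hproj (inl (free_hopf_var x p)) \<otimes>\<^bsub>HQ\<^esub> hproj (inl (free_hopf_var y q))) (comult C c)"
      by (rule sweedler_cong[OF C MQ c], (assumption | rule lin multilinear)+) (simp add: alg_homs_mult[OF hproj_inl] HC_closed)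
    finally show ?thesis
      using free_hopf_relation[OF c pq] alg_homs_smult[OF hproj_inl coalgebra_counit_closed[OF C c] algebra_one_closed[OF UHC]]
        alg_homs_one[OF hproj_inl]
      by (simp add: parity_algebra_def)
  qed
  have convA: "tensor_lift K HQ (\<lambda>x y. ?j x \<otimes>\<^bsub>HQ\<^esub> ?j' y) (comult A a) = counit A a \<odot>\<^bsub>HQ\<^esub> \<one>\<^bsub>HQ\<^esub>"
    if a: "a \<in> carrier A" for a
  proof -
    note CA = coalgebra_A and UA = hopf_algebra_unital[OF A]
    note MA = module_unital_algebra[OF UA]
    note lin = CA UA MA UQ MQ SA linear_maps_comp[OF SA] linear_maps_closed[OF SA] j linear_maps_comp[OF j] linear_maps_closed[OF j]
    have b: "bilinear A A A (\<lambda>x y. x \<otimes>\<^bsub>A\<^esub> antipode A y)"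
      by (assumption | rule lin multilinear)+
    have "hproj (inr (tensor_lift K A (\<lambda>x y. x \<otimes>\<^bsub>A\<^esub> antipode A y) (comult A a))) =
      tensor_lift K HQ (\<lambda>x y. hproj (inr (x \<otimes>\<^bsub>A\<^esub> antipode A y))) (comult A a)"
      by (rule linear_sweedler[OF CA MA MQ a b j])
    also have "\<dots> = tensor_lift K HQ (\<lambda>x y. ?j x \<otimes>\<^bsub>HQ\<^esub> ?j' y) (comult A a)"
      by (rule sweedler_cong[OF CA MQ a], (assumption | rule lin multilinear)+)
        (simp add: alg_homs_mult[OF hproj_inr] linear_maps_closed[OF SA])
    finally show ?thesis
      using hopf_algebra.antipode_right[OF A a] alg_homs_smult[OF hproj_inr coalgebra_counit_closed[OF CA a] algebra_one_closed[OF UA]]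
        alg_homs_one[OF hproj_inr]
      by simp
  qed
  have main: "?i' (act c a) = ?j' a \<otimes>\<^bsub>HQ\<^esub> ?i' c"
    by (rule convolution_inverse_act[where i = ?i and i' = ?i' and j = ?j and j' = ?j',
          OF C coalgebra_A UQ act_bilinear act_comult act_counit w w j j' hproj_act conv conv convA c a]) simp_all
  have Sv: "?S (inl (free_hopf_var c 0)) = ?i' c" if "c \<in> carrier C" for c
    using that by (simp add: P_structure(8) HC_closed free_hopf_antipode_var)
  have Sa: "?S (inr a) = ?j' a"
    using a by (simp add: P_structure(9))
  have "?S s = ?S (inl (free_hopf_var c 0)) \<otimes>\<^bsub>opposite HQ\<^esub> ?S (inr a) \<ominus>\<^bsub>opposite HQ\<^esub>
      ?S (inl (free_hopf_var c 0)) \<otimes>\<^bsub>opposite HQ\<^esub> ?S (inr a)"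
    unfolding s alg_hom_HCA_rel[OF unital_algebra_opposite[OF UQ] S c a]
    by (simp only: Sv[OF c] Sv[OF act_closed[OF c a]] Sa main opposite_simps)
  also have "\<dots> = \<zero>\<^bsub>opposite HQ\<^esub>"
    by (rule minus_self[OF module_unital_algebra[OF unital_algebra_opposite[OF UQ]] algebra_mult_closed[OF unital_algebra_opposite[OF UQ]]])
      (rule alg_homs_closed[OF S] inl_var_closed inr_closed c a)+
  finally show ?thesis
    by simp
qed

section \<open>Universal property of H(C, A)\<close>

lemmas HCA_structure = prehopf_quot_hopf[OF P_structure(1) HCA_rels_subset HCA_rels_comult HCA_rels_counit HCA_rels_antipode]

text \<open>The hypotheses give agreement in degree 0 only. The antipode takes degree i to degree i
  + 1, so induction reaches all algebra generators that come from H(C).\<close>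

lemma HCA_hom_eq:
  assumes H: "hopf_algebra K H" and t: "t \<in> hopf_hom K (HCA K C A act) H" and t': "t' \<in> hopf_hom K (HCA K C A act) H"
    and C_eq: "\<And>c. c \<in> carrier C \<Longrightarrow>
      t (HCA_iota K C A act (free_hopf_incl K C c)) = t' (HCA_iota K C A act (free_hopf_incl K C c))"
    and A_eq: "\<And>a. a \<in> carrier A \<Longrightarrow> t (HCA_jmath K C A act a) = t' (HCA_jmath K C A act a)"
    and u: "u \<in> carrier (HCA K C A act)"
  shows "t u = t' u"
proof -
  note UH = hopf_algebra_unital[OF H] and UHC = prehopf_unital[OF prehopf_free_hopf]
  have alg: "s \<in> alg_homs HQ H" if "s \<in> hopf_hom K (HCA K C A act) H" for s
    using hopf_homD(1)[OF that] by (simp add: HCA_eq)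
  have step: "s (hproj (inl (free_hopf_var c (Suc i)))) = antipode H (s (hproj (inl (free_hopf_var c i))))"
    if s: "s \<in> hopf_hom K (HCA K C A act) H" and c: "c \<in> carrier C" for s c i
  proof -
    have "hproj (inl (free_hopf_var c (Suc i))) = antipode (quot_hopf K P HI) (hproj (inl (free_hopf_var c i)))"
      using c by (subst HCA_structure(4)) (simp_all add: inl_var_closed P_structure(8) HC_closed free_hopf_antipode_var)
    moreover have "hproj (inl (free_hopf_var c i)) \<in> carrier (quot_hopf K P HI)"
      using alg_homs_closed[OF hproj inl_var_closed[OF c]] by simp
    ultimately show ?thesis
      using hopf_homD(4)[OF s[unfolded HCA_eq]] by simp
  qed
  have var_eq: "t (hproj (inl (free_hopf_var c i))) = t' (hproj (inl (free_hopf_var c i)))" if c: "c \<in> carrier C" for c i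
  proof (induction i)
    case 0
    show ?case
      using C_eq[OF c] by (simp add: HCA_iota_def HCA_ideal_eq free_hopf_incl_eq)
  next
    case (Suc i)
    then show ?case
      by (simp only: step[OF t c] step[OF t' c])
  qed
  have "t (hproj x) = t' (hproj x)" if x: "x \<in> carrier P" for x
  proof (rule hopf_coprod_hom_eq[OF UHC hopf_algebra_unital[OF A] UH _ _ _ _ x])
    show "(\<lambda>x. t (hproj x)) \<in> alg_homs P H" "(\<lambda>x. t' (hproj x)) \<in> alg_homs P H"
      by (rule alg_homs_comp[OF alg[OF t] hproj], rule alg_homs_comp[OF alg[OF t'] hproj])
    show "t (hproj (inl y)) = t' (hproj (inl y))" if "y \<in> carrier HC" for y
      by (rule free_hopf_hom_eq[OF UH alg_homs_comp[OF alg[OF t] hproj_inl] alg_homs_comp[OF alg[OF t'] hproj_inl] var_eq that])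
    show "t (hproj (inr a)) = t' (hproj (inr a))" if "a \<in> carrier A" for a
      using A_eq[OF that] by (simp add: HCA_jmath_def HCA_ideal_eq)
  qed
  then show ?thesis
    using u by (auto simp: HCA_eq quot_module_carrier)
qed

lemma HCA_lift:
  assumes H: "hopf_algebra K H" and f: "f \<in> coalgebra_hom K C H" and g: "g \<in> hopf_hom K A H"
    and mult: "\<And>c a. \<lbrakk>c \<in> carrier C; a \<in> carrier A\<rbrakk> \<Longrightarrow> f (act c a) = f c \<otimes>\<^bsub>H\<^esub> g a"
  obtains t where "t \<in> hopf_hom K (HCA K C A act) H"
    and "\<And>c. c \<in> carrier C \<Longrightarrow> t (HCA_iota K C A act (free_hopf_incl K C c)) = f c"
    and "\<And>a. a \<in> carrier A \<Longrightarrow> t (HCA_jmath K C A act a) = g a"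
proof -
  note UH = hopf_algebra_unital[OF H] and preH = hopf_algebra_prehopf[OF H]
  obtain t1 where t1: "t1 \<in> hopf_hom K HC H"
    and t1v: "\<And>c i. c \<in> carrier C \<Longrightarrow> t1 (free_hopf_var c i) = (antipode H ^^ i) (f c)"
    by (rule free_hopf_lift[OF H f]) blast
  obtain t2 where t2: "t2 \<in> hopf_hom K P H"
    and t2l: "\<And>x. x \<in> carrier HC \<Longrightarrow> t2 (inl x) = t1 x" and t2r: "\<And>y. y \<in> carrier A \<Longrightarrow> t2 (inr y) = g y"
    by (rule hopf_coprod_lift[OF prehopf_free_hopf hopf_algebra_prehopf[OF A] preH t1 g]) blast
  have kill: "t2 s = \<zero>\<^bsub>H\<^esub>" if s: "s \<in> HCA_rels" for s
  proof -
    obtain c a where c: "c \<in> carrier C" and a: "a \<in> carrier A"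
      and s: "s = inl (free_hopf_var (act c a) 0) \<ominus>\<^bsub>P\<^esub> inl (free_hopf_var c 0) \<otimes>\<^bsub>P\<^esub> inr a"
      using s unfolding HCA_rels_def by blast
    have "f c \<in> carrier H"
      using f c by (auto simp: coalgebra_hom_def linear_maps_def)
    then show ?thesis
      \<comment> \<open>The relation lies in degree 0, where the power of the antipode is the
        identity, so it is mapped to f(c a) - f(c) \<phi>(a).\<close>
      unfolding s alg_hom_HCA_rel[OF UH hopf_homD(1)[OF t2] c a] using c a
      by (simp add: t2l t2r t1v HC_closed act_closed mult minus_self[OF module_unital_algebra[OF UH]]
        algebra_mult_closed[OF UH] alg_homs_closed[OF hopf_homD(1)[OF g]])
  qed
  note lift = quot_hopf_hom[OF P_structure(1) preH HCA_rels_subset HCA_structure(2,3,4) t2 kill]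
  show thesis
  proof (rule that)
    show "coset_lift t2 \<in> hopf_hom K (HCA K C A act) H"
      unfolding HCA_eq by (rule lift(1))
    have l: "coset_lift t2 (hproj x) = t2 x" if "x \<in> carrier P" for x
      by (rule lift(2)) (use that in auto)
    show "coset_lift t2 (HCA_iota K C A act (free_hopf_incl K C c)) = f c" if "c \<in> carrier C" for c
      using that by (simp add: HCA_iota_def HCA_ideal_eq free_hopf_incl_eq l inl_var_closed t2l HC_closed t1v)
    show "coset_lift t2 (HCA_jmath K C A act a) = g a" if "a \<in> carrier A" for a
      using that by (simp add: HCA_jmath_def HCA_ideal_eq l inr_closed t2r)
  qed
qed

lemma HCA_gens_closed:
  "c \<in> carrier C \<Longrightarrow> HCA_iota K C A act (free_hopf_incl K C c) \<in> carrier (HCA K C A act)"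
  "a \<in> carrier A \<Longrightarrow> HCA_jmath K C A act a \<in> carrier (HCA K C A act)"
  using alg_homs_closed[OF hproj inl_var_closed] alg_homs_closed[OF hproj inr_closed]
  by (simp_all add: HCA_iota_def HCA_jmath_def HCA_ideal_eq HCA_eq free_hopf_incl_eq)

end

theorem proposition2p4:
  fixes K :: "('k, 'r) ring_scheme"
    and A :: "('k, 'a, 'm) hopf_scheme"
    and C :: "('k, 'c, 'n) coalg_scheme"
    and H :: "('k, 'h, 'p) hopf_scheme"
    and act :: "'c \<Rightarrow> 'a \<Rightarrow> 'c"
    and f :: "'c \<Rightarrow> 'h" and \<phi> :: "'a \<Rightarrow> 'h"
  assumes "field K"
    and "hopf_algebra K A"
    and "module_coalgebra K A C act"
    and "hopf_algebra K H"
    and "f \<in> coalgebra_hom K C H"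
    and "\<phi> \<in> hopf_hom K A H"
    and "\<And>a c. \<lbrakk>a \<in> carrier A; c \<in> carrier C\<rbrakk> \<Longrightarrow> f (act c a) = f c \<otimes>\<^bsub>H\<^esub> \<phi> a"
  shows "\<exists>!t. t \<in> hopf_hom K (HCA K C A act) H \<inter> extensional (carrier (HCA K C A act)) \<and>
           (\<forall>c \<in> carrier C. f c = t (HCA_iota K C A act (free_hopf_incl K C c))) \<and>
           (\<forall>a \<in> carrier A. \<phi> a = t (HCA_jmath K C A act a))"
proof -
  have "coalgebra K C"
    using assms(3) by (simp add: module_coalgebra_def)
  then interpret takeuchi_module_coalgebra K C A act
    using assms(1-3)
    by (intro takeuchi_module_coalgebra.intro takeuchi.intro ground_field.intro takeuchi_axioms.intro
      takeuchi_module_coalgebra_axioms.intro)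
  let ?Q = "HCA K C A act"
  obtain t where t: "t \<in> hopf_hom K ?Q H"
    and tC: "\<And>c. c \<in> carrier C \<Longrightarrow> t (HCA_iota K C A act (free_hopf_incl K C c)) = f c"
    and tA: "\<And>a. a \<in> carrier A \<Longrightarrow> t (HCA_jmath K C A act a) = \<phi> a"
    using HCA_lift[OF assms(4-6)] assms(7) by blast
  have pre: "prehopf ?Q"
    unfolding HCA_eq by (rule HCA_structure(1))
  show ?thesis
  proof (rule ex1I)
    \<comment> \<open>A homomorphism is determined on the carrier only; the restriction,
      \<open>undefined\<close> elsewhere, is the one representative in
      \<open>extensional\<close>.\<close>
    show "restrict t (carrier ?Q) \<in> hopf_hom K ?Q H \<inter> extensional (carrier ?Q) \<and>
        (\<forall>c \<in> carrier C. f c = restrict t (carrier ?Q) (HCA_iota K C A act (free_hopf_incl K C c))) \<and>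
        (\<forall>a \<in> carrier A. \<phi> a = restrict t (carrier ?Q) (HCA_jmath K C A act a))"
      using hopf_hom_cong[OF pre hopf_algebra_unital[OF assms(4)] t, of "restrict t (carrier ?Q)"]
      by (simp add: HCA_gens_closed tC tA)
  next
    fix t' assume t': "t' \<in> hopf_hom K ?Q H \<inter> extensional (carrier ?Q) \<and>
        (\<forall>c \<in> carrier C. f c = t' (HCA_iota K C A act (free_hopf_incl K C c))) \<and>
        (\<forall>a \<in> carrier A. \<phi> a = t' (HCA_jmath K C A act a))"
    have "t' x = t x" if "x \<in> carrier ?Q" for x
      by (rule HCA_hom_eq[OF assms(4) _ t _ _ that]) (use t' in \<open>simp_all add: tC tA\<close>)
    then show "t' = restrict t (carrier ?Q)"
      using t' by (intro extensionalityI[of _ "carrier ?Q"]) auto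
  qed
qed

end
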